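(* For every $t\ge0$, $$\mathcal L_t\le\|\bar r_t\|^2+(k*\mathcal L)(t),\qquad V_t\le(k*\mathcal L)(t),$$ and the kernel mass is $$\|k\|_{L^1(0,\infty)}=\frac\gamma2\sum_{i=1}^m\mu_i^2\lambda_i=\frac\gamma2\mu_\star^2\operatorname{Tr}K=\nu.$$ If $\nu<1$, the resolvent $\mathcal Q:=\sum_{\ell\ge1}k^{*\ell}$ converges in $L^1(0,\infty)$, with $$\|\mathcal Q\|_{L^1(0,\infty)}=\frac{\nu}{1-\nu},$$ and for every $t\ge0$, $$\mathcal L_t\le\|\bar r_t\|^2+\bigl(\mathcal Q*\|\bar r_\cdot\|^2\bigr)(t),\qquad V_t\le\bigl(\mathcal Q*\|\bar r_\cdot\|^2\bigr)(t),\qquad \sup_{t\ge0}\mathcal L_t\le\frac{\|r_0\|^2}{1-\nu}.$$ If moreover $\nu\le\frac18$ (equivalently $\gamma\mu_\star^2\kappa\le\frac14$), then $\|\mathcal Q\|_{L^1(0,\infty)}\le\frac17$.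
   Context: Setting. Let $n,d\ge1$, let $X\in\mathbb R^{n\times d}$ be a nonzero matrix with rows $x_1^\top,\dots,x_n^\top$, let $\theta^\star,\theta_0\in\mathbb R^d$ and $\varepsilon\in\mathbb R^n$ be deterministic with $\|\varepsilon\|\le\sqrt n\,\delta$, $\delta>0$, and let $y=X\theta^\star+\varepsilon$. Let $\gamma>0$ (step size). $\|\cdot\|$ is the Euclidean norm and $\mathbf 1\in\mathbb R^n$ the all-ones vector. Spectrum and incoherence. $\Sigma:=\frac1nX^\top X$ and $K:=\frac1nXX^\top$ share their nonzero eigenvalues $\lambda_1\ge\dots\ge\lambda_m>0$ (with multiplicity), $m=\operatorname{rank}X$. Write $\Sigma=\sum_{j\le m}\lambda_jv_jv_j^\top$ with $(v_j)$ orthonormal, and $u_j:=(n\lambda_j)^{-1/2}Xv_j\in\mathbb R^n$ for $j\le m$. Set $\kappa:=\operatorname{Tr}K$, $\mu_j^2:=n\max_{i\le n}u_{j,i}^2$ for $j\le m$, $\mu^2:=\max_{j\le m}\mu_j^2$, $\mu_\star^2:=\frac1\kappa\sum_{j\le m}\mu_j^2\lambda_j$, and $\nu:=\frac\gamma2\mu_\star^2\kappa$. Dynamics. $(W_t)_{t\ge0}$ is an $n$-dimensional Brownian motion and $(\theta_t)_{t\ge0}$ is the unique strong solution, started at $\theta_0$, of $$\mathrm d\theta_t=-\tfrac1nX^\top(X\theta_t-y)\,\mathrm dt+\sqrt{\tfrac\gamma n}\,X^\top R_t\,\mathrm dW_t,\qquad R_t:=\operatorname{diag}(r_t)-\tfrac1nr_t\mathbf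 1^\top,\qquad r_t:=X\theta_t-y,$$ so that $\mathrm dr_t=-Kr_t\,\mathrm dt+\sqrt{\gamma n}\,KR_t\,\mathrm dW_t$. Notation. $\bar r_t:=\mathbb E[r_t]$, $\tilde r_t:=r_t-\bar r_t$, $V_t:=\mathbb E\|\tilde r_t\|^2$, $\mathcal L_t:=\mathbb E\|r_t\|^2=\|\bar r_t\|^2+V_t$. The kernel is $k(u):=\gamma\sum_{i=1}^m\mu_i^2\lambda_i^2e^{-2\lambda_iu}$, $u\ge0$; $(f*g)(t):=\int_0^tf(t-s)g(s)\,\mathrm ds$ is the causal convolution and $k^{*\ell}$ the $\ell$-fold convolution power of $k$. *)

theory Defs
  imports "HOL-Probability.Probability"
begin

section \<open>Vectors and matrices\<close>

definition outer_prod :: "real ^ 'a \<Rightarrow> real ^ 'b \<Rightarrow> real ^ 'b ^ 'a" where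
  "outer_prod x y = (\<chi> i j. x $ i * y $ j)"

definition diag_mat :: "real ^ 'a \<Rightarrow> real ^ 'a ^ 'a" where
  "diag_mat x = (\<chi> i j. if i = j then x $ i else 0)"

text \<open>In the next definition \<open>1 :: real ^ 'n\<close> is the all-ones vector.\<close>

definition noise_matrix :: "real ^ 'n \<Rightarrow> real ^ 'n ^ 'n" where
  "noise_matrix r = diag_mat r - (1 / real CARD('n)) *\<^sub>R outer_prod r (1 :: real ^ 'n)"


section \<open>Brownian motion\<close>

definition natural_filtration ::
    "'w measure \<Rightarrow> (real \<Rightarrow> 'w \<Rightarrow> 'e::topological_space) \<Rightarrow> real \<Rightarrow> 'w measure" where
  "natural_filtration M W t =
     sigma (space M) {W s -` A \<inter> space M | s A. 0 \<le> s \<and> s \<le> t \<and> A \<in> sets borel}"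

definition augmented_filtration ::
    "'w measure \<Rightarrow> (real \<Rightarrow> 'w \<Rightarrow> 'e::topological_space) \<Rightarrow> real \<Rightarrow> 'w measure" where
  "augmented_filtration M W t =
     sigma (space M) (sets (natural_filtration M W t) \<union> null_sets M)"

text \<open>Standard Brownian motion in \<open>real ^ 'n\<close>, started at the origin, on the probability space
  \<open>M\<close>. Only times \<open>t \<ge> 0\<close> are meaningful.\<close>

definition brownian_motion :: "'w measure \<Rightarrow> (real \<Rightarrow> 'w \<Rightarrow> real ^ 'n) \<Rightarrow> bool" where
  "brownian_motion M W \<longleftrightarrow>
     prob_space M \<and>
     (\<forall>t\<ge>0. W t \<in> borel_measurable M) \<and>
     (AE \<omega> in M. W 0 \<omega> = 0) \<and>
     (AE \<omega> in M. continuous_on {0..} (\<lambda>t. W t \<omega>)) \<and>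
     (\<forall>s t. 0 \<le> s \<and> s < t \<longrightarrow>
        (\<forall>i. distributed M lborel (\<lambda>\<omega>. (W t \<omega> - W s \<omega>) $ i)
               (\<lambda>x. ennreal (normal_density 0 (sqrt (t - s)) x))) \<and>
        prob_space.indep_vars M (\<lambda>_. borel) (\<lambda>i \<omega>. (W t \<omega> - W s \<omega>) $ i) UNIV \<and>
        prob_space.indep_set M
          (sets (natural_filtration M W s))
          (sets (vimage_algebra (space M) (\<lambda>\<omega>. W t \<omega> - W s \<omega>) borel)))"


section \<open>The Ito integral\<close>

definition tendsto_in_prob ::
    "'w measure \<Rightarrow> (nat \<Rightarrow> 'w \<Rightarrow> 'e::metric_space) \<Rightarrow> ('w \<Rightarrow> 'e) \<Rightarrow> bool" where
  "tendsto_in_prob M Y Z \<longleftrightarrow>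
     (\<forall>e>0. (\<lambda>N. measure M {\<omega> \<in> space M. e < dist (Y N \<omega>) (Z \<omega>)}) \<longlonglongrightarrow> 0)"

text \<open>An elementary process is given by a number \<open>N\<close> of intervals, their end points
  \<open>p 0 < \<dots> < p N\<close>, and bounded coefficients \<open>\<xi> k\<close>, known at time \<open>p k\<close>; it takes the value \<open>\<xi> k\<close>
  on \<open>{p k <.. p (Suc k)}\<close>. Integrands are matrix-valued, and the norm of \<open>real ^ 'n ^ 'd\<close> is the
  Frobenius norm.\<close>

definition elementary ::
    "'w measure \<Rightarrow> (real \<Rightarrow> 'w measure) \<Rightarrow> nat \<Rightarrow> (nat \<Rightarrow> real) \<Rightarrow>
     (nat \<Rightarrow> 'w \<Rightarrow> real ^ 'n ^ 'd) \<Rightarrow> bool" where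
  "elementary M F N p \<xi> \<longleftrightarrow>
     0 \<le> p 0 \<and> (\<forall>k<N. p k < p (Suc k)) \<and>
     (\<forall>k<N. \<xi> k \<in> borel_measurable (F (p k)) \<and> bounded (\<xi> k ` space M))"

definition elementary_process ::
    "nat \<Rightarrow> (nat \<Rightarrow> real) \<Rightarrow> (nat \<Rightarrow> 'w \<Rightarrow> real ^ 'n ^ 'd) \<Rightarrow> real \<Rightarrow> 'w \<Rightarrow> real ^ 'n ^ 'd" where
  "elementary_process N p \<xi> s \<omega> = (\<Sum>k<N. indicator {p k <.. p (Suc k)} s *\<^sub>R \<xi> k \<omega>)"

definition elementary_integral ::
    "nat \<Rightarrow> (nat \<Rightarrow> real) \<Rightarrow> (nat \<Rightarrow> 'w \<Rightarrow> real ^ 'n ^ 'd) \<Rightarrow> (real \<Rightarrow> 'w \<Rightarrow> real ^ 'n) \<Rightarrow>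
     real \<Rightarrow> 'w \<Rightarrow> real ^ 'd" where
  "elementary_integral N p \<xi> W t \<omega> =
     (\<Sum>k<N. \<xi> k \<omega> *v (W (min (p (Suc k)) t) \<omega> - W (min (p k) t) \<omega>))"

definition progressively_measurable ::
    "(real \<Rightarrow> 'w measure) \<Rightarrow> (real \<Rightarrow> 'w \<Rightarrow> 'e::topological_space) \<Rightarrow> real \<Rightarrow> bool" where
  "progressively_measurable F H t \<longleftrightarrow>
     (\<forall>T. 0 \<le> T \<and> T \<le> t \<longrightarrow>
        (\<lambda>(s, \<omega>). H s \<omega>) \<in> borel_measurable (restrict_space borel {0..T} \<Otimes>\<^sub>M F T))"

text \<open>\<open>is_ito_integral M F W H t J\<close>: the random variable \<open>J\<close> is a version of the Ito integral
  of \<open>H\<close> against \<open>W\<close> over \<open>{0..t}\<close>. The integrand need only be progressively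
  measurable with almost surely square integrable paths; no moments of \<open>H\<close> are required. The
  integral is the limit in probability of the integrals of elementary processes that approximate
  \<open>H\<close> in \<open>L\<^sup>2({0..t})\<close>, in probability.\<close>

definition is_ito_integral ::
    "'w measure \<Rightarrow> (real \<Rightarrow> 'w measure) \<Rightarrow> (real \<Rightarrow> 'w \<Rightarrow> real ^ 'n) \<Rightarrow>
     (real \<Rightarrow> 'w \<Rightarrow> real ^ 'n ^ 'd) \<Rightarrow> real \<Rightarrow> ('w \<Rightarrow> real ^ 'd) \<Rightarrow> bool" where
  "is_ito_integral M F W H t J \<longleftrightarrow>
     progressively_measurable F H t \<and>
     (AE \<omega> in M. set_integrable lborel {0..t} (\<lambda>s. (norm (H s \<omega>))\<^sup>2)) \<and>
     J \<in> borel_measurable M \<and>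
     (\<exists>N p \<xi>.
        (\<forall>j. elementary M F (N j) (p j) (\<xi> j)) \<and>
        tendsto_in_prob M
          (\<lambda>j \<omega>. LBINT s:{0..t}. (norm (elementary_process (N j) (p j) (\<xi> j) s \<omega> - H s \<omega>))\<^sup>2)
          (\<lambda>_. 0) \<and>
        tendsto_in_prob M (\<lambda>j. elementary_integral (N j) (p j) (\<xi> j) W t) J)"


section \<open>Strong solutions\<close>

text \<open>Strong solutions of \<open>d\<theta> = b(\<theta>) dt + \<sigma>(\<theta>) dW\<close> with deterministic initial value \<open>\<theta>0\<close>: continuous,
  adapted to the augmented filtration of the given Brownian motion.\<close>

definition strong_solution ::
    "'w measure \<Rightarrow> (real \<Rightarrow> 'w \<Rightarrow> real ^ 'n) \<Rightarrow> (real ^ 'd \<Rightarrow> real ^ 'd) \<Rightarrow>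
     (real ^ 'd \<Rightarrow> real ^ 'n ^ 'd) \<Rightarrow> real ^ 'd \<Rightarrow> (real \<Rightarrow> 'w \<Rightarrow> real ^ 'd) \<Rightarrow> bool" where
  "strong_solution M W b \<sigma> \<theta>0 \<theta> \<longleftrightarrow>
     (\<forall>t\<ge>0. \<theta> t \<in> borel_measurable (augmented_filtration M W t)) \<and>
     (AE \<omega> in M. continuous_on {0..} (\<lambda>t. \<theta> t \<omega>)) \<and>
     (AE \<omega> in M. \<theta> 0 \<omega> = \<theta>0) \<and>
     (\<forall>t\<ge>0.
        (AE \<omega> in M. set_integrable lborel {0..t} (\<lambda>s. b (\<theta> s \<omega>))) \<and>
        (\<exists>J. is_ito_integral M (augmented_filtration M W) W (\<lambda>s \<omega>. \<sigma> (\<theta> s \<omega>)) t J \<and>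
             (AE \<omega> in M. \<theta> t \<omega> = \<theta>0 + (LBINT s:{0..t}. b (\<theta> s \<omega>)) + J \<omega>)))"


section \<open>Causal convolution on the half-line\<close>

definition L1_norm :: "(real \<Rightarrow> real) \<Rightarrow> real" where
  "L1_norm f = (LBINT u:{0<..}. \<bar>f u\<bar>)"

definition tendsto_in_L1 :: "(nat \<Rightarrow> real \<Rightarrow> real) \<Rightarrow> (real \<Rightarrow> real) \<Rightarrow> bool" where
  "tendsto_in_L1 S f \<longleftrightarrow>
     (\<forall>N. set_integrable lborel {0<..} (S N)) \<and>
     set_integrable lborel {0<..} f \<and>
     (\<lambda>N. L1_norm (\<lambda>u. S N u - f u)) \<longlonglongrightarrow> 0"

definition causal_conv :: "(real \<Rightarrow> real) \<Rightarrow> (real \<Rightarrow> real) \<Rightarrow> real \<Rightarrow> real" where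
  "causal_conv f g t = (LBINT s:{0..t}. f (t - s) * g s)"

text \<open>\<open>conv_power f l\<close> is the \<open>l\<close>-fold convolution power, for \<open>l \<ge> 1\<close>.\<close>

definition conv_power :: "(real \<Rightarrow> real) \<Rightarrow> nat \<Rightarrow> real \<Rightarrow> real" where
  "conv_power f l = (causal_conv f ^^ (l - 1)) f"

text \<open>The sum over \<open>l \<ge> 1\<close> is taken pointwise here. Convergence of the partial sums to it,
  pointwise or in \<open>L\<^sup>1\<close>, is not part of the definition.\<close>

definition resolvent :: "(real \<Rightarrow> real) \<Rightarrow> real \<Rightarrow> real" where
  "resolvent f u = (\<Sum>l. conv_power f (Suc l) u)"

end

theory Submission
  imports Defs
begin

text \<open>
  The residual \<open>r\<close> satisfies a linear equation with multiplicative noise. In the eigenbasis \<open>u j\<close> of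
  the kernel matrix its coordinates solve \<open>dx = - \<lambda> x dt + dM\<close>, and the part of \<open>r\<close> orthogonal to all
  \<open>u j\<close> never moves, because the range of \<open>X\<close> is spanned by the \<open>u j\<close>. Variation of constants gives
  \<open>exp (\<lambda> t) x t - x 0 = \<integral> exp (\<lambda> s) dM s\<close>, and the Ito isometry together with
  \<open>\<bar>R\<^sup>T u j\<bar>\<^sup>2 \<le> (max\<^sub>i u j i\<^sup>2) \<bar>r\<bar>\<^sup>2\<close> bounds the second moment of the right-hand side by
  \<open>\<gamma> \<mu> j\<^sup>2 \<lambda>\<^sup>2 \<integral> exp (2 \<lambda> s) L s ds\<close>. Summing over the modes yields \<open>V \<le> k * L\<close>. The right-hand side also
  has mean zero, so that \<open>E r t = exp (- K t) r 0\<close>; this gives \<open>L = \<bar>E r\<bar>\<^sup>2 + V\<close> and \<open>\<bar>E r t\<bar> \<le> \<bar>r 0\<bar>\<close>.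
  The rest is the theory of the scalar Volterra inequality \<open>L \<le> \<rho> + k * L\<close>: for \<open>\<nu> < 1\<close> iteration
  replaces \<open>k\<close> by its resolvent.

  The Ito integral is given only as a limit in probability, separately for each time, and no moment
  of the solution is known beforehand. The argument therefore never leaves finite sums of Brownian
  increments.

  \<^item> \<open>step_sum_moments\<close> is the Ito isometry for such sums, and \<open>step_sum_lenglart\<close> controls them in
    probability by their quadratic variation alone, without any integrability.

  \<^item> On the event \<open>tame N T\<close> that \<open>\<bar>r\<bar>\<close> stays below \<open>N\<close> up to time \<open>T\<close>, the Ito integral at
    each time is close to Riemann sums of the integrand cut off at level \<open>N\<close>
    (\<open>riemann_sum_approximates_ito_integral\<close>). The integrals at different times thereby become
    consistent with each other.

  \<^item> A discrete variation of constants along a coarse time grid then approximates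
    \<open>exp (\<lambda> T) x T - x 0\<close> by centred sums whose second moment is explicit
    (\<open>mode_approximation\<close>). Limits in probability of such sums inherit the bound on the second moment
    by truncation, and the vanishing mean by uniform integrability.

  \<^item> Applied with the cut-off moments \<open>E[\<bar>r s\<bar>\<^sup>2; tame N s]\<close> on both sides, this is a Gronwall inequality
    whose conclusion does not depend on \<open>N\<close> (\<open>tame_moment_bound\<close>). Letting \<open>N\<close> tend to infinity
    gives square integrability (\<open>second_moment\<close>), and further applications give
    the sharp bound (\<open>variance_bound\<close>) and the mean (\<open>mean_residual\<close>).

  The Volterra part works with convolutions of \<open>[0,\<infinity>]\<close>-valued functions on the whole line, where
  Tonelli's theorem needs no integrability; \<open>volterra\<close> collects its conclusions.
\<close>

section \<open>Causal convolution of nonnegative functions\<close>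

text \<open>Extension by zero to the negative half-line turns the causal convolution into the ordinary one on
  the line, and values in \<open>ennreal\<close> allow Tonelli's theorem without integrability conditions.\<close>

definition causal :: "(real \<Rightarrow> real) \<Rightarrow> real \<Rightarrow> ennreal" where
  "causal f s = ennreal (f s) * indicator {0..} s"

definition nn_conv :: "(real \<Rightarrow> ennreal) \<Rightarrow> (real \<Rightarrow> ennreal) \<Rightarrow> real \<Rightarrow> ennreal" (infixl "\<star>" 70) where
  "(f \<star> g) t = (\<integral>\<^sup>+ s. f (t - s) * g s \<partial>lborel)"

lemma nn_conv_measurable [measurable]:
  assumes [measurable]: "f \<in> borel_measurable borel" "g \<in> borel_measurable borel"
  shows "f \<star> g \<in> borel_measurable borel"
  unfolding nn_conv_def[abs_def] by measurable

lemma nn_integral_reflect_shift: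
  fixes f :: "real \<Rightarrow> ennreal"
  assumes [measurable]: "f \<in> borel_measurable borel"
  shows "(\<integral>\<^sup>+ s. f (t - s) \<partial>lborel) = (\<integral>\<^sup>+ s. f s \<partial>lborel)"
  using nn_integral_real_affine[of f "-1" t] by simp

lemma nn_integral_shift:
  fixes f :: "real \<Rightarrow> ennreal"
  assumes [measurable]: "f \<in> borel_measurable borel"
  shows "(\<integral>\<^sup>+ s. f (s - t) \<partial>lborel) = (\<integral>\<^sup>+ s. f s \<partial>lborel)"
  using nn_integral_real_affine[of f 1 "-t"] by simp

text \<open>Tonelli and translation invariance of Lebesgue measure. Associativity is what lets the
  Volterra inequality be iterated.\<close>

lemma nn_conv_assoc:
  assumes [measurable]: "f \<in> borel_measurable borel" "g \<in> borel_measurable borel" "h \<in> borel_measurable borel"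
  shows "f \<star> (g \<star> h) = (f \<star> g) \<star> h"
proof
  fix t
  have "(f \<star> (g \<star> h)) t = (\<integral>\<^sup>+ s. \<integral>\<^sup>+ u. f (t - s) * (g (s - u) * h u) \<partial>lborel \<partial>lborel)"
    unfolding nn_conv_def by (intro nn_integral_cong nn_integral_cmult[symmetric]) measurable
  also have "\<dots> = (\<integral>\<^sup>+ u. \<integral>\<^sup>+ s. f (t - s) * (g (s - u) * h u) \<partial>lborel \<partial>lborel)"
    by (rule lborel_pair.Fubini') measurable
  also have "\<dots> = (\<integral>\<^sup>+ u. (f \<star> g) (t - u) * h u \<partial>lborel)"
  proof (rule nn_integral_cong)
    fix u
    have "(\<integral>\<^sup>+ s. f (t - s) * (g (s - u) * h u) \<partial>lborel) = (\<integral>\<^sup>+ s. f (t - u - (s - u)) * g (s - u) \<partial>lborel) * h u"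
      by (subst nn_integral_multc[symmetric]) (auto simp: mult.assoc)
    also have "(\<integral>\<^sup>+ s. f (t - u - (s - u)) * g (s - u) \<partial>lborel) = (f \<star> g) (t - u)"
      unfolding nn_conv_def by (rule nn_integral_shift[of "\<lambda>s. f (t - u - s) * g s"]) measurable
    finally show "(\<integral>\<^sup>+ s. f (t - s) * (g (s - u) * h u) \<partial>lborel) = (f \<star> g) (t - u) * h u" .
  qed
  finally show "(f \<star> (g \<star> h)) t = ((f \<star> g) \<star> h) t" unfolding nn_conv_def .
qed

lemma nn_conv_add_left:
  assumes [measurable]: "f \<in> borel_measurable borel" "f' \<in> borel_measurable borel" "g \<in> borel_measurable borel"
  shows "((\<lambda>s. f s + f' s) \<star> g) t = (f \<star> g) t + (f' \<star> g) t"
  unfolding nn_conv_def by (subst nn_integral_add[symmetric]) (auto simp: distrib_right)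

lemma nn_conv_add_right:
  assumes [measurable]: "f \<in> borel_measurable borel" "g \<in> borel_measurable borel" "g' \<in> borel_measurable borel"
  shows "(f \<star> (\<lambda>s. g s + g' s)) t = (f \<star> g) t + (f \<star> g') t"
  unfolding nn_conv_def by (subst nn_integral_add[symmetric]) (auto simp: distrib_left)

lemma nn_conv_mass:
  assumes [measurable]: "f \<in> borel_measurable borel" "g \<in> borel_measurable borel"
  shows "(\<integral>\<^sup>+ t. (f \<star> g) t \<partial>lborel) = (\<integral>\<^sup>+ t. f t \<partial>lborel) * (\<integral>\<^sup>+ t. g t \<partial>lborel)"
proof -
  have "(\<integral>\<^sup>+ t. (f \<star> g) t \<partial>lborel) = (\<integral>\<^sup>+ s. \<integral>\<^sup>+ t. f (t - s) * g s \<partial>lborel \<partial>lborel)"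
    unfolding nn_conv_def by (rule lborel_pair.Fubini') measurable
  also have "\<dots> = (\<integral>\<^sup>+ s. (\<integral>\<^sup>+ t. f t \<partial>lborel) * g s \<partial>lborel)"
    using nn_integral_shift[of f] by (intro nn_integral_cong) (simp add: nn_integral_multc)
  also have "\<dots> = (\<integral>\<^sup>+ t. f t \<partial>lborel) * (\<integral>\<^sup>+ t. g t \<partial>lborel)"
    by (rule nn_integral_cmult) measurable
  finally show ?thesis .
qed

text \<open>The bridge between the two notions of convolution. The Bochner integral of a nonnegative function is
  the Lebesgue integral, or 0 if that is infinite; so finiteness matters only for integrability.\<close>

lemma causal_conv_nn_conv:
  assumes [measurable]: "causal f \<in> borel_measurable borel" "causal g \<in> borel_measurable borel"
    and nn: "\<And>s. 0 \<le> s \<Longrightarrow> 0 \<le> f s" "\<And>s. 0 \<le> s \<Longrightarrow> 0 \<le> g s"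
  shows "causal_conv f g t = enn2real ((causal f \<star> causal g) t)"
    "(causal f \<star> causal g) t < \<infinity> \<Longrightarrow> set_integrable lborel {0..t} (\<lambda>s. f (t - s) * g s)"
    "0 \<le> causal_conv f g t"
proof -
  have eq: "indicator {0..t} s *\<^sub>R (f (t - s) * g s) = enn2real (causal f (t - s)) * enn2real (causal g s)" for s
    using nn by (auto simp: causal_def indicator_def)
  have meas: "(\<lambda>s. indicator {0..t} s *\<^sub>R (f (t - s) * g s)) \<in> borel_measurable lborel"
    unfolding eq by measurable
  have nn': "0 \<le> indicator {0..t} s *\<^sub>R (f (t - s) * g s)" for s
    unfolding eq by simp
  have int: "(\<integral>\<^sup>+ s. ennreal (indicator {0..t} s *\<^sub>R (f (t - s) * g s)) \<partial>lborel) = (causal f \<star> causal g) t"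
    unfolding nn_conv_def using nn
    by (intro nn_integral_cong) (auto simp: causal_def indicator_def ennreal_mult)
  show 1: "causal_conv f g t = enn2real ((causal f \<star> causal g) t)"
    unfolding causal_conv_def set_lebesgue_integral_def int[symmetric]
    using meas nn' by (intro integral_eq_nn_integral) auto
  show "0 \<le> causal_conv f g t" unfolding 1 by simp
  show "set_integrable lborel {0..t} (\<lambda>s. f (t - s) * g s)" if "(causal f \<star> causal g) t < \<infinity>"
    unfolding set_integrable_def using meas that nn'
    by (subst integrable_iff_bounded) (simp add: int[symmetric] del: real_scaleR_def)
qed

lemma causal_measurable:
  "f \<in> borel_measurable borel \<Longrightarrow> causal f \<in> borel_measurable borel"
  unfolding causal_def[abs_def] by (intro borel_measurable_times_ennreal borel_measurable_indicator) auto

lemma nn_conv_negative: "t < 0 \<Longrightarrow> (causal f \<star> causal g) t = 0"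
proof -
  assume "t < 0"
  then have "causal f (t - s) * causal g s = 0" for s by (auto simp: causal_def indicator_def)
  then show ?thesis unfolding nn_conv_def by (simp only: nn_integral_const mult_zero_left)
qed

lemma causal_causal_conv:
  assumes "causal f \<in> borel_measurable borel" "causal g \<in> borel_measurable borel"
    and "\<And>s. 0 \<le> s \<Longrightarrow> 0 \<le> f s" "\<And>s. 0 \<le> s \<Longrightarrow> 0 \<le> g s"
    and fin: "\<And>t. 0 \<le> t \<Longrightarrow> (causal f \<star> causal g) t < \<infinity>"
  shows "causal (causal_conv f g) = causal f \<star> causal g"
proof
  fix t show "causal (causal_conv f g) t = (causal f \<star> causal g) t"
  proof (cases "0 \<le> t")
    case True
    have "causal_conv f g t = enn2real ((causal f \<star> causal g) t)"
      by (rule causal_conv_nn_conv) (use assms in auto)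
    then show ?thesis
      using fin[OF True] True by (simp add: causal_def[of "causal_conv f g"])
  next
    case False
    then show ?thesis using nn_conv_negative[of t f g] by (simp add: causal_def)
  qed
qed

lemma nn_conv_le:
  assumes [measurable]: "g \<in> borel_measurable borel" and "\<And>s. f s \<le> c"
  shows "(f \<star> g) t \<le> c * (\<integral>\<^sup>+ s. g s \<partial>lborel)"
proof -
  have "(f \<star> g) t \<le> (\<integral>\<^sup>+ s. c * g s \<partial>lborel)"
    unfolding nn_conv_def using assms(2) by (intro nn_integral_mono mult_right_mono) auto
  then show ?thesis by (simp add: nn_integral_cmult)
qed

lemma nn_conv_le_right:
  assumes [measurable]: "f \<in> borel_measurable borel" and "\<And>s. g s \<le> c"
  shows "(f \<star> g) t \<le> (\<integral>\<^sup>+ s. f s \<partial>lborel) * c"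
proof -
  have "(f \<star> g) t \<le> (\<integral>\<^sup>+ s. f (t - s) * c \<partial>lborel)"
    unfolding nn_conv_def using assms(2) by (intro nn_integral_mono mult_left_mono) auto
  then show ?thesis using nn_integral_reflect_shift[of f t] by (simp add: nn_integral_multc)
qed

text \<open>The open half-line differs from the support of \<open>causal f\<close> by the null set \<open>{0}\<close>.\<close>

lemma half_line_mass:
  assumes [measurable]: "causal f \<in> borel_measurable borel" and nn: "\<And>s. 0 \<le> s \<Longrightarrow> 0 \<le> f s"
    and mass: "(\<integral>\<^sup>+ s. causal f s \<partial>lborel) = ennreal m" and m: "0 \<le> m"
  shows "set_integrable lborel {0<..} f" "(LBINT s:{0<..}. f s) = m" "L1_norm f = m"
proof -
  have eq: "indicator {0<..} s *\<^sub>R f s = indicator {0<..} s * enn2real (causal f s)" for s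
    using nn by (auto simp: causal_def indicator_def)
  have "(\<integral>\<^sup>+ s. ennreal (indicator {0<..} s *\<^sub>R f s) \<partial>lborel) = (\<integral>\<^sup>+ s. causal f s \<partial>lborel)"
  proof (rule nn_integral_cong_AE)
    show "AE s in lborel. ennreal (indicator {0<..} s *\<^sub>R f s) = causal f s"
      using AE_lborel_singleton[of "0::real"]
      by eventually_elim (auto simp: causal_def indicator_def)
  qed
  moreover have "(\<lambda>s. indicator {0<..} s *\<^sub>R f s) \<in> borel_measurable lborel"
    unfolding eq by measurable
  moreover have "AE s in lborel. 0 \<le> indicator {0<..} s *\<^sub>R f s"
    unfolding eq by (intro AE_I2 mult_nonneg_nonneg) simp_all
  ultimately have "has_bochner_integral lborel (\<lambda>s. indicator {0<..} s *\<^sub>R f s) m"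
    using has_bochner_integral_nn_integral[OF _ _ m] mass by (simp only:)
  then show 1: "set_integrable lborel {0<..} f" "(LBINT s:{0<..}. f s) = m"
    by (auto simp: set_integrable_def set_lebesgue_integral_def has_bochner_integral_iff)
  have "L1_norm f = (LBINT s:{0<..}. f s)"
    unfolding L1_norm_def using nn by (intro set_lebesgue_integral_cong) auto
  then show "L1_norm f = m" using 1 by simp
qed

section \<open>The resolvent of a subcritical kernel\<close>

text \<open>Boundedness of the kernel makes the resolvent series converge pointwise and not only in \<open>L\<^sup>1\<close>.\<close>

locale subcritical_kernel =
  fixes k :: "real \<Rightarrow> real" and c \<nu> :: real
  assumes k_measurable [measurable]: "k \<in> borel_measurable borel"
    and k_nonneg: "\<And>s. 0 \<le> s \<Longrightarrow> 0 \<le> k s" and k_bound: "\<And>s. 0 \<le> s \<Longrightarrow> k s \<le> c"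
    and k_mass: "(\<integral>\<^sup>+ s. causal k s \<partial>lborel) = ennreal \<nu>"
    and \<nu>: "0 \<le> \<nu>" "\<nu> < 1"
begin

lemma c_nonneg: "0 \<le> c" using k_nonneg[of 0] k_bound[of 0] by simp

abbreviation "kp l \<equiv> conv_power k (Suc l)"

lemma kp_Suc: "kp (Suc l) = causal_conv k (kp l)" by (simp add: conv_power_def)

lemma causal_k_le: "causal k s \<le> ennreal c"
  using k_bound[of s] by (auto simp: causal_def indicator_def ennreal_leI)

lemma causal_k_measurable [measurable]: "causal k \<in> borel_measurable borel"
  by (rule causal_measurable) measurable

text \<open>The four claims need a joint induction: that \<open>conv_power\<close>, defined by Bochner integrals, agrees with
  the \<open>ennreal\<close> convolution depends on finiteness, which comes from the geometric bounds
  on the previous power.\<close>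

lemma kp_props:
  "causal (kp l) \<in> borel_measurable borel \<and> (\<forall>s\<ge>0. 0 \<le> kp l s \<and> kp l s \<le> c * \<nu> ^ l)
    \<and> (\<integral>\<^sup>+ s. causal (kp l) s \<partial>lborel) = ennreal (\<nu> ^ Suc l)
    \<and> causal (kp (Suc l)) = causal k \<star> causal (kp l)"
proof (induction l)
  case 0
  have fin: "(causal k \<star> causal k) t < \<infinity>" for t
    using nn_conv_le[of "causal k" "causal k" "ennreal c" t] causal_k_le k_mass
    by (auto simp: ennreal_mult[symmetric] c_nonneg \<nu> intro: order.strict_trans1)
  have "causal (causal_conv k k) = causal k \<star> causal k"
    using k_nonneg fin by (intro causal_causal_conv) auto
  moreover have "kp (Suc 0) = causal_conv k k" "kp 0 = k" by (simp_all add: conv_power_def)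
  ultimately show ?case using k_nonneg k_bound k_mass by auto
next
  case (Suc l)
  then have IH [measurable]: "causal (kp l) \<in> borel_measurable borel"
    and nn: "\<And>s. 0 \<le> s \<Longrightarrow> 0 \<le> kp l s" and mass: "(\<integral>\<^sup>+ s. causal (kp l) s \<partial>lborel) = ennreal (\<nu> ^ Suc l)"
    and eq: "causal (kp (Suc l)) = causal k \<star> causal (kp l)" by auto
  have bd: "(causal k \<star> causal (kp l)) t \<le> ennreal (c * \<nu> ^ Suc l)" for t
    using nn_conv_le[of "causal (kp l)" "causal k" "ennreal c" t] causal_k_le mass
    by (simp add: ennreal_mult[symmetric] c_nonneg \<nu>)
  have meas [measurable]: "causal (kp (Suc l)) \<in> borel_measurable borel" unfolding eq by measurable
  have mass': "(\<integral>\<^sup>+ s. causal (kp (Suc l)) s \<partial>lborel) = ennreal (\<nu> ^ Suc (Suc l))"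
    unfolding eq using nn_conv_mass[of "causal k" "causal (kp l)"] k_mass mass \<nu>
    by (simp add: ennreal_mult[symmetric])
  have vals: "0 \<le> kp (Suc l) s \<and> kp (Suc l) s \<le> c * \<nu> ^ Suc l" for s
  proof -
    have e: "kp (Suc l) s = enn2real ((causal k \<star> causal (kp l)) s)"
      unfolding kp_Suc using causal_conv_nn_conv(1)[of k "kp l" s] k_nonneg nn by simp
    have "enn2real ((causal k \<star> causal (kp l)) s) \<le> enn2real (ennreal (c * \<nu> ^ Suc l))"
      using bd by (intro enn2real_mono) auto
    then show ?thesis unfolding e using c_nonneg \<nu> by simp
  qed
  have fin: "(causal k \<star> causal (kp (Suc l))) t < \<infinity>" for t
    using nn_conv_le[of "causal (kp (Suc l))" "causal k" "ennreal c" t] causal_k_le mass'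
    by (auto simp: ennreal_mult[symmetric] c_nonneg \<nu> intro: order.strict_trans1)
  have "causal (kp (Suc (Suc l))) = causal k \<star> causal (kp (Suc l))"
    unfolding kp_Suc[of "Suc l"] using k_nonneg fin vals by (intro causal_causal_conv) auto
  then show ?case using meas mass' vals by blast
qed

lemma kp_measurable [measurable]: "causal (kp l) \<in> borel_measurable borel"
  and kp_nonneg: "0 \<le> s \<Longrightarrow> 0 \<le> kp l s"
  and kp_le: "0 \<le> s \<Longrightarrow> kp l s \<le> c * \<nu> ^ l"
  and kp_mass: "(\<integral>\<^sup>+ s. causal (kp l) s \<partial>lborel) = ennreal (\<nu> ^ Suc l)"
  and kp_conv: "causal (kp (Suc l)) = causal k \<star> causal (kp l)"
  using kp_props[of l] by blast+

abbreviation "Q \<equiv> resolvent k"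

lemma kp_summable:
  assumes s: "0 \<le> s"
  shows "summable (\<lambda>l. kp l s)"
proof (rule summable_comparison_test'[of "\<lambda>l. c * \<nu> ^ l" 0])
  show "summable (\<lambda>l. c * \<nu> ^ l)"
    by (intro summable_mult summable_geometric) (use \<nu> in simp)
  show "norm (kp l s) \<le> c * \<nu> ^ l" for l
    using kp_nonneg[OF s, of l] kp_le[OF s, of l] by simp
qed

lemma Q_nonneg: "0 \<le> s \<Longrightarrow> 0 \<le> Q s"
  unfolding resolvent_def by (intro suminf_nonneg kp_summable kp_nonneg)

lemma causal_Q: "causal Q = (\<lambda>s. \<Sum>l. causal (kp l) s)"
proof
  fix s show "causal Q s = (\<Sum>l. causal (kp l) s)"
  proof (cases "0 \<le> s")
    case True
    have "(\<Sum>l. ennreal (kp l s)) = ennreal (Q s)"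
      unfolding resolvent_def by (rule suminf_ennreal2[OF kp_nonneg[OF True] kp_summable[OF True]])
    then show ?thesis using True by (simp add: causal_def)
  qed (simp add: causal_def)
qed

lemma causal_Q_measurable [measurable]: "causal Q \<in> borel_measurable borel"
  unfolding causal_Q by measurable

lemma \<nu>_geometric: "(\<lambda>l. \<nu> ^ Suc l) sums (\<nu> / (1 - \<nu>))"
  using sums_mult[OF geometric_sums[of \<nu>], of \<nu>] \<nu> by simp

lemma Q_mass: "(\<integral>\<^sup>+ s. causal Q s \<partial>lborel) = ennreal (\<nu> / (1 - \<nu>))"
proof -
  have "(\<integral>\<^sup>+ s. causal Q s \<partial>lborel) = (\<Sum>l. \<integral>\<^sup>+ s. causal (kp l) s \<partial>lborel)"
    unfolding causal_Q by (rule nn_integral_suminf) simp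
  also have "\<dots> = ennreal (\<Sum>l. \<nu> ^ Suc l)"
    unfolding kp_mass
    by (intro suminf_ennreal2 sums_summable[OF \<nu>_geometric] zero_le_power \<nu>)
  also have "(\<Sum>l. \<nu> ^ Suc l) = \<nu> / (1 - \<nu>)"
    using \<nu>_geometric by (rule sums_unique[symmetric])
  finally show ?thesis .
qed

lemma Q_integral: "set_integrable lborel {0<..} Q" "(LBINT s:{0<..}. Q s) = \<nu> / (1 - \<nu>)" "L1_norm Q = \<nu> / (1 - \<nu>)"
  using half_line_mass[OF causal_Q_measurable Q_nonneg Q_mass] \<nu> by auto

lemma kp_integral: "set_integrable lborel {0<..} (kp l)" "(LBINT s:{0<..}. kp l s) = \<nu> ^ Suc l"
  using half_line_mass[OF kp_measurable kp_nonneg kp_mass, of l] \<nu> by auto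

lemma resolvent_converges: "tendsto_in_L1 (\<lambda>N s. \<Sum>l=1..N. conv_power k l s) Q"
proof -
  have eq: "(\<Sum>l=1..N. conv_power k l s) = (\<Sum>l<N. kp l s)" for N s
    using sum.atLeast1_atMost_eq[of "\<lambda>l. conv_power k l s" N] by simp
  have int: "set_integrable lborel {0<..} (\<lambda>s. \<Sum>l<N. kp l s)" for N
    using kp_integral(1) unfolding set_integrable_def scaleR_sum_right
    by (intro Bochner_Integration.integrable_sum) auto
  have val: "(LBINT s:{0<..}. (\<Sum>l<N. kp l s)) = (\<Sum>l<N. \<nu> ^ Suc l)" for N
    using kp_integral(1) unfolding kp_integral(2)[symmetric] set_lebesgue_integral_def set_integrable_def scaleR_sum_right
    by (intro Bochner_Integration.integral_sum) auto
  have L1: "L1_norm (\<lambda>s. (\<Sum>l<N. kp l s) - Q s) = \<nu> / (1 - \<nu>) - (\<Sum>l<N. \<nu> ^ Suc l)" for N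
  proof -
    have "L1_norm (\<lambda>s. (\<Sum>l<N. kp l s) - Q s) = (LBINT s:{0<..}. Q s - (\<Sum>l<N. kp l s))"
      unfolding L1_norm_def
    proof (rule set_lebesgue_integral_cong)
      show "\<forall>s. s \<in> {0<..} \<longrightarrow> \<bar>(\<Sum>l<N. kp l s) - Q s\<bar> = Q s - (\<Sum>l<N. kp l s)"
      proof (intro allI impI)
        fix s :: real assume s: "s \<in> {0<..}"
        have "(\<Sum>l<N. kp l s) \<le> Q s"
          unfolding resolvent_def using s kp_nonneg by (intro sum_le_suminf kp_summable) auto
        then show "\<bar>(\<Sum>l<N. kp l s) - Q s\<bar> = Q s - (\<Sum>l<N. kp l s)" by simp
      qed
    qed simp
    also have "\<dots> = (LBINT s:{0<..}. Q s) - (LBINT s:{0<..}. (\<Sum>l<N. kp l s))"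
      by (rule set_integral_diff(2)[OF Q_integral(1) int])
    finally show ?thesis unfolding val Q_integral(2) .
  qed
  have "(\<lambda>N. \<nu> / (1 - \<nu>) - (\<Sum>l<N. \<nu> ^ Suc l)) \<longlonglongrightarrow> \<nu> / (1 - \<nu>) - \<nu> / (1 - \<nu>)"
    by (intro tendsto_diff tendsto_const \<nu>_geometric[unfolded sums_def])
  then have "(\<lambda>N. \<nu> / (1 - \<nu>) - (\<Sum>l<N. \<nu> ^ Suc l)) \<longlonglongrightarrow> 0" by simp
  then show ?thesis
    unfolding tendsto_in_L1_def eq L1 using int Q_integral(1) by blast
qed

text \<open>The resolvent equation \<open>Q = k + k * Q\<close>, by shifting the summation index.\<close>

lemma causal_Q_fixed_point: "causal Q = (\<lambda>s. causal k s + (causal k \<star> causal Q) s)"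
proof
  fix s
  have "(causal k \<star> causal Q) s = (\<integral>\<^sup>+ u. (\<Sum>l. causal k (s - u) * causal (kp l) u) \<partial>lborel)"
    unfolding nn_conv_def causal_Q by simp
  also have "\<dots> = (\<Sum>l. (causal k \<star> causal (kp l)) s)"
    unfolding nn_conv_def by (rule nn_integral_suminf) measurable
  also have "\<dots> = (\<Sum>l. causal (kp (Suc l)) s)" by (simp only: kp_conv)
  finally have "causal k s + (causal k \<star> causal Q) s = causal (kp 0) s + (\<Sum>l. causal (kp (Suc l)) s)"
    by (simp add: conv_power_def)
  also have "\<dots> = causal Q s"
    unfolding causal_Q by (subst (2) suminf_offset[of _ 1]) (auto simp: add.commute)
  finally show "causal Q s = causal k s + (causal k \<star> causal Q) s" by simp
qed

text \<open>Put \<open>Z = \<rho> + Q * \<rho>\<close>. The resolvent equation gives \<open>k * Z = Q * \<rho>\<close>, so \<open>Z\<close> solves the Volterra equation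
  \<open>Z = \<rho> + k * Z\<close>. If \<open>L \<le> Z + \<nu>\<^sup>n b\<close> on \<open>[0,t]\<close> then inserting this into \<open>L \<le> \<rho> + k * L\<close> improves the error to
  \<open>\<nu>\<^sup>n\<^sup>+\<^sup>1 b\<close>, hence \<open>L \<le> Z\<close>. A local bound on \<open>L\<close> starts the iteration.\<close>

lemma volterra:
  assumes L_meas [measurable]: "causal L \<in> borel_measurable borel" and \<rho>_meas [measurable]: "causal \<rho> \<in> borel_measurable borel"
    and L_nn: "\<And>s. 0 \<le> s \<Longrightarrow> 0 \<le> L s" and L_bd: "\<And>T. \<exists>B. \<forall>s\<in>{0..T}. L s \<le> B"
    and \<rho>_nn: "\<And>s. 0 \<le> s \<Longrightarrow> 0 \<le> \<rho> s" and \<rho>_bd: "\<And>s. 0 \<le> s \<Longrightarrow> \<rho> s \<le> R"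
    and ineq: "\<And>t. 0 \<le> t \<Longrightarrow> L t \<le> \<rho> t + causal_conv k L t" and t: "0 \<le> t"
  shows "set_integrable lborel {0..t} (\<lambda>s. k (t - s) * L s)"
    "set_integrable lborel {0..t} (\<lambda>s. Q (t - s) * \<rho> s)"
    "L t \<le> \<rho> t + causal_conv Q \<rho> t"
    "causal_conv k L t \<le> causal_conv Q \<rho> t"
    "causal_conv Q \<rho> t \<le> R * (\<nu> / (1 - \<nu>))"
proof -
  have R: "0 \<le> R" using \<rho>_nn[of 0] \<rho>_bd[of 0] by simp
  have Q\<rho>: "(causal Q \<star> causal \<rho>) s \<le> ennreal (R * (\<nu> / (1 - \<nu>)))" for s
  proof -
    have "causal \<rho> u \<le> ennreal R" for u using \<rho>_bd[of u] by (auto simp: causal_def indicator_def ennreal_leI)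
    from nn_conv_le_right[OF causal_Q_measurable this, where t = s] show ?thesis
      unfolding Q_mass using \<nu> R by (simp add: ennreal_mult[symmetric] mult.commute)
  qed
  define Z where "Z s = causal \<rho> s + (causal Q \<star> causal \<rho>) s" for s
  have Z_meas [measurable]: "Z \<in> borel_measurable borel" unfolding Z_def[abs_def] by measurable
  have kZ: "(causal k \<star> Z) s = (causal Q \<star> causal \<rho>) s" for s
  proof -
    have "(causal k \<star> Z) s = (causal k \<star> causal \<rho>) s + (causal k \<star> (causal Q \<star> causal \<rho>)) s"
      unfolding Z_def[abs_def] by (rule nn_conv_add_right) measurable
    also have "causal k \<star> (causal Q \<star> causal \<rho>) = (causal k \<star> causal Q) \<star> causal \<rho>"
      by (rule nn_conv_assoc) measurable
    also have "(causal k \<star> causal \<rho>) s + ((causal k \<star> causal Q) \<star> causal \<rho>) s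
        = ((\<lambda>u. causal k u + (causal k \<star> causal Q) u) \<star> causal \<rho>) s"
      by (rule nn_conv_add_left[symmetric]) measurable
    also have "\<dots> = (causal Q \<star> causal \<rho>) s" by (simp only: causal_Q_fixed_point[symmetric])
    finally show ?thesis .
  qed
  obtain B where B: "0 \<le> B" "\<And>s. s \<in> {0..t} \<Longrightarrow> L s \<le> B"
    using L_bd[of t] by (meson max.cobounded1 max.coboundedI2)
  have conv_L: "causal_conv k L s = enn2real ((causal k \<star> causal L) s)" for s
    by (rule causal_conv_nn_conv) (use k_nonneg L_nn in auto)
  have cut: "(causal k \<star> f) s \<le> (causal k \<star> g) s" if "\<And>u. u \<le> s \<Longrightarrow> f u \<le> g u" for f g s
    unfolding nn_conv_def using that
    by (intro nn_integral_mono) (auto simp: causal_def indicator_def intro: mult_left_mono)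
  have kL_B: "(causal k \<star> causal L) s \<le> ennreal (\<nu> * B)" if "s \<le> t" for s
  proof -
    have "(causal k \<star> causal L) s \<le> (causal k \<star> (\<lambda>_. ennreal B)) s"
      using B that by (intro cut) (auto simp: causal_def indicator_def ennreal_leI)
    also have "\<dots> \<le> ennreal (\<nu> * B)"
      using nn_conv_le_right[of "causal k" "\<lambda>_. ennreal B" "ennreal B" s] k_mass B(1) \<nu> by (simp add: ennreal_mult)
    finally show ?thesis .
  qed
  have step: "causal L s \<le> causal \<rho> s + (causal k \<star> causal L) s" if "s \<le> t" for s
  proof (cases "0 \<le> s")
    case True
    have "ennreal (L s) \<le> ennreal (\<rho> s + causal_conv k L s)" using ineq[OF True] by (rule ennreal_leI)
    also have "\<dots> = causal \<rho> s + ennreal (enn2real ((causal k \<star> causal L) s))"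
      unfolding conv_L using True \<rho>_nn[OF True] by (simp add: causal_def)
    also have "ennreal (enn2real ((causal k \<star> causal L) s)) = (causal k \<star> causal L) s"
      using kL_B[OF that] by (intro ennreal_enn2real) (auto intro: order.strict_trans1)
    finally show ?thesis using True by (simp add: causal_def)
  qed (simp add: causal_def)
  have iter: "causal L s \<le> Z s + ennreal (\<nu> ^ n * B)" if "s \<le> t" for n s
    using that
  proof (induction n arbitrary: s)
    case 0
    then have "causal L s \<le> ennreal B" using B by (auto simp: causal_def indicator_def ennreal_leI)
    then show ?case by (simp add: add_increasing)
  next
    case (Suc n)
    have "causal L s \<le> causal \<rho> s + (causal k \<star> causal L) s" by (rule step) fact
    also have "(causal k \<star> causal L) s \<le> (causal k \<star> (\<lambda>u. Z u + ennreal (\<nu> ^ n * B))) s"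
      using Suc by (intro cut) auto
    also have "(causal k \<star> (\<lambda>u. Z u + ennreal (\<nu> ^ n * B))) s
       = (causal k \<star> Z) s + (causal k \<star> (\<lambda>_. ennreal (\<nu> ^ n * B))) s"
      by (rule nn_conv_add_right) measurable
    also have "(causal k \<star> (\<lambda>_. ennreal (\<nu> ^ n * B))) s \<le> ennreal (\<nu> ^ Suc n * B)"
      using nn_conv_le_right[of "causal k" "\<lambda>_. ennreal (\<nu> ^ n * B)" "ennreal (\<nu> ^ n * B)" s] k_mass B(1) \<nu>
      by (simp add: ennreal_mult[symmetric] mult.assoc)
    finally show ?case unfolding kZ by (simp add: Z_def[of s] add.assoc add_left_mono)
  qed
  have conv_Q: "causal_conv Q \<rho> s = enn2real ((causal Q \<star> causal \<rho>) s)" for s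
    by (rule causal_conv_nn_conv) (use Q_nonneg \<rho>_nn in auto)
  have Q\<rho>': "ennreal (causal_conv Q \<rho> s) = (causal Q \<star> causal \<rho>) s" for s
    unfolding conv_Q using Q\<rho>[of s] by (intro ennreal_enn2real) (auto intro: order.strict_trans1)
  have Q\<rho>0: "0 \<le> causal_conv Q \<rho> s" for s unfolding conv_Q by simp
  have LZ: "L s \<le> \<rho> s + causal_conv Q \<rho> s" if "0 \<le> s" "s \<le> t" for s
  proof -
    have Zs: "Z s = ennreal (\<rho> s + causal_conv Q \<rho> s)"
      unfolding Z_def Q\<rho>'[symmetric] using that Q\<rho>0 \<rho>_nn by (simp add: causal_def)
    have "L s \<le> \<rho> s + causal_conv Q \<rho> s + \<nu> ^ n * B" for n
    proof -
      have "ennreal (L s) \<le> ennreal (\<rho> s + causal_conv Q \<rho> s + \<nu> ^ n * B)"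
        using iter[OF that(2), of n] that \<nu> B(1) Q\<rho>0[of s] \<rho>_nn[OF that(1)] unfolding Zs by (simp add: causal_def)
      moreover have "0 \<le> \<rho> s + causal_conv Q \<rho> s + \<nu> ^ n * B"
        using \<nu> B(1) Q\<rho>0[of s] \<rho>_nn[OF that(1)] by simp
      ultimately show ?thesis by (simp only: ennreal_le_iff)
    qed
    moreover have "(\<lambda>n. \<rho> s + causal_conv Q \<rho> s + \<nu> ^ n * B) \<longlonglongrightarrow> \<rho> s + causal_conv Q \<rho> s + 0 * B"
      using \<nu> by (intro tendsto_intros LIMSEQ_power_zero) auto
    ultimately show ?thesis using LIMSEQ_le_const by fastforce
  qed
  show "L t \<le> \<rho> t + causal_conv Q \<rho> t" using LZ t by simp
  have "(causal k \<star> causal L) t \<le> (causal k \<star> Z) t"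
  proof (rule cut)
    fix u assume "u \<le> t"
    show "causal L u \<le> Z u"
    proof (cases "0 \<le> u")
      case True
      then show ?thesis
        unfolding Z_def Q\<rho>'[symmetric] using LZ[OF True \<open>u \<le> t\<close>] Q\<rho>0[of u] \<rho>_nn[OF True]
        by (simp add: causal_def ennreal_plus[symmetric] ennreal_leI del: ennreal_plus)
    qed (simp add: causal_def)
  qed
  then show "causal_conv k L t \<le> causal_conv Q \<rho> t"
    unfolding conv_L conv_Q kZ using Q\<rho>[of t] by (intro enn2real_mono) (auto intro: order.strict_trans1)
  show "causal_conv Q \<rho> t \<le> R * (\<nu> / (1 - \<nu>))"
    using Q\<rho>[of t] R \<nu> unfolding Q\<rho>'[symmetric] by (simp add: ennreal_le_iff)
  show "set_integrable lborel {0..t} (\<lambda>s. k (t - s) * L s)"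
    by (rule causal_conv_nn_conv(2)) (use k_nonneg L_nn kL_B[of t] in \<open>auto intro: order.strict_trans1\<close>)
  show "set_integrable lborel {0..t} (\<lambda>s. Q (t - s) * \<rho> s)"
    by (rule causal_conv_nn_conv(2)) (use Q_nonneg \<rho>_nn Q\<rho>[of t] in \<open>auto intro: order.strict_trans1\<close>)
qed

end

section \<open>Approximation by centred variables of bounded variance\<close>

context prob_space begin

text \<open>The form in which stochastic integrals are known here: up to an error \<open>e\<close> in probability on the
  event \<open>A\<close>, the variable \<open>Z\<close> is a centred variable whose second moment is at most \<open>b\<close>. Errors
  of this kind add up, so that nested limits can be replaced by one choice of parameters.\<close>

definition centered_approx :: "real \<Rightarrow> 'a set \<Rightarrow> ('a \<Rightarrow> real) \<Rightarrow> real \<Rightarrow> bool" where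
  "centered_approx b A Z e \<longleftrightarrow> (\<exists>Y. integrable M Y \<and> integrable M (\<lambda>\<omega>. (Y \<omega>)\<^sup>2) \<and>
     expectation Y = 0 \<and> expectation (\<lambda>\<omega>. (Y \<omega>)\<^sup>2) \<le> b \<and>
     prob (A \<inter> {\<omega>\<in>space M. e < \<bar>Y \<omega> - Z \<omega>\<bar>}) \<le> e)"

lemma centered_approx_extend:
  assumes Z: "Z \<in> borel_measurable M" and approx: "centered_approx b A Z e"
    and A: "A \<in> sets M" and le: "b \<le> b'" "e + prob (A' - A) \<le> e'" and A': "A' \<in> sets M"
  shows "centered_approx b' A' Z e'"
proof -
  obtain Y where Y: "integrable M Y" "integrable M (\<lambda>\<omega>. (Y \<omega>)\<^sup>2)" "expectation Y = 0"
    "expectation (\<lambda>\<omega>. (Y \<omega>)\<^sup>2) \<le> b" "prob (A \<inter> {\<omega>\<in>space M. e < \<bar>Y \<omega> - Z \<omega>\<bar>}) \<le> e"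
    using approx unfolding centered_approx_def by blast
  let ?X = "A \<inter> {\<omega>\<in>space M. e < \<bar>Y \<omega> - Z \<omega>\<bar>}"
  have [measurable]: "Y \<in> borel_measurable M" using Y(1) by simp
  have "{\<omega>\<in>space M. e < \<bar>Y \<omega> - Z \<omega>\<bar>} \<in> sets M" using Z by measurable
  then have X: "?X \<in> sets M" "A' - A \<in> sets M" using A A' by auto
  have "e \<le> e'" using le(2) measure_nonneg[of M "A' - A"] by linarith
  then have "prob (A' \<inter> {\<omega>\<in>space M. e' < \<bar>Y \<omega> - Z \<omega>\<bar>}) \<le> prob (?X \<union> (A' - A))"
    using X by (intro finite_measure_mono) auto
  also have "\<dots> \<le> e'" using measure_Un_le[OF X] Y(5) le(2) by linarith
  finally show ?thesis unfolding centered_approx_def using Y le(1) by (intro exI[of _ Y]) auto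
qed

text \<open>Fatou's lemma in the form needed for letting truncation levels tend to infinity.\<close>

lemma fatou_bound:
  fixes f :: "nat \<Rightarrow> 'a \<Rightarrow> real"
  assumes int: "\<And>n. integrable M (f n)" and nn: "\<And>n \<omega>. 0 \<le> f n \<omega>"
    and lim: "AE \<omega> in M. (\<lambda>n. f n \<omega>) \<longlonglongrightarrow> g \<omega>" and g: "g \<in> borel_measurable M" "\<And>\<omega>. 0 \<le> g \<omega>"
    and b: "\<And>n. expectation (f n) \<le> b"
  shows "integrable M g" "expectation g \<le> b"
proof -
  have "0 \<le> expectation (f 0)" using nn by (intro integral_nonneg_AE) auto
  then have b0: "0 \<le> b" using b[of 0] by linarith
  have "(\<integral>\<^sup>+ \<omega>. ennreal (g \<omega>) \<partial>M) = (\<integral>\<^sup>+ \<omega>. liminf (\<lambda>n. ennreal (f n \<omega>)) \<partial>M)"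
  proof (rule nn_integral_cong_AE)
    show "AE \<omega> in M. ennreal (g \<omega>) = liminf (\<lambda>n. ennreal (f n \<omega>))"
      using lim by eventually_elim (intro lim_imp_Liminf[symmetric] tendsto_ennrealI, auto)
  qed
  also have "\<dots> \<le> liminf (\<lambda>n. \<integral>\<^sup>+ \<omega>. ennreal (f n \<omega>) \<partial>M)"
    using int by (intro nn_integral_liminf) auto
  also have "\<dots> \<le> limsup (\<lambda>n. \<integral>\<^sup>+ \<omega>. ennreal (f n \<omega>) \<partial>M)" by (intro Liminf_le_Limsup) auto
  also have "\<dots> \<le> ennreal b"
  proof (rule Limsup_bounded, intro always_eventually allI)
    fix n show "(\<integral>\<^sup>+ \<omega>. ennreal (f n \<omega>) \<partial>M) \<le> ennreal b"
      using nn_integral_eq_integral[OF int[of n]] nn b[of n] by (simp add: ennreal_leI)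
  qed
  finally have le: "(\<integral>\<^sup>+ \<omega>. ennreal (g \<omega>) \<partial>M) \<le> ennreal b" .
  show i: "integrable M g"
  proof (rule integrableI_nonneg)
    show "(\<integral>\<^sup>+ \<omega>. ennreal (g \<omega>) \<partial>M) < \<infinity>" using le by (rule order.strict_trans1) simp
  qed (use g in auto)
  have "ennreal (expectation g) = (\<integral>\<^sup>+ \<omega>. ennreal (g \<omega>) \<partial>M)"
    using i g by (intro nn_integral_eq_integral[symmetric]) auto
  then have "ennreal (expectation g) \<le> ennreal b" using le by simp
  then show "expectation g \<le> b" using b0 by (simp only: ennreal_le_iff)
qed

text \<open>Truncate \<open>Z\<close> at level \<open>n\<close>. Where the approximation succeeds, \<open>\<bar>Z\<bar> \<le> \<bar>Y\<bar> + e\<close>; where it fails, the truncated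
  square is at most \<open>n\<^sup>2\<close> on an event of probability \<open>e\<close>. First \<open>e\<close> tends to zero, then \<open>n\<close> to infinity.\<close>

lemma second_moment_of_limit_in_probability:
  assumes Z: "Z \<in> borel_measurable M" and A: "A \<in> sets M"
    and approx: "\<And>e. 0 < e \<Longrightarrow> centered_approx (b + e) A Z e"
  shows "integrable M (\<lambda>\<omega>. indicator A \<omega> * (Z \<omega> :: real)\<^sup>2)" "expectation (\<lambda>\<omega>. indicator A \<omega> * (Z \<omega>)\<^sup>2) \<le> b"
proof -
  define f where "f n \<omega> = indicator A \<omega> * (min \<bar>Z \<omega>\<bar> (real n))\<^sup>2" for n \<omega>
  have fm: "f n \<in> borel_measurable M" for n unfolding f_def[abs_def] using Z A by measurable
  have fnn: "0 \<le> f n \<omega>" for n \<omega> by (simp add: f_def)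
  have fi: "integrable M (f n)" for n
  proof (rule integrable_const_bound[of _ "(real n)\<^sup>2"])
    have "(min \<bar>Z \<omega>\<bar> (real n))\<^sup>2 \<le> (real n)\<^sup>2" for \<omega> by (intro power_mono) auto
    then show "AE \<omega> in M. norm (f n \<omega>) \<le> (real n)\<^sup>2" by (intro AE_I2) (auto simp: f_def indicator_def)
  qed (rule fm)
  have fb: "expectation (f n) \<le> b" for n
  proof (rule ccontr)
    assume "\<not> expectation (f n) \<le> b"
    then have gap: "0 < expectation (f n) - b" by simp
    \<comment> \<open>The expression is the excess over \<open>b\<close> of the bound derived from \<open>pw\<close> below; it vanishes as \<open>e\<close> tends to 0.\<close>
    have "((\<lambda>e. (1 + e) * (b + e) + e + e\<^sup>2 + (real n)\<^sup>2 * e - b) \<longlongrightarrow> (1 + 0) * (b + 0) + 0 + 0\<^sup>2 + (real n)\<^sup>2 * 0 - b) (at_right 0)"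
      by (intro tendsto_intros)
    then have "\<forall>\<^sub>F e in at_right 0. (1 + e) * (b + e) + e + e\<^sup>2 + (real n)\<^sup>2 * e - b < expectation (f n) - b"
      using gap by (intro order_tendstoD(2)) auto
    then have "\<forall>\<^sub>F e in at_right 0. 0 < e \<and> (1 + e) * (b + e) + e + e\<^sup>2 + (real n)\<^sup>2 * e - b < expectation (f n) - b"
      using eventually_at_right_less[of "0::real"] by eventually_elim simp
    then obtain e where e: "0 < e" "(1 + e) * (b + e) + e + e\<^sup>2 + (real n)\<^sup>2 * e < expectation (f n)"
      by (auto dest!: eventually_happens)
    obtain Y where Y: "integrable M Y" "integrable M (\<lambda>\<omega>. (Y \<omega>)\<^sup>2)" "expectation (\<lambda>\<omega>. (Y \<omega>)\<^sup>2) \<le> b + e"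
      "prob (A \<inter> {\<omega>\<in>space M. e < \<bar>Y \<omega> - Z \<omega>\<bar>}) \<le> e" using approx[OF e(1)] unfolding centered_approx_def by blast
    define X where "X = A \<inter> {\<omega>\<in>space M. e < \<bar>Y \<omega> - Z \<omega>\<bar>}"
    have Ym: "Y \<in> borel_measurable M" using Y(1) by simp
    have "{\<omega>\<in>space M. e < \<bar>Y \<omega> - Z \<omega>\<bar>} \<in> sets M" using Ym Z by measurable
    then have X: "X \<in> sets M" using A by (auto simp: X_def)
    have pw: "f n \<omega> \<le> (1 + e) * (Y \<omega>)\<^sup>2 + (e + e\<^sup>2) + (real n)\<^sup>2 * indicator X \<omega>" if "\<omega> \<in> space M" for \<omega>
    proof -
      have s: "0 \<le> (1 + e) * (Y \<omega>)\<^sup>2 + (e + e\<^sup>2)" using e by simp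
      consider "\<omega> \<notin> A" | "\<omega> \<in> X" | "\<omega> \<in> A" "\<bar>Y \<omega> - Z \<omega>\<bar> \<le> e" 
        using \<open>\<omega> \<in> space M\<close> by (cases "\<omega> \<in> A"; cases "e < \<bar>Y \<omega> - Z \<omega>\<bar>") (auto simp: X_def)
      then show ?thesis
      proof cases
        case 1 then show ?thesis using s by (simp add: f_def)
      next
        case 2
        have "f n \<omega> \<le> (real n)\<^sup>2"
        proof -
          have "(min \<bar>Z \<omega>\<bar> (real n))\<^sup>2 \<le> (real n)\<^sup>2" by (intro power_mono) auto
          then show ?thesis by (auto simp: f_def indicator_def)
        qed
        then show ?thesis using s 2 by simp
      next
        case 3
        have "f n \<omega> \<le> (min \<bar>Z \<omega>\<bar> (real n))\<^sup>2" by (auto simp: f_def indicator_def)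
        also have "\<dots> \<le> (\<bar>Y \<omega>\<bar> + e)\<^sup>2" using 3(2) by (intro power_mono) auto
        also have "\<dots> = (Y \<omega>)\<^sup>2 + e * (2 * \<bar>Y \<omega>\<bar>) + e\<^sup>2" by (simp add: power2_sum)
        also have "\<dots> \<le> (Y \<omega>)\<^sup>2 + e * (1 + (Y \<omega>)\<^sup>2) + e\<^sup>2"
          using sum_squares_bound[of "\<bar>Y \<omega>\<bar>" 1] e by simp
        also have "\<dots> = (1 + e) * (Y \<omega>)\<^sup>2 + (e + e\<^sup>2)" by (simp add: algebra_simps)
        also have "\<dots> \<le> (1 + e) * (Y \<omega>)\<^sup>2 + (e + e\<^sup>2) + (real n)\<^sup>2 * indicator X \<omega>" by simp
        finally show ?thesis .
      qed
    qed
    have rhs: "integrable M (\<lambda>\<omega>. (1 + e) * (Y \<omega>)\<^sup>2 + (e + e\<^sup>2) + (real n)\<^sup>2 * indicator X \<omega>)"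
      using Y(2) X by (intro Bochner_Integration.integrable_add integrable_mult_right) (auto simp: integrable_indicator_iff less_top[symmetric])
    have "expectation (f n) \<le> expectation (\<lambda>\<omega>. (1 + e) * (Y \<omega>)\<^sup>2 + (e + e\<^sup>2) + (real n)\<^sup>2 * indicator X \<omega>)"
      using pw by (intro integral_mono fi rhs) auto
    also have "\<dots> = (1 + e) * expectation (\<lambda>\<omega>. (Y \<omega>)\<^sup>2) + (e + e\<^sup>2) + (real n)\<^sup>2 * prob X"
      using Y(2) X by (simp add: Bochner_Integration.integral_add integrable_indicator_iff less_top[symmetric] prob_space)
    also have "\<dots> \<le> (1 + e) * (b + e) + (e + e\<^sup>2) + (real n)\<^sup>2 * e"
      using Y(3,4) e by (intro add_mono mult_left_mono) (auto simp: X_def)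
    finally show False using e(2) by simp
  qed
  have lim: "AE \<omega> in M. (\<lambda>n. f n \<omega>) \<longlonglongrightarrow> indicator A \<omega> * (Z \<omega>)\<^sup>2"
  proof (rule AE_I2)
    fix \<omega>
    obtain n0 where n0: "\<bar>Z \<omega>\<bar> < real n0" using reals_Archimedean2 by blast
    have "\<forall>\<^sub>F n in sequentially. f n \<omega> = indicator A \<omega> * (Z \<omega>)\<^sup>2"
      using eventually_ge_at_top[of n0] by eventually_elim (use n0 in \<open>auto simp: f_def min_absorb1\<close>)
    then show "(\<lambda>n. f n \<omega>) \<longlonglongrightarrow> indicator A \<omega> * (Z \<omega>)\<^sup>2" by (rule tendsto_eventually)
  qed
  have gm: "(\<lambda>\<omega>. indicator A \<omega> * (Z \<omega>)\<^sup>2) \<in> borel_measurable M" using Z A by measurable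
  show "integrable M (\<lambda>\<omega>. indicator A \<omega> * (Z \<omega>)\<^sup>2)" "expectation (\<lambda>\<omega>. indicator A \<omega> * (Z \<omega>)\<^sup>2) \<le> b"
    using fatou_bound[OF fi fnn lim gm _ fb] by auto
qed

text \<open>Bounded second moments make the approximating variables uniformly integrable, so that the mean passes
  to the limit.\<close>

lemma mean_of_limit_in_probability:
  assumes Z: "integrable M Z" "integrable M (\<lambda>\<omega>. (Z \<omega> :: real)\<^sup>2)"
    and approx: "\<And>e. 0 < e \<Longrightarrow> e \<le> 1 \<Longrightarrow> centered_approx b (space M) Z e"
  shows "expectation Z = 0"
proof (rule ccontr)
  assume "expectation Z \<noteq> 0"
  then have gap: "0 < \<bar>expectation Z\<bar>" by simp
  define D where "D = expectation (\<lambda>\<omega>. (Z \<omega>)\<^sup>2) + b"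
  \<comment> \<open>Approximation with error \<open>x\<^sup>2\<close>: on the exceptional event, of probability at most \<open>x\<^sup>2\<close>, use
    \<open>2 \<bar>w\<bar> \<le> x w\<^sup>2 + 1 / x\<close>, whose expectation is of order \<open>x\<close>.\<close>
  have "((\<lambda>x. x\<^sup>2 + x * D + x) \<longlongrightarrow> 0\<^sup>2 + 0 * D + 0) (at_right (0::real))" by (intro tendsto_intros)
  then have "\<forall>\<^sub>F x in at_right 0. x\<^sup>2 + x * D + x < \<bar>expectation Z\<bar>"
    using gap by (intro order_tendstoD(2)) auto
  moreover have "\<forall>\<^sub>F x in at_right (0::real). x < 1" by (rule eventually_at_rightI[of 0 1]) auto
  ultimately have "\<forall>\<^sub>F x in at_right 0. 0 < x \<and> x < 1 \<and> x\<^sup>2 + x * D + x < \<bar>expectation Z\<bar>"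
    using eventually_at_right_less[of "0::real"] by eventually_elim simp
  then obtain x where x: "0 < x" "x < 1" "x\<^sup>2 + x * D + x < \<bar>expectation Z\<bar>"
    by (auto dest!: eventually_happens)
  have "0 < x\<^sup>2" "x\<^sup>2 \<le> 1" using x by (auto intro: power_le_one)
  then obtain Y where Y: "integrable M Y" "integrable M (\<lambda>\<omega>. (Y \<omega>)\<^sup>2)" "expectation Y = 0" "expectation (\<lambda>\<omega>. (Y \<omega>)\<^sup>2) \<le> b"
      "prob (space M \<inter> {\<omega>\<in>space M. x\<^sup>2 < \<bar>Y \<omega> - Z \<omega>\<bar>}) \<le> x\<^sup>2"
    using approx[of "x\<^sup>2"] unfolding centered_approx_def by blast
  let ?X = "space M \<inter> {\<omega>\<in>space M. x\<^sup>2 < \<bar>Y \<omega> - Z \<omega>\<bar>}"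
  have Ym: "Y \<in> borel_measurable M" "Z \<in> borel_measurable M" using Y(1) Z(1) by simp_all
  then have X: "?X \<in> sets M" by measurable
  have pw: "\<bar>Z \<omega> - Y \<omega>\<bar> \<le> x\<^sup>2 + x * ((Z \<omega>)\<^sup>2 + (Y \<omega>)\<^sup>2) + indicator ?X \<omega> / x" if "\<omega> \<in> space M" for \<omega>
  proof (cases "\<omega> \<in> ?X")
    case True
    have "0 \<le> (x * \<bar>Z \<omega> - Y \<omega>\<bar> - 1)\<^sup>2" by simp
    then have "2 * (x * \<bar>Z \<omega> - Y \<omega>\<bar>) \<le> x\<^sup>2 * (Z \<omega> - Y \<omega>)\<^sup>2 + 1" by (simp add: power2_diff power_mult_distrib)
    moreover have "x\<^sup>2 * (Z \<omega> - Y \<omega>)\<^sup>2 \<le> x\<^sup>2 * (2 * ((Z \<omega>)\<^sup>2 + (Y \<omega>)\<^sup>2))"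
      using sum_squares_bound[of "Z \<omega>" "- Y \<omega>"] by (intro mult_left_mono) (simp_all add: power2_diff)
    moreover have "x\<^sup>2 * (2 * ((Z \<omega>)\<^sup>2 + (Y \<omega>)\<^sup>2)) = 2 * (x\<^sup>2 * ((Z \<omega>)\<^sup>2 + (Y \<omega>)\<^sup>2))" by simp
    ultimately have "2 * (x * \<bar>Z \<omega> - Y \<omega>\<bar>) \<le> 2 * (x\<^sup>2 * ((Z \<omega>)\<^sup>2 + (Y \<omega>)\<^sup>2)) + 2" by linarith
    then have "x * \<bar>Z \<omega> - Y \<omega>\<bar> \<le> x * (x * ((Z \<omega>)\<^sup>2 + (Y \<omega>)\<^sup>2) + 1 / x)" using x by (simp add: distrib_left power2_eq_square mult.assoc)
    then have "\<bar>Z \<omega> - Y \<omega>\<bar> \<le> x * ((Z \<omega>)\<^sup>2 + (Y \<omega>)\<^sup>2) + 1 / x" using x(1) by (rule mult_left_le_imp_le)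
    moreover have "0 \<le> x\<^sup>2" by simp
    moreover have "indicator ?X \<omega> / x = 1 / x" using True by simp
    ultimately show ?thesis by linarith
  next
    case False
    then have "\<bar>Z \<omega> - Y \<omega>\<bar> \<le> x\<^sup>2" using that by auto
    moreover have "0 \<le> x * ((Z \<omega>)\<^sup>2 + (Y \<omega>)\<^sup>2)" using x by simp
    ultimately show ?thesis using False by simp
  qed
  have rhs: "integrable M (\<lambda>\<omega>. x\<^sup>2 + x * ((Z \<omega>)\<^sup>2 + (Y \<omega>)\<^sup>2) + indicator ?X \<omega> / x)"
    using Y(2) Z(2) X by (intro Bochner_Integration.integrable_add integrable_mult_right integrable_divide_zero) (auto simp: integrable_indicator_iff less_top[symmetric])
  have "expectation Z = expectation (\<lambda>\<omega>. Z \<omega> - Y \<omega>)" using Z(1) Y(1,3) by simp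
  then have "\<bar>expectation Z\<bar> \<le> expectation (\<lambda>\<omega>. \<bar>Z \<omega> - Y \<omega>\<bar>)"
    using integral_abs_bound[of M "\<lambda>\<omega>. Z \<omega> - Y \<omega>"] by simp
  also have "\<dots> \<le> expectation (\<lambda>\<omega>. x\<^sup>2 + x * ((Z \<omega>)\<^sup>2 + (Y \<omega>)\<^sup>2) + indicator ?X \<omega> / x)"
    using pw Z(1) Y(1) by (intro integral_mono rhs) auto
  also have "\<dots> = x\<^sup>2 + x * (expectation (\<lambda>\<omega>. (Z \<omega>)\<^sup>2) + expectation (\<lambda>\<omega>. (Y \<omega>)\<^sup>2)) + prob ?X / x"
    using Y(2) Z(2) X by (simp add: Bochner_Integration.integral_add integrable_indicator_iff less_top[symmetric] prob_space)
  also have "\<dots> \<le> x\<^sup>2 + x * D + x\<^sup>2 / x"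
    unfolding D_def using Y(4,5) x by (intro add_mono mult_left_mono divide_right_mono) auto
  also have "x\<^sup>2 / x = x" using x by (simp add: power2_eq_square)
  finally show False using x(3) by simp
qed

end

section \<open>Increments of Brownian motion\<close>

locale brownian =
  fixes M :: "'w measure" and W :: "real \<Rightarrow> 'w \<Rightarrow> real ^ 'n"
  assumes bm: "brownian_motion M W"
begin

abbreviation F :: "real \<Rightarrow> 'w measure" where "F \<equiv> augmented_filtration M W"

sublocale prob_space M using bm by (simp add: brownian_motion_def)

lemma W_measurable: "0 \<le> t \<Longrightarrow> W t \<in> borel_measurable M"
  using bm by (simp add: brownian_motion_def)

lemma sets_natural:
  "sets (natural_filtration M W s) =
     sigma_sets (space M) {W u -` A \<inter> space M | u A. 0 \<le> u \<and> u \<le> s \<and> A \<in> sets borel}"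
  unfolding natural_filtration_def by (rule sets_measure_of) auto

lemma space_natural [simp]: "space (natural_filtration M W s) = space M"
  unfolding natural_filtration_def by (rule space_measure_of) auto

lemma natural_generator_mono:
  "s \<le> t \<Longrightarrow> {W u -` A \<inter> space M | u A. 0 \<le> u \<and> u \<le> s \<and> A \<in> sets borel}
     \<subseteq> {W u -` A \<inter> space M | u A. 0 \<le> u \<and> u \<le> t \<and> A \<in> sets borel}"
  by fastforce

lemma natural_mono: "s \<le> t \<Longrightarrow> sets (natural_filtration M W s) \<subseteq> sets (natural_filtration M W t)"
  unfolding sets_natural by (rule sigma_sets_mono') (rule natural_generator_mono)

lemma natural_subset: "sets (natural_filtration M W s) \<subseteq> sets M"
  unfolding sets_natural
proof (rule sets.sigma_sets_subset)
  show "{W u -` A \<inter> space M |u A. 0 \<le> u \<and> u \<le> s \<and> A \<in> sets borel} \<subseteq> sets M"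
    using W_measurable by (auto intro: measurable_sets)
qed

lemma augmented_generator: "sets (natural_filtration M W s) \<union> null_sets M \<subseteq> Pow (space M)"
  using natural_subset sets.sets_into_space[of _ M] by (fastforce simp: null_sets_def)

lemma sets_augmented:
  "sets (F s) = sigma_sets (space M) (sets (natural_filtration M W s) \<union> null_sets M)"
  unfolding augmented_filtration_def by (rule sets_measure_of) (rule augmented_generator)

lemma space_augmented [simp]: "space (F s) = space M"
  unfolding augmented_filtration_def by (rule space_measure_of) (rule augmented_generator)

lemma F_mono: "s \<le> t \<Longrightarrow> sets (F s) \<subseteq> sets (F t)"
  unfolding sets_augmented using natural_mono by (intro sigma_sets_mono') blast

lemma F_subset: "sets (F s) \<subseteq> sets M"
  unfolding sets_augmented
  using natural_subset by (intro sets.sigma_sets_subset) (auto simp: null_sets_def)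

lemma measurable_F_mono: "f \<in> borel_measurable (F s) \<Longrightarrow> s \<le> t \<Longrightarrow> f \<in> borel_measurable (F t)"
  using measurable_mono[OF order.refl refl F_mono, of s t borel] by auto

lemma measurable_F_M: "f \<in> borel_measurable (F s) \<Longrightarrow> f \<in> borel_measurable M"
  using measurable_mono[OF order.refl refl F_subset, of s borel] by auto

lemma W_measurable_F: "0 \<le> u \<Longrightarrow> u \<le> s \<Longrightarrow> W u \<in> borel_measurable (F s)"
proof (rule measurableI)
  fix A :: "(real^'n) set" assume "0 \<le> u" "u \<le> s" "A \<in> sets borel"
  then have "W u -` A \<inter> space M \<in> sets (natural_filtration M W s)"
    unfolding sets_natural by (intro sigma_sets.Basic) auto
  then show "W u -` A \<inter> space (F s) \<in> sets (F s)"
    unfolding sets_augmented by (auto intro: sigma_sets.Basic)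
qed auto

text \<open>Augmentation changes events only by null sets. The sets with a natural representative up to a null set
  form a sigma-algebra, which contains both families of generators. Independence of increments
  from the past therefore extends to the augmented filtration.\<close>

lemma augmented_ae_natural:
  assumes "A \<in> sets (F s)"
  shows "\<exists>B\<in>sets (natural_filtration M W s). (A - B) \<union> (B - A) \<in> null_sets M"
  using assms unfolding sets_augmented
proof (induction A rule: sigma_sets.induct)
  case (Basic A)
  then show ?case
  proof
    assume "A \<in> sets (natural_filtration M W s)" then show ?thesis by (intro bexI[of _ A]) auto
  next
    assume "A \<in> null_sets M" then show ?thesis by (intro bexI[of _ "{}"]) auto
  qed
next
  case Empty
  show ?case by (intro bexI[of _ "{}"]) auto
next
  case (Compl A)
  then obtain B where B: "B \<in> sets (natural_filtration M W s)" "(A - B) \<union> (B - A) \<in> null_sets M"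
    by auto
  have "A \<in> sets M" using Compl.hyps F_subset[of s] unfolding sets_augmented by blast
  have "B \<subseteq> space M" using B natural_subset sets.sets_into_space by blast
  moreover have "A \<subseteq> space M" using \<open>A \<in> sets M\<close> sets.sets_into_space by blast
  ultimately have "((space M - A) - (space M - B)) \<union> ((space M - B) - (space M - A)) = (A - B) \<union> (B - A)"
    by blast
  moreover have "space M - B \<in> sets (natural_filtration M W s)"
    using sets.compl_sets[OF B(1)] by simp
  ultimately show ?case using B(2) by (metis (no_types, lifting))
next
  case (Union A)
  then have "\<forall>i. \<exists>B. B \<in> sets (natural_filtration M W s) \<and> (A i - B) \<union> (B - A i) \<in> null_sets M"
    by blast
  then obtain B where B: "\<And>i. B i \<in> sets (natural_filtration M W s)"
      "\<And>i. (A i - B i) \<union> (B i - A i) \<in> null_sets M" by metis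
  let ?N = "\<Union>i. (A i - B i) \<union> (B i - A i)"
  have N: "?N \<in> null_sets M" using B(2) by (intro null_sets_UN)
  have "A i \<in> sets M" for i using Union.hyps F_subset[of s] unfolding sets_augmented by blast
  moreover have "B i \<in> sets M" for i using B natural_subset by blast
  ultimately have "(\<Union>i. A i) - (\<Union>i. B i) \<union> ((\<Union>i. B i) - (\<Union>i. A i)) \<in> sets M" by auto
  then have "(\<Union>i. A i) - (\<Union>i. B i) \<union> ((\<Union>i. B i) - (\<Union>i. A i)) \<in> null_sets M"
    by (rule null_sets_subset[OF N]) blast
  then show ?case using B(1) by (intro bexI[of _ "\<Union>i. B i"]) auto
qed

lemma increment_measurable: "0 \<le> s \<Longrightarrow> 0 \<le> t \<Longrightarrow> (\<lambda>\<omega>. W t \<omega> - W s \<omega>) \<in> borel_measurable M"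
  using W_measurable by auto

lemma indep_increment_sets:
  assumes st: "0 \<le> s" "s < t" and A: "A \<in> sets (F s)"
    and C: "C \<in> sets (vimage_algebra (space M) (\<lambda>\<omega>. W t \<omega> - W s \<omega>) borel)"
  shows "prob (A \<inter> C) = prob A * prob C"
proof -
  have ind: "indep_set (sets (natural_filtration M W s))
          (sets (vimage_algebra (space M) (\<lambda>\<omega>. W t \<omega> - W s \<omega>) borel))"
    using bm st by (simp add: brownian_motion_def)
  obtain B where B: "B \<in> sets (natural_filtration M W s)" "(A - B) \<union> (B - A) \<in> null_sets M"
    using augmented_ae_natural[OF A] by auto
  have AM: "A \<in> sets M" "B \<in> sets M" "C \<in> sets M"
    using A F_subset B natural_subset C ind unfolding indep_sets2_eq by blast+
  have ae: "AE \<omega> in M. \<omega> \<in> A \<longleftrightarrow> \<omega> \<in> B"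
    using AE_not_in[OF B(2)] by eventually_elim blast
  have "prob (A \<inter> C) = prob (B \<inter> C)"
    using ae AM by (intro finite_measure_eq_AE) auto
  also have "\<dots> = prob B * prob C"
    using ind B C unfolding indep_sets2_eq by blast
  also have "prob B = prob A"
    using ae AM by (intro finite_measure_eq_AE) auto
  finally show ?thesis .
qed

lemma indep_increment:
  fixes \<zeta> :: "'w \<Rightarrow> real" and g :: "real ^ 'n \<Rightarrow> real"
  assumes st: "0 \<le> s" "s < t" and z: "\<zeta> \<in> borel_measurable (F s)"
    and g: "g \<in> borel_measurable borel"
  shows "indep_var borel \<zeta> borel (\<lambda>\<omega>. g (W t \<omega> - W s \<omega>))"
proof -
  let ?D = "\<lambda>\<omega>. W t \<omega> - W s \<omega>"
  let ?V = "vimage_algebra (space M) ?D borel"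
  have meas: "\<zeta> \<in> borel_measurable M" "?D \<in> borel_measurable M"
    using measurable_F_M[OF z] increment_measurable st by auto
  have gD: "(\<lambda>\<omega>. g (?D \<omega>)) \<in> borel_measurable M"
    using measurable_compose[OF meas(2) g] .
  have "{\<zeta> -` A \<inter> space M |A. A \<in> sets borel} \<subseteq> sets (F s)"
    using measurable_sets[OF z] by auto
  then have s1: "sigma_sets (space M) {\<zeta> -` A \<inter> space M |A. A \<in> sets borel} \<subseteq> sets (F s)"
    using sets.sigma_sets_subset[of _ "F s"] by simp
  have DV: "?D \<in> measurable ?V borel"
    by (rule measurable_vimage_algebra1) auto
  have "(\<lambda>\<omega>. g (?D \<omega>)) \<in> borel_measurable ?V"
    using measurable_compose[OF DV g] .
  then have "{(\<lambda>\<omega>. g (?D \<omega>)) -` A \<inter> space M |A. A \<in> sets borel} \<subseteq> sets ?V"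
    using measurable_sets[of "\<lambda>\<omega>. g (?D \<omega>)" ?V] by auto
  then have s2: "sigma_sets (space M) {(\<lambda>\<omega>. g (?D \<omega>)) -` A \<inter> space M |A. A \<in> sets borel} \<subseteq> sets ?V"
    using sets.sigma_sets_subset[of _ ?V] by simp
  have sub: "sets ?V \<subseteq> sets M"
    using bm st by (simp add: brownian_motion_def indep_sets2_eq)
  show ?thesis
    unfolding indep_var_eq indep_sets2_eq
    using meas gD s1 s2 sub F_subset[of s] indep_increment_sets[OF st] by blast
qed

lemma increment_moments:
  assumes st: "0 \<le> s" "s < t"
  shows "integrable M (\<lambda>\<omega>. (W t \<omega> - W s \<omega>) $ i)" (is ?i1)
    "expectation (\<lambda>\<omega>. (W t \<omega> - W s \<omega>) $ i) = 0" (is ?e1)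
    "integrable M (\<lambda>\<omega>. (W t \<omega> - W s \<omega>) $ i * (W t \<omega> - W s \<omega>) $ j)" (is ?i2)
    "expectation (\<lambda>\<omega>. (W t \<omega> - W s \<omega>) $ i * (W t \<omega> - W s \<omega>) $ j) = (if i = j then t - s else 0)" (is ?e2)
proof -
  let ?D = "\<lambda>i \<omega>. (W t \<omega> - W s \<omega>) $ i"
  have dist: "distributed M lborel (?D i) (\<lambda>x. ennreal (normal_density 0 (sqrt (t - s)) x))" for i
    using bm st by (simp add: brownian_motion_def)
  have indep: "indep_vars (\<lambda>_. borel) ?D UNIV"
    using bm st by (simp add: brownian_motion_def)
  have pos: "0 < sqrt (t - s)" using st by simp
  have I1: "integrable M (?D i)" for i
    using distributed_integrable[OF dist[of i], of "\<lambda>x. x"] integrable_normal_moment[OF pos, of 0 1]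
    by (simp add: normal_density_nonneg)
  have E1: "expectation (?D i) = 0" for i
    using distributed_integral[OF dist[of i], of "\<lambda>x. x"] integral_normal_moment_odd[OF pos, of 0 0]
    by (simp add: normal_density_nonneg)
  have I2: "integrable M (\<lambda>\<omega>. (?D i \<omega>)^2)" for i
    using distributed_integrable[OF dist[of i], of "\<lambda>x. x^2"] integrable_normal_moment[OF pos, of 0 2]
    by (simp add: normal_density_nonneg)
  have E2: "expectation (\<lambda>\<omega>. (?D i \<omega>)^2) = t - s" for i
    using distributed_integral[OF dist[of i], of "\<lambda>x. x^2"] integral_normal_moment_even[OF pos, of 0 1] st
    by (simp add: normal_density_nonneg fact_numeral)
  have *: "integrable M (\<lambda>\<omega>. ?D i \<omega> * ?D j \<omega>)
      \<and> expectation (\<lambda>\<omega>. ?D i \<omega> * ?D j \<omega>) = (if i = j then t - s else 0)"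
  proof (cases "i = j")
    case True
    then show ?thesis using I2[of i] E2[of i] by (simp add: power2_eq_square)
  next
    case False
    have "indep_vars (\<lambda>_. borel) ?D {i, j}" by (rule indep_vars_subset[OF indep]) auto
    from indep_vars_integrable[OF _ this] indep_vars_lebesgue_integral[OF _ this] False I1 E1
    show ?thesis by (simp add: prod.insert)
  qed
  show ?i1 ?e1 ?i2 ?e2 using I1 E1 * by auto
qed

text \<open>Integrability of the past factor suffices, because it is independent of the increment. This matters
  in \<open>step_sum_moments\<close>, where the past factor is an unbounded partial sum.\<close>

lemma past_times_increment:
  fixes \<zeta> :: "'w \<Rightarrow> real" and g :: "real ^ 'n \<Rightarrow> real"
  assumes st: "0 \<le> s" "s < t" and z: "\<zeta> \<in> borel_measurable (F s)" "integrable M \<zeta>"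
    and g: "g \<in> borel_measurable borel" "integrable M (\<lambda>\<omega>. g (W t \<omega> - W s \<omega>))"
  shows "integrable M (\<lambda>\<omega>. \<zeta> \<omega> * g (W t \<omega> - W s \<omega>))"
    "expectation (\<lambda>\<omega>. \<zeta> \<omega> * g (W t \<omega> - W s \<omega>)) = expectation \<zeta> * expectation (\<lambda>\<omega>. g (W t \<omega> - W s \<omega>))"
proof -
  have "indep_var borel \<zeta> borel (\<lambda>\<omega>. g (W t \<omega> - W s \<omega>))"
    using indep_increment[OF st z(1) g(1)] .
  from indep_var_integrable[OF this z(2) g(2)] indep_var_lebesgue_integral[OF this z(2) g(2)]
  show "integrable M (\<lambda>\<omega>. \<zeta> \<omega> * g (W t \<omega> - W s \<omega>))"
    "expectation (\<lambda>\<omega>. \<zeta> \<omega> * g (W t \<omega> - W s \<omega>)) = expectation \<zeta> * expectation (\<lambda>\<omega>. g (W t \<omega> - W s \<omega>))" by auto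
qed

definition step_sum :: "(nat \<Rightarrow> real) \<Rightarrow> (nat \<Rightarrow> 'w \<Rightarrow> real ^ 'n) \<Rightarrow> nat \<Rightarrow> 'w \<Rightarrow> real" where
  "step_sum q \<zeta> L \<omega> = (\<Sum>l<L. \<zeta> l \<omega> \<bullet> (W (q (Suc l)) \<omega> - W (q l) \<omega>))"

text \<open>One step of the Ito isometry, expanded in coordinates: distinct coordinates of the increment are
  uncorrelated, and the diagonal terms contribute \<open>t - s\<close>.\<close>

lemma inner_increment_moments:
  fixes \<zeta> :: "'w \<Rightarrow> real ^ 'n"
  assumes st: "0 \<le> s" "s < t" and z: "\<zeta> \<in> borel_measurable (F s)" "\<And>\<omega>. \<omega> \<in> space M \<Longrightarrow> norm (\<zeta> \<omega>) \<le> c"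
    and Y: "Y \<in> borel_measurable (F s)" "integrable M Y"
  shows "integrable M (\<lambda>\<omega>. Y \<omega> * (\<zeta> \<omega> \<bullet> (W t \<omega> - W s \<omega>)))"
    "expectation (\<lambda>\<omega>. Y \<omega> * (\<zeta> \<omega> \<bullet> (W t \<omega> - W s \<omega>))) = 0"
    "integrable M (\<lambda>\<omega>. (\<zeta> \<omega> \<bullet> (W t \<omega> - W s \<omega>))\<^sup>2)"
    "expectation (\<lambda>\<omega>. (\<zeta> \<omega> \<bullet> (W t \<omega> - W s \<omega>))\<^sup>2) = expectation (\<lambda>\<omega>. (norm (\<zeta> \<omega>))\<^sup>2) * (t - s)"
proof -
  let ?D = "\<lambda>i \<omega>. (W t \<omega> - W s \<omega>) $ i"
  have zi: "(\<lambda>\<omega>. \<zeta> \<omega> $ i) \<in> borel_measurable (F s)" for i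
    using z(1) by (rule measurable_compose) simp
  have bd: "\<bar>\<zeta> \<omega> $ i\<bar> \<le> c" if "\<omega> \<in> space M" for \<omega> i
    using z(2)[OF that] component_le_norm_cart[of "\<zeta> \<omega>" i] by linarith
  have YI: "integrable M (\<lambda>\<omega>. Y \<omega> * \<zeta> \<omega> $ i)" for i
  proof (rule Bochner_Integration.integrable_bound)
    show "integrable M (\<lambda>\<omega>. Y \<omega> * c)" using Y by simp
    show "(\<lambda>\<omega>. Y \<omega> * \<zeta> \<omega> $ i) \<in> borel_measurable M"
      using measurable_F_M[OF Y(1)] measurable_F_M[OF zi] by simp
    show "AE x in M. norm (Y x * \<zeta> x $ i) \<le> norm (Y x * c)"
      using order_trans[OF bd abs_ge_self] by (intro AE_I2) (auto simp: abs_mult intro!: mult_left_mono)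
  qed
  have ZI: "integrable M (\<lambda>\<omega>. \<zeta> \<omega> $ i * \<zeta> \<omega> $ j)" for i j
  proof (rule integrable_const_bound[of _ "c * c"])
    show "AE x in M. norm (\<zeta> x $ i * \<zeta> x $ j) \<le> c * c"
      using bd by (intro AE_I2) (auto simp: abs_mult intro!: mult_mono intro: order_trans[OF abs_ge_zero])
    show "(\<lambda>\<omega>. \<zeta> \<omega> $ i * \<zeta> \<omega> $ j) \<in> borel_measurable M"
      using measurable_F_M[OF zi] by simp
  qed
  have a: "integrable M (\<lambda>\<omega>. (Y \<omega> * \<zeta> \<omega> $ i) * ?D i \<omega>)" "expectation (\<lambda>\<omega>. (Y \<omega> * \<zeta> \<omega> $ i) * ?D i \<omega>) = 0" for i
    using past_times_increment[OF st, of "\<lambda>\<omega>. Y \<omega> * \<zeta> \<omega> $ i" "\<lambda>x. x $ i"] YI zi Y increment_moments[OF st, of i]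
    by auto
  have b: "integrable M (\<lambda>\<omega>. (\<zeta> \<omega> $ i * \<zeta> \<omega> $ j) * (?D i \<omega> * ?D j \<omega>))"
    "expectation (\<lambda>\<omega>. (\<zeta> \<omega> $ i * \<zeta> \<omega> $ j) * (?D i \<omega> * ?D j \<omega>)) =
       (if i = j then expectation (\<lambda>\<omega>. (\<zeta> \<omega> $ i)\<^sup>2) * (t - s) else 0)" for i j
    using past_times_increment[OF st, of "\<lambda>\<omega>. \<zeta> \<omega> $ i * \<zeta> \<omega> $ j" "\<lambda>x. x $ i * x $ j"] ZI zi increment_moments[OF st]
    by (auto simp: power2_eq_square)
  have e1: "Y \<omega> * (\<zeta> \<omega> \<bullet> (W t \<omega> - W s \<omega>)) = (\<Sum>i\<in>UNIV. (Y \<omega> * \<zeta> \<omega> $ i) * ?D i \<omega>)" for \<omega>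
    by (simp add: inner_vec_def sum_distrib_left mult.assoc)
  have e2: "(\<zeta> \<omega> \<bullet> (W t \<omega> - W s \<omega>))\<^sup>2 = (\<Sum>i\<in>UNIV. \<Sum>j\<in>UNIV. (\<zeta> \<omega> $ i * \<zeta> \<omega> $ j) * (?D i \<omega> * ?D j \<omega>))" for \<omega>
    by (simp add: inner_vec_def power2_eq_square sum_product mult.assoc mult.left_commute)
  show "integrable M (\<lambda>\<omega>. Y \<omega> * (\<zeta> \<omega> \<bullet> (W t \<omega> - W s \<omega>)))"
    "expectation (\<lambda>\<omega>. Y \<omega> * (\<zeta> \<omega> \<bullet> (W t \<omega> - W s \<omega>))) = 0"
    unfolding e1 using a by (auto simp: Bochner_Integration.integral_sum)
  show "integrable M (\<lambda>\<omega>. (\<zeta> \<omega> \<bullet> (W t \<omega> - W s \<omega>))\<^sup>2)"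
    unfolding e2 using b by auto
  have "expectation (\<lambda>\<omega>. (\<zeta> \<omega> \<bullet> (W t \<omega> - W s \<omega>))\<^sup>2) = (\<Sum>i\<in>UNIV. expectation (\<lambda>\<omega>. (\<zeta> \<omega> $ i)\<^sup>2) * (t - s))"
    unfolding e2 using b by (simp add: Bochner_Integration.integral_sum sum.delta)
  also have "\<dots> = expectation (\<lambda>\<omega>. (norm (\<zeta> \<omega>))\<^sup>2) * (t - s)"
    unfolding power2_norm_eq_inner inner_vec_def using ZI
    by (simp add: Bochner_Integration.integral_sum sum_distrib_right power2_eq_square)
  finally show "expectation (\<lambda>\<omega>. (\<zeta> \<omega> \<bullet> (W t \<omega> - W s \<omega>))\<^sup>2) = expectation (\<lambda>\<omega>. (norm (\<zeta> \<omega>))\<^sup>2) * (t - s)" .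
qed

text \<open>Ito isometry for finite sums. The cross term with the next increment vanishes because the partial
  sum is known at its left end point.\<close>

lemma step_sum_moments:
  assumes q0: "0 \<le> q 0" and q: "\<And>l. l < L \<Longrightarrow> q l < q (Suc l)"
    and z: "\<And>l. l < L \<Longrightarrow> \<zeta> l \<in> borel_measurable (F (q l))"
    and c: "\<And>l \<omega>. l < L \<Longrightarrow> \<omega> \<in> space M \<Longrightarrow> norm (\<zeta> l \<omega>) \<le> c"
  shows "0 \<le> q L \<and> step_sum q \<zeta> L \<in> borel_measurable (F (q L)) \<and>
    integrable M (step_sum q \<zeta> L) \<and> expectation (step_sum q \<zeta> L) = 0 \<and>
    integrable M (\<lambda>\<omega>. (step_sum q \<zeta> L \<omega>)\<^sup>2) \<and>
    expectation (\<lambda>\<omega>. (step_sum q \<zeta> L \<omega>)\<^sup>2) = (\<Sum>l<L. expectation (\<lambda>\<omega>. (norm (\<zeta> l \<omega>))\<^sup>2) * (q (Suc l) - q l))"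
  using q z c
proof (induction L)
  case 0
  then show ?case using q0 by (simp add: step_sum_def[abs_def])
next
  case (Suc L)
  let ?S = "step_sum q \<zeta> L" and ?D = "\<lambda>\<omega>. \<zeta> L \<omega> \<bullet> (W (q (Suc L)) \<omega> - W (q L) \<omega>)"
  have IH: "0 \<le> q L" "?S \<in> borel_measurable (F (q L))" "integrable M ?S" "expectation ?S = 0"
    "integrable M (\<lambda>\<omega>. (?S \<omega>)\<^sup>2)"
    "expectation (\<lambda>\<omega>. (?S \<omega>)\<^sup>2) = (\<Sum>l<L. expectation (\<lambda>\<omega>. (norm (\<zeta> l \<omega>))\<^sup>2) * (q (Suc l) - q l))"
    using Suc by auto
  have lt: "q L < q (Suc L)" using Suc.prems by auto
  have zL: "\<zeta> L \<in> borel_measurable (F (q L))" "\<And>\<omega>. \<omega> \<in> space M \<Longrightarrow> norm (\<zeta> L \<omega>) \<le> c"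
    using Suc.prems by auto
  note m1 = inner_increment_moments[OF IH(1) lt zL IH(2,3)]
  have one: "(\<lambda>_. 1::real) \<in> borel_measurable (F (q L))" "integrable M (\<lambda>_. 1::real)" by auto
  note m2 = inner_increment_moments[OF IH(1) lt zL one]
  have eq: "step_sum q \<zeta> (Suc L) = (\<lambda>\<omega>. ?S \<omega> + ?D \<omega>)"
    by (auto simp: step_sum_def)
  have sq: "(?S \<omega> + ?D \<omega>)\<^sup>2 = (?S \<omega>)\<^sup>2 + 2 * (?S \<omega> * ?D \<omega>) + (?D \<omega>)\<^sup>2" for \<omega>
    by (simp add: power2_sum)
  have D: "?D \<in> borel_measurable (F (q (Suc L)))"
    using measurable_F_mono[OF zL(1)] lt W_measurable_F[of "q L" "q (Suc L)"]
       W_measurable_F[of "q (Suc L)" "q (Suc L)"] IH(1) by (intro borel_measurable_inner) auto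
  show ?case
    unfolding eq sq using IH lt m1 m2 D measurable_F_mono[OF IH(2), of "q (Suc L)"] by auto
qed

end

section \<open>Lenglart's inequality for step integrands\<close>

text \<open>Used to merge the end points of two step processes into one common partition.\<close>

lemma increasing_enumeration:
  fixes P :: "real set"
  assumes "finite P" "P \<subseteq> {0..t}" "0 \<in> P" "t \<in> P"
  obtains q L where "q 0 = 0" "q L = t" "\<And>l. l < L \<Longrightarrow> q l < q (Suc l)" "q ` {..L} = P"
proof -
  define xs where "xs = sorted_list_of_set P"
  have set: "set xs = P" and sorted: "sorted_wrt (<) xs"
    using assms(1) by (auto simp: xs_def strict_sorted_list_of_set)
  have ne: "xs \<noteq> []" using set assms(3) by auto
  define q where "q l = xs ! l" for l
  define L where "L = length xs - 1"
  have len: "length xs = Suc L" using ne by (simp add: L_def)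
  have incr: "q i < q j" if "i < j" "j \<le> L" for i j
    using sorted_wrt_nth_less[OF sorted, of i j] that len by (simp add: q_def)
  have img: "q ` {..L} = P"
    unfolding set[symmetric] set_conv_nth q_def using len by (auto simp: less_Suc_eq_le)
  have "q 0 = 0"
  proof -
    obtain j where j: "j \<le> L" "q j = 0" using img assms(3) by force
    have "q 0 \<in> P" using img by auto
    then have "0 \<le> q 0" using assms(2) by auto
    then show ?thesis using incr[of 0 j] j by (cases "j = 0") auto
  qed
  moreover have "q L = t"
  proof -
    obtain j where j: "j \<le> L" "q j = t" using img assms(4) by force
    have "q L \<in> P" using img by auto
    then have "q L \<le> t" using assms(2) by auto
    then show ?thesis using incr[of j L] j by (cases "j = L") auto
  qed
  ultimately show ?thesis using incr img that[of q L] by simp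
qed

lemma chain_less:
  fixes q :: "nat \<Rightarrow> real"
  assumes "\<forall>l<L. q l < q (Suc l)" "i < j" "j \<le> L"
  shows "q i < q j"
  using assms(2,3)
proof (induction j)
  case (Suc j)
  then show ?case using assms(1) by (cases "i = j") (auto intro: less_trans)
qed simp

lemma chain_le_iff:
  fixes q :: "nat \<Rightarrow> real"
  assumes "\<forall>l<L. q l < q (Suc l)" "i \<le> L" "j \<le> L"
  shows "q i \<le> q j \<longleftrightarrow> i \<le> j"
  using chain_less[OF assms(1), of i j] chain_less[OF assms(1), of j i] assms(2,3)
  by (cases i j rule: linorder_cases) auto

lemma telescope_between:
  fixes q :: "nat \<Rightarrow> real" and f :: "real \<Rightarrow> 'b::ab_group_add"
  assumes q: "\<forall>l<L. q l < q (Suc l)" and ab: "a \<in> q ` {..L}" "b \<in> q ` {..L}" "a \<le> b"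
  shows "(\<Sum>l<L. if a < q (Suc l) \<and> q (Suc l) \<le> b then f (q (Suc l)) - f (q l) else 0) = f b - f a"
proof -
  obtain i j where ij: "a = q i" "b = q j" "i \<le> L" "j \<le> L" using ab by auto
  then have "i \<le> j" using chain_le_iff[OF q] ab(3) by simp
  have eq: "a < q (Suc l) \<and> q (Suc l) \<le> b \<longleftrightarrow> i \<le> l \<and> l < j" if "l < L" for l
    using chain_le_iff[OF q, of "Suc l" i] chain_le_iff[OF q, of "Suc l" j] ij that
    by auto
  have "(\<Sum>l<L. if a < q (Suc l) \<and> q (Suc l) \<le> b then f (q (Suc l)) - f (q l) else 0)
     = (\<Sum>l<L. if i \<le> l \<and> l < j then f (q (Suc l)) - f (q l) else 0)"
    using eq by (intro sum.cong) auto
  also have "\<dots> = (\<Sum>l\<in>{i..<j}. f (q (Suc l)) - f (q l))"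
    using ij(4) by (intro sum.mono_neutral_cong_right) auto
  also have "\<dots> = f b - f a" using \<open>i \<le> j\<close> using sum_Suc_diff'[of i j "\<lambda>l. f (q l)"] by (simp add: ij)
  finally show ?thesis .
qed

text \<open>The value on \<open>{q l<..q (Suc l)}\<close> is read off at the right end point, in accordance with the
  left-open intervals of elementary processes.\<close>

lemma step_function_integral:
  fixes q :: "nat \<Rightarrow> real" and g :: "real \<Rightarrow> real"
  assumes q: "\<forall>l<L. q l < q (Suc l)"
    and g: "\<And>l s. l < L \<Longrightarrow> q l < s \<Longrightarrow> s \<le> q (Suc l) \<Longrightarrow> g s = g (q (Suc l))"
  shows "set_integrable lborel {q 0..q L} g
    \<and> (LBINT s:{q 0..q L}. g s) = (\<Sum>l<L. g (q (Suc l)) * (q (Suc l) - q l))"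
  using q g
proof (induction L)
  case 0
  have eq: "(\<lambda>s. indicator {q 0} s *\<^sub>R g s) = (\<lambda>s. indicator {q 0} s *\<^sub>R g (q 0))"
    by (auto simp: indicator_def)
  show ?case unfolding atLeastAtMost_singleton set_integrable_def set_lebesgue_integral_def eq by simp
next
  case (Suc L)
  have IH: "set_integrable lborel {q 0..q L} g"
    "(LBINT s:{q 0..q L}. g s) = (\<Sum>l<L. g (q (Suc l)) * (q (Suc l) - q l))"
  proof -
    have "\<forall>l<L. q l < q (Suc l)" using Suc.prems(1) by simp
    moreover have "g s = g (q (Suc l))" if "l < L" "q l < s" "s \<le> q (Suc l)" for l s
      by (rule Suc.prems(2)) (use that in auto)
    ultimately have "set_integrable lborel {q 0..q L} g
      \<and> (LBINT s:{q 0..q L}. g s) = (\<Sum>l<L. g (q (Suc l)) * (q (Suc l) - q l))"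
      by (rule Suc.IH)
    then show "set_integrable lborel {q 0..q L} g"
      "(LBINT s:{q 0..q L}. g s) = (\<Sum>l<L. g (q (Suc l)) * (q (Suc l) - q l))" by blast+
  qed
  have le: "q 0 \<le> q L" using chain_le_iff[of L q 0 L] Suc.prems(1) by auto
  have lt: "q L < q (Suc L)" using Suc.prems(1) by simp
  have eq: "(\<lambda>s. indicator {q L<..q (Suc L)} s *\<^sub>R g s) = (\<lambda>s. indicator {q L<..q (Suc L)} s *\<^sub>R g (q (Suc L)))"
  proof
    fix s
    have "q L < s \<Longrightarrow> s \<le> q (Suc L) \<Longrightarrow> g s = g (q (Suc L))"
      by (rule Suc.prems(2)) auto
    then show "indicator {q L<..q (Suc L)} s *\<^sub>R g s = indicator {q L<..q (Suc L)} s *\<^sub>R g (q (Suc L))"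
      by (cases "q L < s \<and> s \<le> q (Suc L)") (simp_all only: indicator_def greaterThanAtMost_iff of_bool_eq scaleR_zero_left simp_thms)
  qed
  have last: "set_integrable lborel {q L<..q (Suc L)} g"
    "(LBINT s:{q L<..q (Suc L)}. g s) = g (q (Suc L)) * (q (Suc L) - q L)"
    unfolding set_integrable_def set_lebesgue_integral_def eq using lt by simp_all
  have un: "{q 0..q (Suc L)} = {q 0..q L} \<union> {q L<..q (Suc L)}" using le lt by auto
  have dj: "{q 0..q L} \<inter> {q L<..q (Suc L)} = {}" by auto
  show ?case
    unfolding un using IH last set_integrable_Un[OF IH(1) last(1)] set_integral_Un[OF dj IH(1) last(1)]
    by simp
qed

text \<open>Elementary processes with values in \<open>real ^ 'n\<close>. Pairing a matrix-valued elementary process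
  with a fixed vector produces one of these.\<close>

definition step_process :: "nat \<Rightarrow> (nat \<Rightarrow> real) \<Rightarrow> (nat \<Rightarrow> 'w \<Rightarrow> real ^ 'n) \<Rightarrow> real \<Rightarrow> 'w \<Rightarrow> real ^ 'n" where
  "step_process N p \<xi> s \<omega> = (\<Sum>k<N. indicator {p k<..p (Suc k)} s *\<^sub>R \<xi> k \<omega>)"

context brownian begin

text \<open>Lenglart's inequality. Dropping the coefficients from the first interval on which the accumulated
  quadratic variation exceeds \<open>\<delta>\<close> keeps the sum adapted and makes its second moment at most \<open>\<delta>\<close>, and nothing
  changes where the total does not exceed \<open>\<delta>\<close>. Chebyshev's inequality then applies to the stopped sum.\<close>

lemma step_sum_lenglart:
  assumes q0: "0 \<le> q 0" and q: "\<And>l. l < L \<Longrightarrow> q l < q (Suc l)"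
    and z: "\<And>l. l < L \<Longrightarrow> \<zeta> l \<in> borel_measurable (F (q l))"
    and c: "\<And>l \<omega>. l < L \<Longrightarrow> \<omega> \<in> space M \<Longrightarrow> norm (\<zeta> l \<omega>) \<le> c"
    and A: "A \<in> sets M" and \<epsilon>: "0 < \<epsilon>" and \<delta>: "0 \<le> \<delta>"
  shows "prob (A \<inter> {\<omega>\<in>space M. \<epsilon> < \<bar>step_sum q \<zeta> L \<omega>\<bar>})
    \<le> prob (A \<inter> {\<omega>\<in>space M. \<delta> < (\<Sum>l<L. (norm (\<zeta> l \<omega>))\<^sup>2 * (q (Suc l) - q l))}) + \<delta> / \<epsilon>\<^sup>2"
proof -
  have q': "\<forall>l<L. q l < q (Suc l)" using q by blast
  \<comment> \<open>\<open>S (Suc l)\<close> is known at time \<open>q l\<close>, since the interval lengths are deterministic; hence \<open>\<eta> l\<close> is adapted.\<close>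
  define S where "S l \<omega> = (\<Sum>i<l. (norm (\<zeta> i \<omega>))\<^sup>2 * (q (Suc i) - q i))" for l \<omega>
  define \<eta> where "\<eta> l \<omega> = (if S (Suc l) \<omega> \<le> \<delta> then \<zeta> l \<omega> else 0)" for l \<omega>
  have Sm: "S l \<in> borel_measurable (F (q l'))" if "l \<le> Suc l'" "l' < L" for l l'
  proof -
    have "\<zeta> i \<in> borel_measurable (F (q l'))" if "i < l" for i
    proof (rule measurable_F_mono[OF z])
      show "i < L" "q i \<le> q l'"
        using chain_le_iff[OF q', of i l'] that \<open>l \<le> Suc l'\<close> \<open>l' < L\<close> by auto
    qed
    then show ?thesis unfolding S_def[abs_def] by (intro borel_measurable_sum) auto
  qed
  have zm: "\<zeta> l \<in> borel_measurable M" if "l < L" for l using measurable_F_M[OF z[OF that]] .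
  have SL: "S L \<in> borel_measurable M" unfolding S_def[abs_def] using zm by (intro borel_measurable_sum) auto
  have \<eta>m: "\<eta> l \<in> borel_measurable (F (q l))" if "l < L" for l
  proof -
    have "{\<omega> \<in> space (F (q l)). S (Suc l) \<omega> \<le> \<delta>} \<in> sets (F (q l))"
      by (rule borel_measurable_le[OF Sm[of "Suc l" l] borel_measurable_const]) (use that in simp_all)
    then have "(\<lambda>\<omega>. if S (Suc l) \<omega> \<le> \<delta> then \<zeta> l \<omega> else 0) \<in> borel_measurable (F (q l))"
      by (rule measurable_If[OF z[OF that] borel_measurable_const])
    then show ?thesis by (simp only: \<eta>_def[abs_def])
  qed
  have c0: "norm (\<eta> l \<omega>) \<le> max c 0" if "l < L" "\<omega> \<in> space M" for l \<omega>
    using c[OF that] by (auto simp: \<eta>_def)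
  note mom = step_sum_moments[OF q0 q \<eta>m c0]
  have bound: "(\<Sum>i<l. (norm (\<eta> i \<omega>))\<^sup>2 * (q (Suc i) - q i)) \<le> min \<delta> (S l \<omega>)" if "l \<le> L" for l \<omega>
    using that
  proof (induction l)
    case 0 then show ?case using \<delta> by (simp add: S_def)
  next
    case (Suc l)
    then have "0 \<le> (norm (\<zeta> l \<omega>))\<^sup>2 * (q (Suc l) - q l)" using q[of l] by simp
    then show ?case using Suc by (auto simp: S_def \<eta>_def)
  qed
  have "expectation (\<lambda>\<omega>. (step_sum q \<eta> L \<omega>)\<^sup>2)
      = expectation (\<lambda>\<omega>. \<Sum>l<L. (norm (\<eta> l \<omega>))\<^sup>2 * (q (Suc l) - q l))"
  proof -
    have "integrable M (\<lambda>\<omega>. (norm (\<eta> l \<omega>))\<^sup>2)" if "l < L" for l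
    proof (rule integrable_const_bound[of _ "(max c 0)\<^sup>2"])
      show "AE \<omega> in M. norm ((norm (\<eta> l \<omega>))\<^sup>2) \<le> (max c 0)\<^sup>2"
        using c0[OF that] by (intro AE_I2) (simp add: power_mono)
      show "(\<lambda>\<omega>. (norm (\<eta> l \<omega>))\<^sup>2) \<in> borel_measurable M"
        using measurable_F_M[OF \<eta>m[OF that]] by simp
    qed
    then show ?thesis using mom by (simp add: Bochner_Integration.integral_sum)
  qed
  also have "\<dots> \<le> \<delta>"
  proof (rule integral_le_const)
    show "integrable M (\<lambda>\<omega>. \<Sum>l<L. (norm (\<eta> l \<omega>))\<^sup>2 * (q (Suc l) - q l))"
    proof (rule integrable_const_bound[of _ \<delta>])
      show "(\<lambda>\<omega>. \<Sum>l<L. (norm (\<eta> l \<omega>))\<^sup>2 * (q (Suc l) - q l)) \<in> borel_measurable M"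
        using measurable_F_M[OF \<eta>m] by (intro borel_measurable_sum) auto
      have "0 \<le> (\<Sum>l<L. (norm (\<eta> l \<omega>))\<^sup>2 * (q (Suc l) - q l))" for \<omega>
        using q by (intro sum_nonneg) (auto simp: less_imp_le)
      then show "AE \<omega> in M. norm (\<Sum>l<L. (norm (\<eta> l \<omega>))\<^sup>2 * (q (Suc l) - q l)) \<le> \<delta>"
        using bound[of L] by (intro AE_I2) (auto simp: abs_of_nonneg)
    qed
    show "AE \<omega> in M. (\<Sum>l<L. (norm (\<eta> l \<omega>))\<^sup>2 * (q (Suc l) - q l)) \<le> \<delta>"
      using bound[of L] by auto
  qed
  finally have E: "expectation (\<lambda>\<omega>. (step_sum q \<eta> L \<omega>)\<^sup>2) \<le> \<delta>" .
  have Sint: "integrable M (\<lambda>\<omega>. (step_sum q \<eta> L \<omega>)\<^sup>2)" "step_sum q \<eta> L \<in> borel_measurable M"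
    using mom measurable_F_M by auto
  have "prob {\<omega>\<in>space M. \<epsilon>\<^sup>2 \<le> (step_sum q \<eta> L \<omega>)\<^sup>2} \<le> expectation (\<lambda>\<omega>. (step_sum q \<eta> L \<omega>)\<^sup>2) / \<epsilon>\<^sup>2"
    using integral_Markov_inequality_measure[OF Sint(1), of "{}" "\<epsilon>\<^sup>2"] \<epsilon> by simp
  also have "\<dots> \<le> \<delta> / \<epsilon>\<^sup>2" using E by (intro divide_right_mono) auto
  finally have P: "prob {\<omega>\<in>space M. \<epsilon>\<^sup>2 \<le> (step_sum q \<eta> L \<omega>)\<^sup>2} \<le> \<delta> / \<epsilon>\<^sup>2" .
  have same: "step_sum q \<eta> L \<omega> = step_sum q \<zeta> L \<omega>" if "S L \<omega> \<le> \<delta>" for \<omega>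
  proof -
    have "S (Suc l) \<omega> \<le> S L \<omega>" if "l < L" for l
      unfolding S_def using that q by (intro sum_mono2) (auto simp: less_imp_le)
    then show ?thesis unfolding step_sum_def \<eta>_def using that by (intro sum.cong) force+
  qed
  have sub: "A \<inter> {\<omega>\<in>space M. \<epsilon> < \<bar>step_sum q \<zeta> L \<omega>\<bar>}
     \<subseteq> (A \<inter> {\<omega>\<in>space M. \<delta> < S L \<omega>}) \<union> {\<omega>\<in>space M. \<epsilon>\<^sup>2 \<le> (step_sum q \<eta> L \<omega>)\<^sup>2}"
  proof
    fix \<omega> assume w: "\<omega> \<in> A \<inter> {\<omega>\<in>space M. \<epsilon> < \<bar>step_sum q \<zeta> L \<omega>\<bar>}"
    show "\<omega> \<in> (A \<inter> {\<omega>\<in>space M. \<delta> < S L \<omega>}) \<union> {\<omega>\<in>space M. \<epsilon>\<^sup>2 \<le> (step_sum q \<eta> L \<omega>)\<^sup>2}"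
    proof (cases "S L \<omega> \<le> \<delta>")
      case True
      have "\<epsilon>\<^sup>2 \<le> \<bar>step_sum q \<zeta> L \<omega>\<bar>\<^sup>2" using w \<epsilon> by (intro power_mono) auto
      then show ?thesis using w same[OF True] by simp
    qed (use w in auto)
  qed
  have m1: "A \<inter> {\<omega>\<in>space M. \<delta> < S L \<omega>} \<in> sets M" using A SL by measurable
  have m2: "{\<omega>\<in>space M. \<epsilon>\<^sup>2 \<le> (step_sum q \<eta> L \<omega>)\<^sup>2} \<in> sets M" using Sint(2) by measurable
  have "prob (A \<inter> {\<omega>\<in>space M. \<epsilon> < \<bar>step_sum q \<zeta> L \<omega>\<bar>})
     \<le> prob ((A \<inter> {\<omega>\<in>space M. \<delta> < S L \<omega>}) \<union> {\<omega>\<in>space M. \<epsilon>\<^sup>2 \<le> (step_sum q \<eta> L \<omega>)\<^sup>2})"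
    using m1 m2 by (intro finite_measure_mono sub) auto
  also have "\<dots> \<le> prob (A \<inter> {\<omega>\<in>space M. \<delta> < S L \<omega>}) + \<delta> / \<epsilon>\<^sup>2"
    using measure_Un_le[OF m1 m2] P by linarith
  finally show ?thesis unfolding S_def .
qed

definition adapted_step :: "nat \<Rightarrow> (nat \<Rightarrow> real) \<Rightarrow> (nat \<Rightarrow> 'w \<Rightarrow> real ^ 'n) \<Rightarrow> bool" where
  "adapted_step N p \<xi> \<longleftrightarrow> 0 \<le> p 0 \<and> (\<forall>k<N. p k < p (Suc k)) \<and>
     (\<forall>k<N. \<xi> k \<in> borel_measurable (F (p k)) \<and> (\<exists>c. \<forall>\<omega>\<in>space M. norm (\<xi> k \<omega>) \<le> c))"

definition step_integral :: "nat \<Rightarrow> (nat \<Rightarrow> real) \<Rightarrow> (nat \<Rightarrow> 'w \<Rightarrow> real ^ 'n) \<Rightarrow> real \<Rightarrow> 'w \<Rightarrow> real" where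
  "step_integral N p \<xi> t \<omega> = (\<Sum>k<N. \<xi> k \<omega> \<bullet> (W (min (p (Suc k)) t) \<omega> - W (min (p k) t) \<omega>))"

text \<open>On a partition that contains all end points, the value of a step process on an interval is known at
  the left end of that interval, and the integral telescopes into a sum over the partition.\<close>

lemma step_refine:
  assumes ad: "adapted_step N p \<xi>"
    and q: "q 0 = 0" "q L = t" "\<And>l. l < L \<Longrightarrow> q l < q (Suc l)"
    and sub: "\<And>k. k \<le> N \<Longrightarrow> min (p k) t \<in> q ` {..L}"
  shows "step_integral N p \<xi> t \<omega> = step_sum q (\<lambda>l. step_process N p \<xi> (q (Suc l))) L \<omega>"
    "l < L \<Longrightarrow> step_process N p \<xi> (q (Suc l)) \<in> borel_measurable (F (q l))"
    "l < L \<Longrightarrow> q l < s \<Longrightarrow> s \<le> q (Suc l) \<Longrightarrow> step_process N p \<xi> s \<omega> = step_process N p \<xi> (q (Suc l)) \<omega>"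
    "\<exists>c. \<forall>s. \<forall>\<omega>\<in>space M. norm (step_process N p \<xi> s \<omega>) \<le> c"
proof -
  have q': "\<forall>l<L. q l < q (Suc l)" using q by blast
  have qt: "q l \<le> t" if "l \<le> L" for l
    using chain_le_iff[OF q', of l L] that q(2) by auto
  \<comment> \<open>No end point lies strictly inside an interval of the refined partition.\<close>
  have key: "p k \<le> q l" if kl: "l < L" "k \<le> N" "p k < q (Suc l)" for k l
  proof -
    obtain j where j: "j \<le> L" "min (p k) t = q j" using sub[OF kl(2)] by auto
    have "min (p k) t = p k" using kl qt[of "Suc l"] by auto
    then have "q j < q (Suc l)" using j kl by simp
    then have "j \<le> l" using chain_le_iff[OF q', of "Suc l" j] kl j by auto
    then show ?thesis using chain_le_iff[OF q', of j l] j kl \<open>min (p k) t = p k\<close> by auto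
  qed
  have pk: "p k < p (Suc k)" if "k < N" for k using ad that by (simp add: adapted_step_def)
  show "step_integral N p \<xi> t \<omega> = step_sum q (\<lambda>l. step_process N p \<xi> (q (Suc l))) L \<omega>"
  proof -
    have tel: "(\<Sum>l<L. indicator {p k<..p (Suc k)} (q (Suc l)) *\<^sub>R (W (q (Suc l)) \<omega> - W (q l) \<omega>))
        = W (min (p (Suc k)) t) \<omega> - W (min (p k) t) \<omega>" if "k < N" for k
    proof -
      have "(\<Sum>l<L. indicator {p k<..p (Suc k)} (q (Suc l)) *\<^sub>R (W (q (Suc l)) \<omega> - W (q l) \<omega>))
        = (\<Sum>l<L. if min (p k) t < q (Suc l) \<and> q (Suc l) \<le> min (p (Suc k)) t
             then W (q (Suc l)) \<omega> - W (q l) \<omega> else 0)"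
      proof (intro sum.cong refl)
        fix l assume "l \<in> {..<L}"
        then show "indicator {p k<..p (Suc k)} (q (Suc l)) *\<^sub>R (W (q (Suc l)) \<omega> - W (q l) \<omega>) =
          (if min (p k) t < q (Suc l) \<and> q (Suc l) \<le> min (p (Suc k)) t
             then W (q (Suc l)) \<omega> - W (q l) \<omega> else 0)"
          using qt[of "Suc l"] by (auto simp: indicator_def min_less_iff_disj)
      qed
      also have "\<dots> = W (min (p (Suc k)) t) \<omega> - W (min (p k) t) \<omega>"
        using telescope_between[OF q', of "min (p k) t" "min (p (Suc k)) t" "\<lambda>s. W s \<omega>"]
          sub[of k] sub[of "Suc k"] pk[OF that] that by (auto simp: min_def)
      finally show ?thesis .
    qed
    have "step_sum q (\<lambda>l. step_process N p \<xi> (q (Suc l))) L \<omega>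
      = (\<Sum>l<L. \<Sum>k<N. \<xi> k \<omega> \<bullet> (indicator {p k<..p (Suc k)} (q (Suc l)) *\<^sub>R (W (q (Suc l)) \<omega> - W (q l) \<omega>)))"
      by (simp add: step_sum_def step_process_def inner_sum_left)
    also have "\<dots> = (\<Sum>k<N. \<xi> k \<omega> \<bullet> (\<Sum>l<L. indicator {p k<..p (Suc k)} (q (Suc l)) *\<^sub>R (W (q (Suc l)) \<omega> - W (q l) \<omega>)))"
      by (subst sum.swap) (simp add: inner_sum_right)
    also have "\<dots> = step_integral N p \<xi> t \<omega>"
      unfolding step_integral_def using tel by (intro sum.cong) auto
    finally show ?thesis by simp
  qed
  show "step_process N p \<xi> (q (Suc l)) \<in> borel_measurable (F (q l))" if "l < L"
    unfolding step_process_def[abs_def]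
  proof (rule borel_measurable_sum)
    fix k assume "k \<in> {..<N}"
    then have k: "k < N" by simp
    show "(\<lambda>\<omega>. indicator {p k<..p (Suc k)} (q (Suc l)) *\<^sub>R \<xi> k \<omega>) \<in> borel_measurable (F (q l))"
    proof (cases "p k < q (Suc l)")
      case True
      then have "\<xi> k \<in> borel_measurable (F (q l))"
        using key[of l k] that True ad k by (auto simp: adapted_step_def intro: measurable_F_mono)
      then show ?thesis by simp
    qed simp
  qed
  show "step_process N p \<xi> s \<omega> = step_process N p \<xi> (q (Suc l)) \<omega>" if "l < L" "q l < s" "s \<le> q (Suc l)"
    unfolding step_process_def
  proof (intro sum.cong refl)
    fix k assume "k \<in> {..<N}"
    then have k: "k < N" by simp
    show "indicator {p k<..p (Suc k)} s *\<^sub>R \<xi> k \<omega> = indicator {p k<..p (Suc k)} (q (Suc l)) *\<^sub>R \<xi> k \<omega>"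
      using key[of l k] key[of l "Suc k"] that k by (auto simp: indicator_def)
  qed
  show "\<exists>c. \<forall>s. \<forall>\<omega>\<in>space M. norm (step_process N p \<xi> s \<omega>) \<le> c"
  proof -
    obtain c where c: "\<And>k \<omega>. k < N \<Longrightarrow> \<omega> \<in> space M \<Longrightarrow> norm (\<xi> k \<omega>) \<le> c k"
      using ad unfolding adapted_step_def by metis
    have "norm (step_process N p \<xi> s \<omega>) \<le> (\<Sum>k<N. \<bar>c k\<bar>)" if "\<omega> \<in> space M" for s \<omega>
      unfolding step_process_def
    proof (rule sum_norm_le)
      fix k assume "k \<in> {..<N}"
      then show "norm (indicator {p k<..p (Suc k)} s *\<^sub>R \<xi> k \<omega>) \<le> \<bar>c k\<bar>"
        using c[of k \<omega>] that by (auto simp: indicator_def)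
    qed
    then show ?thesis by blast
  qed
qed

text \<open>Two step integrals are compared on the common refinement of their partitions, where their
  difference is a single adapted sum.\<close>

lemma step_integral_lenglart:
  assumes ad: "adapted_step N1 p1 \<xi>1" "adapted_step N2 p2 \<xi>2" and t: "0 \<le> t"
    and A: "A \<in> sets M" and \<epsilon>: "0 < \<epsilon>" and \<delta>: "0 \<le> \<delta>"
  shows "prob (A \<inter> {\<omega>\<in>space M. \<epsilon> < \<bar>step_integral N1 p1 \<xi>1 t \<omega> - step_integral N2 p2 \<xi>2 t \<omega>\<bar>})
    \<le> prob (A \<inter> {\<omega>\<in>space M. \<delta> < (LBINT s:{0..t}. (norm (step_process N1 p1 \<xi>1 s \<omega> - step_process N2 p2 \<xi>2 s \<omega>))\<^sup>2)}) + \<delta> / \<epsilon>\<^sup>2"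
proof -
  define P where "P = {0, t} \<union> (\<lambda>k. min (p1 k) t) ` {..N1} \<union> (\<lambda>k. min (p2 k) t) ` {..N2}"
  have nn: "0 \<le> p k" if "adapted_step N p \<xi>" "k \<le> N" for N p \<xi> k
  proof -
    have "p 0 \<le> p k" using chain_le_iff[of N p 0 k] that by (auto simp: adapted_step_def)
    then show ?thesis using that by (auto simp: adapted_step_def)
  qed
  have "finite P" "P \<subseteq> {0..t}" "0 \<in> P" "t \<in> P"
    using t nn[OF ad(1)] nn[OF ad(2)] by (auto simp: P_def)
  then obtain q L where q: "q 0 = 0" "q L = t" "\<And>l. l < L \<Longrightarrow> q l < q (Suc l)" "q ` {..L} = P"
    using increasing_enumeration by metis
  have sub: "\<And>k. k \<le> N1 \<Longrightarrow> min (p1 k) t \<in> q ` {..L}" "\<And>k. k \<le> N2 \<Longrightarrow> min (p2 k) t \<in> q ` {..L}"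
    unfolding q(4) by (auto simp: P_def)
  note r1 = step_refine[OF ad(1) q(1-3) sub(1)] and r2 = step_refine[OF ad(2) q(1-3) sub(2)]
  obtain c1 c2 where c: "\<And>s \<omega>. \<omega> \<in> space M \<Longrightarrow> norm (step_process N1 p1 \<xi>1 s \<omega>) \<le> c1"
     "\<And>s \<omega>. \<omega> \<in> space M \<Longrightarrow> norm (step_process N2 p2 \<xi>2 s \<omega>) \<le> c2"
    using r1(4) r2(4) by metis
  define \<zeta> where "\<zeta> l \<omega> = step_process N1 p1 \<xi>1 (q (Suc l)) \<omega> - step_process N2 p2 \<xi>2 (q (Suc l)) \<omega>" for l \<omega>
  have diff: "step_integral N1 p1 \<xi>1 t \<omega> - step_integral N2 p2 \<xi>2 t \<omega> = step_sum q \<zeta> L \<omega>" for \<omega>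
    by (simp only: r1(1) r2(1) step_sum_def \<zeta>_def inner_diff_left sum_subtractf)
  have int: "(LBINT s:{0..t}. (norm (step_process N1 p1 \<xi>1 s \<omega> - step_process N2 p2 \<xi>2 s \<omega>))\<^sup>2)
     = (\<Sum>l<L. (norm (\<zeta> l \<omega>))\<^sup>2 * (q (Suc l) - q l))" for \<omega>
  proof -
    let ?g = "\<lambda>s. (norm (step_process N1 p1 \<xi>1 s \<omega> - step_process N2 p2 \<xi>2 s \<omega>))\<^sup>2"
    have "\<forall>l<L. q l < q (Suc l)" using q(3) by blast
    moreover have "?g s = ?g (q (Suc l))" if "l < L" "q l < s" "s \<le> q (Suc l)" for l s
    proof -
      have "step_process N1 p1 \<xi>1 s \<omega> = step_process N1 p1 \<xi>1 (q (Suc l)) \<omega>"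
        by (rule r1(3)) (use that in auto)
      moreover have "step_process N2 p2 \<xi>2 s \<omega> = step_process N2 p2 \<xi>2 (q (Suc l)) \<omega>"
        by (rule r2(3)) (use that in auto)
      ultimately show ?thesis by (simp only:)
    qed
    ultimately have "(LBINT s:{q 0..q L}. ?g s) = (\<Sum>l<L. ?g (q (Suc l)) * (q (Suc l) - q l))"
      by (rule step_function_integral[THEN conjunct2])
    then show ?thesis unfolding \<zeta>_def q(1,2) .
  qed
  show ?thesis
    unfolding diff int
  proof (rule step_sum_lenglart[where q = q and \<zeta> = \<zeta> and L = L and c = "c1 + c2"])
    show "q l < q (Suc l)" if "l < L" for l using q(3) that .
    show "A \<in> sets M" "0 < \<epsilon>" "0 \<le> \<delta>" by (rule A \<epsilon> \<delta>)+
    show "\<zeta> l \<in> borel_measurable (F (q l))" if "l < L" for l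
      unfolding \<zeta>_def[abs_def]
      by (rule borel_measurable_diff; rule r1(2) r2(2)) (use that in auto)
    show "norm (\<zeta> l \<omega>) \<le> c1 + c2" if "\<omega> \<in> space M" for l \<omega>
      unfolding \<zeta>_def using c(1)[OF that, of "q (Suc l)"] c(2)[OF that, of "q (Suc l)"]
      by (intro norm_triangle_le_diff) linarith
  qed (use q in auto)
qed

end

section \<open>Adapted continuous processes cut off at a level\<close>

lemma norm_cart_squared: "(norm (x :: real ^ 'k))\<^sup>2 = (\<Sum>i\<in>UNIV. (x $ i)\<^sup>2)"
  by (simp add: norm_vec_def L2_set_def sum_nonneg)

lemma norm_matrix_squared: "(norm (A :: real ^ 'k ^ 'l))\<^sup>2 = (\<Sum>i\<in>UNIV. \<Sum>j\<in>UNIV. (A $ i $ j)\<^sup>2)"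
proof -
  have "(norm A)\<^sup>2 = (\<Sum>i\<in>UNIV. (norm (A $ i))\<^sup>2)"
    unfolding norm_vec_def[of A] L2_set_def by (simp add: sum_nonneg)
  then show ?thesis by (simp add: norm_cart_squared)
qed

text \<open>The norm of matrices is the Frobenius norm, so this is the Cauchy--Schwarz inequality in each column.\<close>

lemma norm_transpose_mult_le:
  fixes A :: "real ^ 'n ^ 'd" and a :: "real ^ 'd"
  shows "norm (transpose A *v a) \<le> norm a * norm A"
proof -
  have "(norm (transpose A *v a))\<^sup>2 = (\<Sum>j\<in>UNIV. (\<Sum>i\<in>UNIV. A $ i $ j * a $ i)\<^sup>2)"
    by (simp add: norm_cart_squared matrix_vector_mult_def transpose_def)
  also have "\<dots> \<le> (\<Sum>j\<in>UNIV. (\<Sum>i\<in>UNIV. (A $ i $ j)\<^sup>2) * (\<Sum>i\<in>UNIV. (a $ i)\<^sup>2))"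
    by (intro sum_mono Cauchy_Schwarz_ineq_sum)
  also have "\<dots> = (\<Sum>j\<in>UNIV. \<Sum>i\<in>UNIV. (A $ i $ j)\<^sup>2) * (norm a)\<^sup>2"
    by (simp add: sum_distrib_right norm_cart_squared)
  also have "(\<Sum>j\<in>UNIV. \<Sum>i\<in>UNIV. (A $ i $ j)\<^sup>2) = (norm A)\<^sup>2"
    unfolding norm_matrix_squared by (rule sum.swap)
  finally have "(norm (transpose A *v a))\<^sup>2 \<le> (norm a * norm A)\<^sup>2" by (simp add: power_mult_distrib mult.commute)
  then show ?thesis by (rule power2_le_imp_le) simp
qed

lemma inner_matrix_transpose:
  fixes A :: "real ^ 'n ^ 'd" shows "a \<bullet> (A *v w) = (transpose A *v a) \<bullet> w"
  by (simp only: dot_lmul_matrix transpose_matrix_vector)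

lemma transpose_mult_combination:
  fixes A :: "nat \<Rightarrow> real ^ 'n ^ 'd"
  shows "transpose (\<Sum>k<N. c k *\<^sub>R A k) *v a = (\<Sum>k<N. c k *\<^sub>R (transpose (A k) *v a))"
proof (induction N)
  case 0
  show ?case by (simp add: vec_eq_iff transpose_def matrix_vector_mult_def)
next
  case (Suc N)
  have "transpose (C + b *\<^sub>R D) *v a = transpose C *v a + b *\<^sub>R (transpose D *v a)" for C D :: "real ^ 'n ^ 'd" and b
    by (simp add: vec_eq_iff transpose_def matrix_vector_mult_def sum.distrib[symmetric] sum_distrib_left algebra_simps)
  then show ?case using Suc by simp
qed

lemma step_process_eq:
  assumes "\<forall>k<N. p k < p (Suc k)" "k < N" "p k < s" "s \<le> p (Suc k)"
  shows "step_process N p \<xi> s \<omega> = \<xi> k \<omega>"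
proof -
  have "indicator {p j<..p (Suc j)} s *\<^sub>R \<xi> j \<omega> = (if j = k then \<xi> k \<omega> else 0)" if "j < N" for j
  proof (cases j k rule: linorder_cases)
    case less
    then have "p (Suc j) \<le> p k" using chain_le_iff[OF assms(1), of "Suc j" k] assms(2) by auto
    then show ?thesis using assms less by (auto simp: indicator_def)
  next
    case greater
    then have "p (Suc k) \<le> p j" using chain_le_iff[OF assms(1), of "Suc k" j] that by auto
    then show ?thesis using assms greater by (auto simp: indicator_def)
  qed (use assms in auto)
  then have "step_process N p \<xi> s \<omega> = (\<Sum>j<N. if j = k then \<xi> k \<omega> else 0)"
    unfolding step_process_def by (intro sum.cong) auto
  then show ?thesis using assms(2) by simp
qed

lemma grid_cell:
  assumes "0 < \<tau>" "0 < s" "s \<le> real K * \<tau>"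
  obtains k where "k < K" "real k * \<tau> < s" "s \<le> real (Suc k) * \<tau>"
proof -
  define j where "j = nat \<lceil>s / \<tau>\<rceil>"
  have pos: "0 < s / \<tau>" using assms by simp
  have j: "real j = of_int \<lceil>s / \<tau>\<rceil>" unfolding j_def using pos by simp
  have j1: "s / \<tau> \<le> real j" "real j < s / \<tau> + 1" unfolding j by linarith+
  have "j \<noteq> 0" using j1 pos by (cases j) auto
  then obtain k where k: "j = Suc k" by (cases j) auto
  have "s / \<tau> \<le> real K" using assms by (simp add: divide_le_eq)
  then have "j \<le> K" unfolding j_def using pos by (simp add: ceiling_le_iff nat_le_iff)
  then show ?thesis using that[of k] k j1 assms by (auto simp: field_simps)
qed

text \<open>The process \<open>r\<close> drives the localization. Paths are continuous only almost surely, and neither the null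
  set nor the exit time of a ball is measurable without further argument; the definitions below
  therefore refer to rational times.\<close>

locale localized = brownian M W
  for M :: "'w measure" and W :: "real \<Rightarrow> 'w \<Rightarrow> real ^ 'n" +
  fixes r :: "real \<Rightarrow> 'w \<Rightarrow> real ^ 'n"
  assumes r_adapted: "\<And>t. 0 \<le> t \<Longrightarrow> r t \<in> borel_measurable (F t)"
    and r_cont: "AE \<omega> in M. continuous_on {0..} (\<lambda>t. r t \<omega>)"
begin

text \<open>The event that \<open>r\<close> stays in the ball of radius \<open>N\<close> up to time \<open>t\<close>. It plays the role of \<open>{t \<le> \<tau> N}\<close> for the
  exit time \<open>\<tau> N\<close>. Time \<open>t\<close> itself is included so that the bound at \<open>t\<close> holds on every path.\<close>

definition tame :: "real \<Rightarrow> real \<Rightarrow> 'w set" where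
  "tame N t = {\<omega>\<in>space M. norm (r t \<omega>) \<le> N \<and> (\<forall>q\<in>\<rat> \<inter> {0..t}. norm (r q \<omega>) \<le> N)}"

lemma r_measurable: "0 \<le> t \<Longrightarrow> r t \<in> borel_measurable M"
  using r_adapted measurable_F_M by blast

lemma tame_adapted:
  assumes "0 \<le> t" shows "tame N t \<in> sets (F t)"
proof -
  have c: "countable (\<rat> \<inter> {0..t})" using countable_rat by blast
  have m: "{\<omega>\<in>space (F t). norm (r q \<omega>) \<le> N} \<in> sets (F t)" if "0 \<le> q" "q \<le> t" for q
  proof -
    have [measurable]: "r q \<in> borel_measurable (F t)"
      using measurable_F_mono[OF r_adapted[OF that(1)] that(2)] .
    show ?thesis by measurable
  qed
  have eq: "tame N t = {\<omega>\<in>space (F t). norm (r t \<omega>) \<le> N} \<inter> {\<omega>\<in>space (F t). \<forall>q\<in>\<rat> \<inter> {0..t}. norm (r q \<omega>) \<le> N}"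
    by (auto simp: tame_def)
  show ?thesis unfolding eq
    using m[of t] assms by (intro sets.Int sets.sets_Collect_countable_All' c m) auto
qed

lemma tame_sets: "0 \<le> t \<Longrightarrow> tame N t \<in> sets M"
  using tame_adapted F_subset by blast

lemma tame_iff:
  assumes cont: "continuous_on {0..} (\<lambda>t. r t \<omega>)" and t: "0 \<le> t"
  shows "\<omega> \<in> tame N t \<longleftrightarrow> \<omega> \<in> space M \<and> (\<forall>s\<in>{0..t}. norm (r s \<omega>) \<le> N)"
proof
  assume w: "\<omega> \<in> tame N t"
  have "norm (r s \<omega>) \<le> N" if s: "s \<in> {0..t}" for s
  proof (cases "s = t")
    case True then show ?thesis using w by (simp add: tame_def)
  next
    case False
    show ?thesis
    proof (rule ccontr)
      assume "\<not> norm (r s \<omega>) \<le> N"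
      then have pos: "0 < norm (r s \<omega>) - N" by simp
      have "continuous_on {0..} (\<lambda>t. norm (r t \<omega>))" using cont by (rule continuous_on_norm)
      then obtain d where d: "0 < d" "\<And>u. u \<in> {0..} \<Longrightarrow> dist u s < d \<Longrightarrow> dist (norm (r u \<omega>)) (norm (r s \<omega>)) < norm (r s \<omega>) - N"
        using s pos unfolding continuous_on_iff by (metis atLeast_iff atLeastAtMost_iff)
      obtain q where q: "q \<in> \<rat>" "s < q" "q < min t (s + d)"
        using Rats_dense_in_real[of s "min t (s + d)"] s False d by auto
      then have "dist (norm (r q \<omega>)) (norm (r s \<omega>)) < norm (r s \<omega>) - N"
        using d s by (auto simp: dist_real_def)
      moreover have "norm (r q \<omega>) \<le> N" using w q s by (auto simp: tame_def)
      ultimately show False by (simp add: dist_real_def)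
    qed
  qed
  then show "\<omega> \<in> space M \<and> (\<forall>s\<in>{0..t}. norm (r s \<omega>) \<le> N)" using w by (simp add: tame_def)
next
  assume "\<omega> \<in> space M \<and> (\<forall>s\<in>{0..t}. norm (r s \<omega>) \<le> N)"
  then show "\<omega> \<in> tame N t" using t by (auto simp: tame_def)
qed

text \<open>Continuity from above: the events that \<open>r\<close> oscillates by more than \<open>\<rho>\<close> between rational times at distance
  less than \<open>1 / (n + 1)\<close> decrease to a null set, because paths are uniformly continuous on
  compact intervals. The result is a scale \<open>d\<close> that does not depend on \<open>\<omega>\<close>.\<close>

lemma modulus_of_continuity:
  assumes T: "0 < T" and \<rho>: "0 < \<rho>" and e: "0 < e"
  obtains d E where "0 < d" "E \<in> sets M" "prob E \<le> e"
    "AE \<omega> in M. \<omega> \<notin> E \<longrightarrow> (\<forall>s\<in>{0..T}. \<forall>u\<in>{0..T}. \<bar>s - u\<bar> < d \<longrightarrow> norm (r s \<omega> - r u \<omega>) \<le> \<rho>)"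
proof -
  let ?C = "\<rat> \<inter> {0..T}"
  define E where "E n = {\<omega>\<in>space M. \<exists>s\<in>?C. \<exists>u\<in>?C. \<bar>s - u\<bar> < 1 / real (Suc n) \<and> \<rho> < norm (r s \<omega> - r u \<omega>)}" for n
  have c: "countable ?C" using countable_rat by blast
  have Em: "E n \<in> sets M" for n
    unfolding E_def
  proof (intro sets.sets_Collect_countable_Ex' c)
    fix s u assume su: "s \<in> ?C" "u \<in> ?C"
    have "{\<omega> \<in> space M. \<rho> < norm (r s \<omega> - r u \<omega>)} \<in> sets M"
    proof -
      have [measurable]: "r s \<in> borel_measurable M" "r u \<in> borel_measurable M" using r_measurable su by auto
      show ?thesis by measurable
    qed
    then show "{\<omega> \<in> space M. \<bar>s - u\<bar> < 1 / real (Suc n) \<and> \<rho> < norm (r s \<omega> - r u \<omega>)} \<in> sets M"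
      by (cases "\<bar>s - u\<bar> < 1 / real (Suc n)") auto
  qed
  have dec: "decseq E"
  proof (rule decseq_SucI)
    fix n
    have "1 / real (Suc (Suc n)) \<le> 1 / real (Suc n)" by (simp add: frac_le)
    then show "E (Suc n) \<le> E n" unfolding E_def by (fastforce intro: less_le_trans)
  qed
  have "AE \<omega> in M. \<omega> \<notin> (\<Inter>n. E n)"
    using r_cont
  proof eventually_elim
    case (elim \<omega>)
    have "continuous_on {0..T} (\<lambda>t. r t \<omega>)" using elim by (rule continuous_on_subset) auto
    then have "uniformly_continuous_on {0..T} (\<lambda>t. r t \<omega>)" by (intro compact_uniformly_continuous) auto
    then obtain d where d: "0 < d" "\<And>s u. s \<in> {0..T} \<Longrightarrow> u \<in> {0..T} \<Longrightarrow> dist u s < d \<Longrightarrow> dist (r u \<omega>) (r s \<omega>) < \<rho>"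
      using \<rho> unfolding uniformly_continuous_on_def by metis
    obtain n where n: "1 / real (Suc n) < d" using d(1) nat_approx_posE by auto
    have "\<omega> \<notin> E n"
    proof
      assume "\<omega> \<in> E n"
      then obtain s u where su: "s \<in> ?C" "u \<in> ?C" "\<bar>s - u\<bar> < 1 / real (Suc n)" "\<rho> < norm (r s \<omega> - r u \<omega>)"
        by (auto simp: E_def)
      then show False using d(2)[of u s] n by (auto simp: dist_norm)
    qed
    then show ?case by blast
  qed
  then have "prob (\<Inter>n. E n) = 0"
    using Em by (intro prob_eq_0[THEN iffD2]) auto
  moreover have "(\<lambda>n. prob (E n)) \<longlonglongrightarrow> prob (\<Inter>n. E n)"
    using Em dec by (intro finite_Lim_measure_decseq) auto
  ultimately have "eventually (\<lambda>n. prob (E n) < e) sequentially"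
    using e by (intro order_tendstoD(2)) auto
  then obtain n where n: "prob (E n) < e" by (auto simp: eventually_sequentially)
  have "AE \<omega> in M. \<omega> \<notin> E n \<longrightarrow> (\<forall>s\<in>{0..T}. \<forall>u\<in>{0..T}. \<bar>s - u\<bar> < 1 / real (Suc n) \<longrightarrow> norm (r s \<omega> - r u \<omega>) \<le> \<rho>)"
    using r_cont AE_space
  proof eventually_elim
    case (elim \<omega>)
    show ?case
    proof (intro impI ballI, rule ccontr)
      fix s u assume w: "\<omega> \<notin> E n" and su: "s \<in> {0..T}" "u \<in> {0..T}" "\<bar>s - u\<bar> < 1 / real (Suc n)"
        and neg: "\<not> norm (r s \<omega> - r u \<omega>) \<le> \<rho>"
      define g where "g = (norm (r s \<omega> - r u \<omega>) - \<rho>) / 2"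
      have g: "0 < g" using neg by (simp add: g_def)
      define k where "k = (1 / real (Suc n) - \<bar>s - u\<bar>) / 2"
      have k: "0 < k" using su by (simp add: k_def)
      have near: "\<exists>q\<in>?C. \<bar>q - v\<bar> < k \<and> norm (r q \<omega> - r v \<omega>) < g" if v: "v \<in> {0..T}" for v
      proof -
        obtain d where d: "0 < d" "\<And>u. u \<in> {0..} \<Longrightarrow> dist u v < d \<Longrightarrow> dist (r u \<omega>) (r v \<omega>) < g"
          using elim(1) v g unfolding continuous_on_iff by (metis atLeast_iff atLeastAtMost_iff)
        have "max 0 (v - min k d) < min T (v + min k d)" using v k d T by auto
        then obtain q where q: "q \<in> \<rat>" "max 0 (v - min k d) < q" "q < min T (v + min k d)"
          using Rats_dense_in_real by blast
        then have "\<bar>q - v\<bar> < k" "\<bar>q - v\<bar> < d" "q \<in> ?C" by auto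
        then show ?thesis using d(2)[of q] by (intro bexI[of _ q]) (auto simp: dist_norm)
      qed
      obtain q where q: "q \<in> ?C" "\<bar>q - s\<bar> < k" "norm (r q \<omega> - r s \<omega>) < g" using near[OF su(1)] by auto
      obtain p where p: "p \<in> ?C" "\<bar>p - u\<bar> < k" "norm (r p \<omega> - r u \<omega>) < g" using near[OF su(2)] by auto
      have k2: "\<bar>s - u\<bar> + 2 * k = 1 / real (Suc n)" 
      proof -
        have "2 * ((a - b) / 2) = a - b" for a b :: real by simp
        then show ?thesis unfolding k_def by (simp only: add_diff_cancel_left' diff_add_cancel add.commute[of "\<bar>s - u\<bar>"])
      qed
      have "\<bar>q - p\<bar> < 1 / real (Suc n)" unfolding k2[symmetric] using q(2) p(2) by linarith
      then have "norm (r q \<omega> - r p \<omega>) \<le> \<rho>" using w q(1) p(1) elim(2) by (force simp: E_def not_less)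
      moreover have "norm (r s \<omega> - r u \<omega>) \<le> norm (r q \<omega> - r p \<omega>) + norm (r q \<omega> - r s \<omega>) + norm (r p \<omega> - r u \<omega>)"
        by norm
      moreover have "2 * g = norm (r s \<omega> - r u \<omega>) - \<rho>" by (simp add: g_def)
      ultimately show False using q(3) p(3) by linarith
    qed
  qed
  then show ?thesis using that[of "1 / real (Suc n)" "E n"] n Em by auto
qed

end

context brownian begin

text \<open>Convergence in probability is phrased with the measures of sets that could fail to be measurable.
  Progressive measurability of the integrand and Fubini's theorem exclude this.\<close>

lemma ito_approximation_error_measurable:
  fixes H :: "real \<Rightarrow> 'w \<Rightarrow> real ^ 'n ^ 'd"
  assumes t: "0 \<le> t" and prog: "progressively_measurable F H t" and el: "elementary M F N p \<xi>"
  shows "(\<lambda>\<omega>. LBINT s:{0..t}. (norm (elementary_process N p \<xi> s \<omega> - H s \<omega>))\<^sup>2) \<in> borel_measurable M"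
proof -
  let ?L = "restrict_space lborel {0..t}"
  have id: "(\<lambda>x. x) \<in> measurable M (F t)"
    by (rule measurableI) (use F_subset[of t] sets.sets_into_space in \<open>auto simp: Int_absorb2\<close>)
  have sL: "sets ?L = sets (restrict_space borel {0..t})" by (rule sets_restrict_space_cong) simp
  have "(\<lambda>(s, \<omega>). H s \<omega>) \<in> borel_measurable (restrict_space borel {0..t} \<Otimes>\<^sub>M F t)"
    using prog t by (auto simp: progressively_measurable_def)
  moreover have "(\<lambda>(\<omega>, s). (s, \<omega>)) \<in> measurable (M \<Otimes>\<^sub>M ?L) (restrict_space borel {0..t} \<Otimes>\<^sub>M F t)"
  proof -
    have 1: "fst \<in> measurable (M \<Otimes>\<^sub>M ?L) (F t)" by (rule measurable_compose[OF measurable_fst id])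
    have "snd \<in> measurable (M \<Otimes>\<^sub>M ?L) ?L" by (rule measurable_snd)
    then have 2: "snd \<in> measurable (M \<Otimes>\<^sub>M ?L) (restrict_space borel {0..t})"
      using measurable_cong_sets[OF refl sL] by blast
    show ?thesis unfolding split_beta' by (rule measurable_Pair[OF 2 1])
  qed
  ultimately have "(\<lambda>x. (\<lambda>(s, \<omega>). H s \<omega>) ((\<lambda>(\<omega>, s). (s, \<omega>)) x)) \<in> borel_measurable (M \<Otimes>\<^sub>M ?L)"
    by (rule measurable_compose[rotated])
  then have H: "(\<lambda>x. H (snd x) (fst x)) \<in> borel_measurable (M \<Otimes>\<^sub>M ?L)" by (simp add: split_beta')
  have \<phi>: "(\<lambda>x. elementary_process N p \<xi> (snd x) (fst x)) \<in> borel_measurable (M \<Otimes>\<^sub>M ?L)"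
    unfolding elementary_process_def
  proof (intro borel_measurable_sum borel_measurable_scaleR)
    fix k assume "k \<in> {..<N}"
    then have "\<xi> k \<in> borel_measurable M" using el measurable_F_M by (auto simp: elementary_def)
    then show "(\<lambda>x. \<xi> k (fst x)) \<in> borel_measurable (M \<Otimes>\<^sub>M ?L)" by (rule measurable_compose[OF measurable_fst])
    have ind: "(indicator {p k<..p (Suc k)} :: real \<Rightarrow> real) \<in> borel_measurable ?L"
      by (rule measurable_restrict_space1) simp
    show "(\<lambda>x. indicator {p k<..p (Suc k)} (snd x) :: real) \<in> borel_measurable (M \<Otimes>\<^sub>M ?L)"
      by (rule measurable_compose[OF measurable_snd ind])
  qed
  interpret L: finite_measure ?L
    by (rule finite_measureI) (simp add: t space_restrict_space emeasure_restrict_space)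
  have "(\<lambda>\<omega>. \<integral> s. (norm (elementary_process N p \<xi> s \<omega> - H s \<omega>))\<^sup>2 \<partial>?L) \<in> borel_measurable M"
  proof (rule L.borel_measurable_lebesgue_integral)
    have "(\<lambda>x. (norm (elementary_process N p \<xi> (snd x) (fst x) - H (snd x) (fst x)))\<^sup>2) \<in> borel_measurable (M \<Otimes>\<^sub>M ?L)"
      by (intro borel_measurable_power measurable_compose[OF _ borel_measurable_norm] borel_measurable_diff \<phi> H)
    then show "(\<lambda>(\<omega>, s). (norm (elementary_process N p \<xi> s \<omega> - H s \<omega>))\<^sup>2) \<in> borel_measurable (M \<Otimes>\<^sub>M ?L)"
      by (simp add: split_beta')
  qed
  then show ?thesis
    by (simp add: set_lebesgue_integral_def integral_restrict_space)
qed

end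

section \<open>Riemann sums of a continuous integrand\<close>

lemma matrix_vector_measurable:
  fixes f :: "'w \<Rightarrow> real ^ 'n ^ 'd" and g :: "'w \<Rightarrow> real ^ 'n"
  assumes "f \<in> borel_measurable M" "g \<in> borel_measurable M"
  shows "(\<lambda>\<omega>. f \<omega> *v g \<omega>) \<in> borel_measurable M"
proof (rule borel_measurable_continuous_Pair[OF assms])
  show "continuous_on UNIV (\<lambda>x :: (real ^ 'n ^ 'd) \<times> (real ^ 'n). fst x *v snd x)"
    unfolding matrix_vector_mult_def by (intro continuous_intros)
qed

lemma transpose_vector_measurable:
  fixes f :: "'w \<Rightarrow> real ^ 'n ^ 'd" and a :: "real ^ 'd"
  assumes "f \<in> borel_measurable M"
  shows "(\<lambda>\<omega>. transpose (f \<omega>) *v a) \<in> borel_measurable M"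
proof (rule borel_measurable_continuous_on[OF _ assms])
  show "continuous_on UNIV (\<lambda>A :: real ^ 'n ^ 'd. transpose A *v a)"
    unfolding matrix_vector_mult_def transpose_def by (simp, intro continuous_intros)
qed

lemma elementary_error_integrable:
  fixes \<xi> :: "nat \<Rightarrow> 'w \<Rightarrow> real ^ 'n ^ 'd" and f :: "real \<Rightarrow> real ^ 'n ^ 'd"
  assumes cont: "continuous_on {0..} f"
  shows "set_integrable lborel {0..t} (\<lambda>s. (norm (elementary_process N p \<xi> s \<omega> - f s))\<^sup>2)"
proof -
  let ?\<phi> = "\<lambda>s. elementary_process N p \<xi> s \<omega>"
  have cont': "continuous_on {0..t} f" using cont by (rule continuous_on_subset) auto
  have m1: "(\<lambda>s. indicator {0..t} s *\<^sub>R f s) \<in> borel_measurable borel"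
    using cont' by (intro borel_measurable_continuous_on_indicator) auto
  have m2: "?\<phi> \<in> borel_measurable borel"
    unfolding elementary_process_def by (intro borel_measurable_sum borel_measurable_scaleR) auto
  have eq: "indicator {0..t} s *\<^sub>R (norm (?\<phi> s - f s))\<^sup>2
      = indicator {0..t} s *\<^sub>R (norm (?\<phi> s - indicator {0..t} s *\<^sub>R f s))\<^sup>2" for s
    by (auto simp: indicator_def)
  have "bounded (f ` {0..t})" using cont' by (intro compact_imp_bounded compact_continuous_image) auto
  then obtain c where c: "\<And>s. s \<in> {0..t} \<Longrightarrow> norm (f s) \<le> c" unfolding bounded_iff by blast
  define b where "b = (\<Sum>k<N. norm (\<xi> k \<omega>))"
  have b: "norm (?\<phi> s) \<le> b" for s
    unfolding elementary_process_def b_def by (intro sum_norm_le) (auto simp: indicator_def)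
  have bd: "norm (indicator {0..t} s *\<^sub>R (norm (?\<phi> s - f s))\<^sup>2) \<le> indicator {0..t} s *\<^sub>R (b + c)\<^sup>2" for s
  proof (cases "s \<in> {0..t}")
    case True
    have "norm (?\<phi> s - f s) \<le> b + c" using b[of s] c[OF True] by (intro norm_triangle_le_diff) linarith
    then show ?thesis using True by (simp add: power_mono)
  qed auto
  show ?thesis
    unfolding set_integrable_def
  proof (rule Bochner_Integration.integrable_bound[where f = "\<lambda>s. indicator {0..t} s *\<^sub>R (b + c)\<^sup>2"])
    show "integrable lborel (\<lambda>s. indicator {0..t} s *\<^sub>R (b + c)\<^sup>2)"
      by (cases "0 \<le> t") (auto simp: emeasure_lborel_Icc_eq)
    show "(\<lambda>s. indicator {0..t} s *\<^sub>R (norm (?\<phi> s - f s))\<^sup>2) \<in> borel_measurable lborel"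
      unfolding eq using m1 m2 by measurable
    show "AE s in lborel. norm (indicator {0..t} s *\<^sub>R (norm (?\<phi> s - f s))\<^sup>2) \<le> norm (indicator {0..t} s *\<^sub>R (b + c)\<^sup>2)"
      using bd by (intro AE_I2) (auto intro: order_trans)
  qed
qed

context localized begin

definition grid :: "real \<Rightarrow> nat \<Rightarrow> real" where "grid \<tau> k = real k * \<tau>"

text \<open>The integrand \<open>\<eta> (r s)\<close>, stopped when \<open>r\<close> leaves the ball of radius \<open>N\<close>.\<close>

definition cut :: "real \<Rightarrow> (real ^ 'n \<Rightarrow> real ^ 'n) \<Rightarrow> real \<Rightarrow> 'w \<Rightarrow> real ^ 'n" where
  "cut N \<eta> s \<omega> = indicator (tame N s) \<omega> *\<^sub>R \<eta> (r s \<omega>)"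

lemma grid_simps [simp]: "grid \<tau> 0 = 0" "0 < \<tau> \<Longrightarrow> grid \<tau> k < grid \<tau> (Suc k)" "0 < \<tau> \<Longrightarrow> 0 \<le> grid \<tau> k"
  by (simp_all add: grid_def algebra_simps)

lemma grid_diff: "grid \<tau> (Suc k) - grid \<tau> k = \<tau>" by (simp add: grid_def algebra_simps)

lemma cut_measurable:
  assumes "0 \<le> s" "bounded_linear \<eta>" shows "cut N \<eta> s \<in> borel_measurable (F s)"
proof -
  have "(\<lambda>\<omega>. \<eta> (r s \<omega>)) \<in> borel_measurable (F s)"
    using borel_measurable_continuous_on[OF linear_continuous_on[OF assms(2)] r_adapted[OF assms(1)]] .
  then show ?thesis unfolding cut_def[abs_def]
    using tame_adapted[OF assms(1)] by (intro borel_measurable_scaleR borel_measurable_indicator)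
qed

lemma cut_bounded:
  assumes "bounded_linear \<eta>"
  obtains c where "\<And>s \<omega>. norm (cut N \<eta> s \<omega>) \<le> c"
proof -
  obtain C where C: "0 < C" "\<And>x. norm (\<eta> x) \<le> norm x * C" using bounded_linear.pos_bounded[OF assms] by auto
  have "norm (cut N \<eta> s \<omega>) \<le> \<bar>N\<bar> * C" for s \<omega>
  proof (cases "\<omega> \<in> tame N s")
    case True
    then have "norm (r s \<omega>) \<le> \<bar>N\<bar>" by (auto simp: tame_def)
    then have "norm (r s \<omega>) * C \<le> \<bar>N\<bar> * C" using C by (intro mult_right_mono) auto
    then show ?thesis using True C(2)[of "r s \<omega>"] by (simp add: cut_def)
  qed (use C in \<open>simp add: cut_def\<close>)
  then show ?thesis using that by blast
qed

definition riemann :: "real \<Rightarrow> (real ^ 'n \<Rightarrow> real ^ 'n) \<Rightarrow> real \<Rightarrow> nat \<Rightarrow> 'w \<Rightarrow> real" where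
  "riemann N \<eta> \<tau> = step_sum (grid \<tau>) (\<lambda>k. cut N \<eta> (grid \<tau> k))"

lemma cut_adapted_step:
  assumes "0 < \<tau>" "bounded_linear \<eta>"
  shows "adapted_step K (grid \<tau>) (\<lambda>k. cut N \<eta> (grid \<tau> k))"
proof -
  obtain c where "\<And>s \<omega>. norm (cut N \<eta> s \<omega>) \<le> c" using cut_bounded[OF assms(2)] by blast
  then show ?thesis using assms cut_measurable by (auto simp: adapted_step_def)
qed

lemma grid_step_integral:
  assumes "0 < \<tau>" shows "step_integral K (grid \<tau>) \<zeta> (grid \<tau> K) = step_sum (grid \<tau>) \<zeta> K"
proof
  fix \<omega>
  have "grid \<tau> k \<le> grid \<tau> K" if "k \<le> K" for k using that assms by (simp add: grid_def)
  then show "step_integral K (grid \<tau>) \<zeta> (grid \<tau> K) \<omega> = step_sum (grid \<tau>) \<zeta> K \<omega>"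
    unfolding step_integral_def step_sum_def by (intro sum.cong) (auto simp: min_absorb1 Suc_le_eq)
qed

lemma step_integral_measurable:
  assumes "adapted_step N p \<xi>" "0 \<le> t"
  shows "step_integral N p \<xi> t \<in> borel_measurable M"
  unfolding step_integral_def[abs_def]
proof (intro borel_measurable_sum borel_measurable_inner borel_measurable_diff)
  fix k assume "k \<in> {..<N}"
  then have k: "k < N" by simp
  have inc: "\<forall>k<N. p k < p (Suc k)" using assms by (simp add: adapted_step_def)
  have nn: "0 \<le> p j" if "j \<le> N" for j
    using chain_le_iff[OF inc, of 0 j] that assms(1) by (auto simp: adapted_step_def)
  show "\<xi> k \<in> borel_measurable M" using assms k measurable_F_M by (auto simp: adapted_step_def)
  show "W (min (p (Suc k)) t) \<in> borel_measurable M" "W (min (p k) t) \<in> borel_measurable M"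
    using nn[of k] nn[of "Suc k"] k assms(2) by (auto intro: W_measurable)
qed

text \<open>Both the elementary integrals in the definition of \<open>J\<close> and the Riemann sums are step integrals. On
  \<open>tame N t\<close> the cut-off is inactive, so there the step integrands are both close to \<open>\<eta> (r s)\<close> in \<open>L\<^sup>2\<close>: the
  former by definition, the latter by continuity of paths. Lenglart's inequality on the event
  \<open>tame N t\<close> transfers this to the integrals. The scale \<open>d\<close> serves all grids at once, which is what
  permits one grid for several times \<open>t\<close>.\<close>

lemma riemann_sum_approximates_ito_integral:
  fixes H :: "real \<Rightarrow> 'w \<Rightarrow> real ^ 'n ^ 'd" and a :: "real ^ 'd"
  assumes t: "0 \<le> t" and ito: "is_ito_integral M F W H t J"
    and H\<eta>: "\<And>s \<omega>. transpose (H s \<omega>) *v a = \<eta> (r s \<omega>)" and \<eta>: "bounded_linear \<eta>"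
    and Hc: "AE \<omega> in M. continuous_on {0..} (\<lambda>s. H s \<omega>)" and e: "0 < e"
  shows "\<exists>d>0. \<forall>K \<tau>. 0 < \<tau> \<longrightarrow> \<tau> < d \<longrightarrow> grid \<tau> K = t \<longrightarrow>
    prob (tame N t \<inter> {\<omega>\<in>space M. e < \<bar>a \<bullet> J \<omega> - riemann N \<eta> \<tau> K \<omega>\<bar>}) \<le> e"
proof -
  interpret \<eta>: bounded_linear \<eta> by fact
  obtain C where C: "0 < C" "\<And>x. norm (\<eta> x) \<le> norm x * C" using \<eta>.pos_bounded by auto
  obtain Np p \<xi> where el: "\<And>j. elementary M F (Np j) (p j) (\<xi> j)"
    and err0: "tendsto_in_prob M
          (\<lambda>j \<omega>. LBINT s:{0..t}. (norm (elementary_process (Np j) (p j) (\<xi> j) s \<omega> - H s \<omega>))\<^sup>2) (\<lambda>_. 0)"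
    and lim: "tendsto_in_prob M (\<lambda>j. elementary_integral (Np j) (p j) (\<xi> j) W t) J"
    and prog: "progressively_measurable F H t" and Jm: "J \<in> borel_measurable M"
    using ito unfolding is_ito_integral_def by blast
  define err where "err j \<omega> = (LBINT s:{0..t}. (norm (elementary_process (Np j) (p j) (\<xi> j) s \<omega> - H s \<omega>))\<^sup>2)" for j \<omega>
  define I where "I j = elementary_integral (Np j) (p j) (\<xi> j) W t" for j
  \<comment> \<open>Lenglart's inequality costs \<open>\<delta> / (e / 2)\<^sup>2 = e / 4\<close>; the three other error events get \<open>e / 4\<close> each.\<close>
  define \<delta> where "\<delta> = e ^ 3 / 16"
  \<comment> \<open>The term \<open>1\<close> only keeps \<open>\<alpha>\<close> positive when \<open>a = 0\<close>; likewise in \<open>b\<close>.\<close>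
  define \<alpha> where "\<alpha> = 2 * (norm a)\<^sup>2 + 1"
  define b where "b = e / 2 / (norm a + 1)"
  have pos: "0 < \<delta>" "0 < \<alpha>" "0 < b" using e by (auto simp: \<delta>_def \<alpha>_def b_def add_nonneg_pos intro!: divide_pos_pos)
  have "(\<lambda>j. prob {\<omega>\<in>space M. \<delta> / (2 * \<alpha>) < dist (err j \<omega>) 0}) \<longlonglongrightarrow> 0"
    using err0 pos unfolding tendsto_in_prob_def err_def by auto
  then have ev1: "\<forall>\<^sub>F j in sequentially. prob {\<omega>\<in>space M. \<delta> / (2 * \<alpha>) < dist (err j \<omega>) 0} < e / 4"
    using e by (intro order_tendstoD(2)) auto
  have "(\<lambda>j. prob {\<omega>\<in>space M. b < dist (I j \<omega>) (J \<omega>)}) \<longlonglongrightarrow> 0"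
    using lim pos unfolding tendsto_in_prob_def I_def by auto
  then have ev2: "\<forall>\<^sub>F j in sequentially. prob {\<omega>\<in>space M. b < dist (I j \<omega>) (J \<omega>)} < e / 4"
    using e by (intro order_tendstoD(2)) auto
  obtain j where j: "prob {\<omega>\<in>space M. \<delta> / (2 * \<alpha>) < dist (err j \<omega>) 0} < e / 4"
    "prob {\<omega>\<in>space M. b < dist (I j \<omega>) (J \<omega>)} < e / 4"
    using eventually_conj[OF ev1 ev2] by (auto simp: eventually_sequentially)
  \<comment> \<open>An oscillation of \<open>r\<close> by \<open>\<rho>\<close> contributes at most \<open>2 (C \<rho>)\<^sup>2 t \<le> \<delta> / 2\<close> to the squared \<open>L\<^sup>2\<close> distance.\<close>
  define \<rho> where "\<rho> = sqrt (\<delta> / (4 * (t + 1))) / C"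
  have \<rho>: "0 < \<rho>" using pos t C by (simp add: \<rho>_def)
  have "(C * \<rho>)\<^sup>2 = \<delta> / (4 * (t + 1))" using C pos t by (simp add: \<rho>_def)
  then have "4 * (t + 1) * (C * \<rho>)\<^sup>2 = \<delta>" using t by simp
  moreover have "4 * t * x \<le> 4 * (t + 1) * x" if "0 \<le> x" for x :: real using that by (simp add: algebra_simps)
  ultimately have "4 * t * (C * \<rho>)\<^sup>2 \<le> \<delta>" by (metis zero_le_power2)
  then have \<rho>2: "2 * (C * \<rho>)\<^sup>2 * t \<le> \<delta> / 2" by (simp add: mult.commute mult.left_commute)
  obtain d E where dE: "0 < d" "E \<in> sets M" "prob E \<le> e / 4"
    "AE \<omega> in M. \<omega> \<notin> E \<longrightarrow> (\<forall>s\<in>{0..t+1}. \<forall>u\<in>{0..t+1}. \<bar>s - u\<bar> < d \<longrightarrow> norm (r s \<omega> - r u \<omega>) \<le> \<rho>)"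
    using modulus_of_continuity[of "t + 1" \<rho> "e / 4"] t \<rho> e by auto
  define \<xi>' where "\<xi>' k \<omega> = transpose (\<xi> j k \<omega>) *v a" for k \<omega>
  have ad1: "adapted_step (Np j) (p j) \<xi>'"
    unfolding adapted_step_def
  proof (intro conjI allI impI)
    show "0 \<le> p j 0" using el[of j] by (simp add: elementary_def)
    fix k assume k: "k < Np j"
    show "p j k < p j (Suc k)" using el[of j] k by (simp add: elementary_def)
    show "\<xi>' k \<in> borel_measurable (F (p j k))"
      unfolding \<xi>'_def[abs_def] using el[of j] k by (intro transpose_vector_measurable) (simp add: elementary_def)
    have "bounded (\<xi> j k ` space M)" using el[of j] k by (simp add: elementary_def)
    then obtain c where c: "\<And>\<omega>. \<omega> \<in> space M \<Longrightarrow> norm (\<xi> j k \<omega>) \<le> c" unfolding bounded_iff by auto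
    have "norm (\<xi>' k \<omega>) \<le> norm a * c" if "\<omega> \<in> space M" for \<omega>
      unfolding \<xi>'_def using norm_transpose_mult_le[of "\<xi> j k \<omega>" a] c[OF that]
      by (meson mult_left_mono norm_ge_zero order_trans)
    then show "\<exists>c. \<forall>\<omega>\<in>space M. norm (\<xi>' k \<omega>) \<le> c" by blast
  qed
  have proc: "step_process (Np j) (p j) \<xi>' s \<omega> = transpose (elementary_process (Np j) (p j) (\<xi> j) s \<omega>) *v a" for s \<omega>
    unfolding step_process_def elementary_process_def \<xi>'_def transpose_mult_combination ..
  have int: "step_integral (Np j) (p j) \<xi>' t \<omega> = a \<bullet> I j \<omega>" for \<omega>
    unfolding step_integral_def I_def elementary_integral_def \<xi>'_def inner_sum_right inner_matrix_transpose ..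
  have pinc: "\<forall>k<Np j. p j k < p j (Suc k)" and p0: "0 \<le> p j 0" using el[of j] by (auto simp: elementary_def)
  have pnn: "0 \<le> p j k" if "k \<le> Np j" for k using chain_le_iff[OF pinc, of 0 k] p0 that by auto
  have Im: "I j \<in> borel_measurable M"
    unfolding I_def elementary_integral_def[abs_def]
  proof (intro borel_measurable_sum matrix_vector_measurable borel_measurable_diff)
    fix k assume "k \<in> {..<Np j}"
    then have k: "k < Np j" by simp
    show "\<xi> j k \<in> borel_measurable M" using el[of j] k measurable_F_M by (auto simp: elementary_def)
    show "W (min (p j (Suc k)) t) \<in> borel_measurable M" "W (min (p j k) t) \<in> borel_measurable M"
      using pnn[of k] pnn[of "Suc k"] k t by (auto intro: W_measurable)
  qed
  have errm: "err j \<in> borel_measurable M"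
    unfolding err_def[abs_def] by (rule ito_approximation_error_measurable[OF t prog el])
  let ?X1 = "{\<omega>\<in>space M. \<delta> / (2 * \<alpha>) < dist (err j \<omega>) 0}" and ?X2 = "{\<omega>\<in>space M. b < dist (I j \<omega>) (J \<omega>)}"
  have X: "?X1 \<in> sets M" "?X2 \<in> sets M"
    using errm Im Jm by measurable
  have main: "prob (tame N t \<inter> {\<omega>\<in>space M. e < \<bar>a \<bullet> J \<omega> - riemann N \<eta> \<tau> K \<omega>\<bar>}) \<le> e"
    if \<tau>: "0 < \<tau>" "\<tau> < d" and K: "grid \<tau> K = t" for K \<tau>
  proof -
    define \<zeta> where "\<zeta> k = cut N \<eta> (grid \<tau> k)" for k
    define S where "S = step_sum (grid \<tau>) \<zeta> K"
    have ad2: "adapted_step K (grid \<tau>) \<zeta>" unfolding \<zeta>_def by (rule cut_adapted_step[OF \<tau>(1) \<eta>])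
    have Seq: "step_integral K (grid \<tau>) \<zeta> t = S" unfolding S_def K[symmetric] by (rule grid_step_integral[OF \<tau>(1)])
    have Sm: "S \<in> borel_measurable M" unfolding Seq[symmetric] by (rule step_integral_measurable[OF ad2 t])
    let ?D = "\<lambda>\<omega>. LBINT s:{0..t}. (norm (step_process (Np j) (p j) \<xi>' s \<omega> - step_process K (grid \<tau>) \<zeta> s \<omega>))\<^sup>2"
    have "prob (tame N t \<inter> {\<omega>\<in>space M. e / 2 < \<bar>a \<bullet> I j \<omega> - S \<omega>\<bar>}) \<le> prob (tame N t \<inter> {\<omega>\<in>space M. \<delta> < ?D \<omega>}) + \<delta> / (e / 2)\<^sup>2"
      using step_integral_lenglart[OF ad1 ad2 t tame_sets[OF t], of "e / 2" \<delta>] e pos unfolding int Seq by simp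
    also have "\<delta> / (e / 2)\<^sup>2 = e / 4" using e by (simp add: \<delta>_def power2_eq_square power3_eq_cube)
    also have "prob (tame N t \<inter> {\<omega>\<in>space M. \<delta> < ?D \<omega>}) \<le> prob (?X1 \<union> E)"
    proof (rule finite_measure_mono_AE)
      show "?X1 \<union> E \<in> sets M" using X dE(2) by blast
      show "AE \<omega> in M. \<omega> \<in> tame N t \<inter> {\<omega>\<in>space M. \<delta> < ?D \<omega>} \<longrightarrow> \<omega> \<in> ?X1 \<union> E"
        using Hc r_cont dE(4)
      proof eventually_elim
        case (elim \<omega>)
        show ?case
        proof (rule impI, rule ccontr)
          assume a1: "\<omega> \<in> tame N t \<inter> {\<omega>\<in>space M. \<delta> < ?D \<omega>}" and a2: "\<omega> \<notin> ?X1 \<union> E"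
          have bd: "norm (r s \<omega>) \<le> N" if "s \<in> {0..t}" for s
            using a1 tame_iff[OF elim(2) t] that by auto
          have Bs: "\<omega> \<in> tame N s" if "s \<in> {0..t}" for s
            using a1 bd that tame_iff[OF elim(2), of s N] by auto
          have mod: "norm (r s \<omega> - r u \<omega>) \<le> \<rho>" if "s \<in> {0..t}" "u \<in> {0..t}" "\<bar>s - u\<bar> < d" for s u
            using elim(3) a2 that by auto
          have err: "err j \<omega> \<le> \<delta> / (2 * \<alpha>)" using a1 a2 by (auto simp: dist_real_def)
          let ?g = "\<lambda>s. (norm (elementary_process (Np j) (p j) (\<xi> j) s \<omega> - H s \<omega>))\<^sup>2"
          have gint: "set_integrable lborel {0..t} ?g" by (rule elementary_error_integrable[OF elim(1)])
          have pw: "(norm (step_process (Np j) (p j) \<xi>' s \<omega> - step_process K (grid \<tau>) \<zeta> s \<omega>))\<^sup>2 \<le> 2 * (norm a)\<^sup>2 * ?g s + 2 * (C * \<rho>)\<^sup>2"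
            if s: "0 < s" "s \<le> t" for s
          proof -
            obtain k where k: "k < K" "real k * \<tau> < s" "s \<le> real (Suc k) * \<tau>"
              using grid_cell[OF \<tau>(1) s(1), of K] s(2) K by (auto simp: grid_def)
            have "step_process K (grid \<tau>) \<zeta> s \<omega> = \<zeta> k \<omega>"
              by (rule step_process_eq) (use k \<tau> in \<open>auto simp: grid_def\<close>)
            also have "\<dots> = \<eta> (r (grid \<tau> k) \<omega>)"
              unfolding \<zeta>_def cut_def using Bs[of "grid \<tau> k"] k s \<tau> by (simp add: grid_def)
            finally have \<psi>: "step_process K (grid \<tau>) \<zeta> s \<omega> = \<eta> (r (grid \<tau> k) \<omega>)" .
            let ?x = "transpose (elementary_process (Np j) (p j) (\<xi> j) s \<omega> - H s \<omega>) *v a"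
              and ?y = "\<eta> (r s \<omega> - r (grid \<tau> k) \<omega>)"
            have tr: "transpose (A - A') *v a = transpose A *v a - transpose A' *v a" for A A' :: "real ^ 'n ^ 'd"
              by (simp add: vec_eq_iff transpose_def matrix_vector_mult_def sum_subtractf[symmetric] algebra_simps)
            have split: "step_process (Np j) (p j) \<xi>' s \<omega> - step_process K (grid \<tau>) \<zeta> s \<omega> = ?x + ?y"
              unfolding proc \<psi> \<eta>.diff tr H\<eta> by simp
            have "norm ?x \<le> norm a * norm (elementary_process (Np j) (p j) (\<xi> j) s \<omega> - H s \<omega>)"
              by (rule norm_transpose_mult_le)
            then have nx: "(norm ?x)\<^sup>2 \<le> (norm a)\<^sup>2 * ?g s" unfolding power_mult_distrib[symmetric] by (rule power_mono) simp
            have "norm (r s \<omega> - r (grid \<tau> k) \<omega>) \<le> \<rho>"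
              by (rule mod) (use k s \<tau> in \<open>auto simp: grid_def algebra_simps\<close>)
            then have "norm ?y \<le> \<rho> * C" using C(2)[of "r s \<omega> - r (grid \<tau> k) \<omega>"] C(1)
              by (meson mult_right_mono less_imp_le order_trans)
            then have ny: "(norm ?y)\<^sup>2 \<le> (C * \<rho>)\<^sup>2" by (intro power_mono) (auto simp: mult.commute)
            have "(norm (?x + ?y))\<^sup>2 \<le> (norm ?x + norm ?y)\<^sup>2" by (intro power_mono norm_triangle_ineq) simp
            also have "\<dots> \<le> 2 * (norm ?x)\<^sup>2 + 2 * (norm ?y)\<^sup>2"
              using sum_squares_bound[of "norm ?x" "norm ?y"] by (simp add: power2_sum)
            finally show ?thesis unfolding split using nx ny by linarith
          qed
          have "?D \<omega> \<le> (LBINT s:{0..t}. 2 * (norm a)\<^sup>2 * ?g s + 2 * (C * \<rho>)\<^sup>2)"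
            unfolding set_lebesgue_integral_def
          proof (rule integral_mono_AE')
            have "set_integrable lborel {0..t} (\<lambda>s. 2 * (norm a)\<^sup>2 * ?g s + 2 * (C * \<rho>)\<^sup>2)"
              using gint t by (intro set_integral_add set_integrable_mult_right) (auto simp: set_integrable_def)
            then show "integrable lborel (\<lambda>s. indicator {0..t} s *\<^sub>R (2 * (norm a)\<^sup>2 * ?g s + 2 * (C * \<rho>)\<^sup>2))"
              by (simp only: set_integrable_def)
            show "AE s in lborel. indicator {0..t} s *\<^sub>R (norm (step_process (Np j) (p j) \<xi>' s \<omega> - step_process K (grid \<tau>) \<zeta> s \<omega>))\<^sup>2
               \<le> indicator {0..t} s *\<^sub>R (2 * (norm a)\<^sup>2 * ?g s + 2 * (C * \<rho>)\<^sup>2)"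
              using AE_lborel_singleton[of "0::real"]
            proof eventually_elim
              case (elim s)
              show ?case
              proof (cases "s \<in> {0..t}")
                case True
                then show ?thesis using elim pw[of s] by simp
              qed simp
            qed
          qed simp
          also have "\<dots> = 2 * (norm a)\<^sup>2 * err j \<omega> + 2 * (C * \<rho>)\<^sup>2 * t"
          proof -
            have "(LBINT s:{0..t}. 2 * (norm a)\<^sup>2 * ?g s + 2 * (C * \<rho>)\<^sup>2)
              = (LBINT s:{0..t}. 2 * (norm a)\<^sup>2 * ?g s) + (LBINT s:{0..t}. 2 * (C * \<rho>)\<^sup>2)"
              using gint t by (intro set_integral_add set_integrable_mult_right) (auto simp: set_integrable_def)
            then show ?thesis unfolding err_def using t by (simp add: set_lebesgue_integral_def)
          qed
          also have "2 * (norm a)\<^sup>2 * err j \<omega> \<le> \<alpha> * (\<delta> / (2 * \<alpha>))"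
          proof (rule mult_mono)
            show "2 * (norm a)\<^sup>2 \<le> \<alpha>" by (simp add: \<alpha>_def)
            show "err j \<omega> \<le> \<delta> / (2 * \<alpha>)" by fact
            show "0 \<le> err j \<omega>" unfolding err_def set_lebesgue_integral_def by (intro integral_nonneg_AE) auto
          qed (use pos in auto)
          also have "\<alpha> * (\<delta> / (2 * \<alpha>)) = \<delta> / 2" using pos by simp
          finally have "?D \<omega> \<le> \<delta>" using \<rho>2 by simp
          then show False using a1 by auto
        qed
      qed
    qed
    also have "prob (?X1 \<union> E) \<le> e / 4 + e / 4"
      using measure_Un_le[OF X(1) dE(2)] j(1) dE(3) by linarith
    finally have P1: "prob (tame N t \<inter> {\<omega>\<in>space M. e / 2 < \<bar>a \<bullet> I j \<omega> - S \<omega>\<bar>}) \<le> 3 * e / 4" by simp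
    let ?X3 = "tame N t \<inter> {\<omega>\<in>space M. e / 2 < \<bar>a \<bullet> I j \<omega> - S \<omega>\<bar>}"
    have "{\<omega>\<in>space M. e / 2 < \<bar>a \<bullet> I j \<omega> - S \<omega>\<bar>} \<in> sets M" using Im Sm by measurable
    then have X3: "?X3 \<in> sets M" using tame_sets[OF t] by blast
    have "prob (tame N t \<inter> {\<omega>\<in>space M. e < \<bar>a \<bullet> J \<omega> - S \<omega>\<bar>}) \<le> prob (?X2 \<union> ?X3)"
    proof (rule finite_measure_mono)
      show "?X2 \<union> ?X3 \<in> sets M" using X X3 by blast
      show "tame N t \<inter> {\<omega>\<in>space M. e < \<bar>a \<bullet> J \<omega> - S \<omega>\<bar>} \<subseteq> ?X2 \<union> ?X3"
      proof
        fix \<omega> assume w: "\<omega> \<in> tame N t \<inter> {\<omega>\<in>space M. e < \<bar>a \<bullet> J \<omega> - S \<omega>\<bar>}"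
        show "\<omega> \<in> ?X2 \<union> ?X3"
        proof (rule ccontr)
          assume n: "\<omega> \<notin> ?X2 \<union> ?X3"
          then have le: "dist (I j \<omega>) (J \<omega>) \<le> b" "\<bar>a \<bullet> I j \<omega> - S \<omega>\<bar> \<le> e / 2" using w by auto
          have "\<bar>a \<bullet> J \<omega> - a \<bullet> I j \<omega>\<bar> \<le> norm a * norm (J \<omega> - I j \<omega>)"
            unfolding inner_diff_right[symmetric] by (rule Cauchy_Schwarz_ineq2)
          also have "\<dots> \<le> (norm a + 1) * b" using le(1) by (intro mult_mono) (auto simp: dist_norm norm_minus_commute)
          also have "\<dots> = e / 2"
          proof -
            have "norm a + 1 \<noteq> 0" using norm_ge_zero[of a] by linarith
            then show ?thesis unfolding b_def by (metis nonzero_mult_div_cancel_left times_divide_eq_right)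
          qed
          finally have "\<bar>a \<bullet> J \<omega> - a \<bullet> I j \<omega>\<bar> \<le> e / 2" .
          moreover have "e < \<bar>a \<bullet> J \<omega> - S \<omega>\<bar>" using w by simp
          ultimately show False using le(2) by linarith
        qed
      qed
    qed
    also have "\<dots> \<le> e" using measure_Un_le[OF X(2) X3] j(2) P1 by linarith
    finally show ?thesis unfolding S_def \<zeta>_def riemann_def .
  qed
  show ?thesis using main dE(1) by blast
qed

end

section \<open>Variation of constants for one mode\<close>

lemma integral_piece:
  fixes f :: "real \<Rightarrow> real"
  assumes f: "continuous_on {0..T} f" and ab: "0 \<le> a" "a \<le> b" "b \<le> T"
    and \<rho>: "\<And>s. a \<le> s \<Longrightarrow> s \<le> b \<Longrightarrow> \<bar>f s - c\<bar> \<le> \<rho>"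
  shows "\<bar>integral {0..b} f - integral {0..a} f - (b - a) * c\<bar> \<le> (b - a) * \<rho>"
proof -
  have fab: "continuous_on {a..b} f" using f by (rule continuous_on_subset) (use ab in auto)
  have f0b: "continuous_on {0..b} f" using f by (rule continuous_on_subset) (use ab in auto)
  have i: "f integrable_on {a..b}" "f integrable_on {0..b}"
    using fab f0b by (auto intro: integrable_continuous_real)
  have "integral {0..a} f + integral {a..b} f = integral {0..b} f"
    by (rule Henstock_Kurzweil_Integration.integral_combine) (use ab i in auto)
  moreover have "integral {a..b} (\<lambda>s. f s - c) = integral {a..b} f - (b - a) * c"
    using i ab by (subst Henstock_Kurzweil_Integration.integral_diff) (auto simp: mult.commute)
  moreover have "norm (integral {a..b} (\<lambda>s. f s - c)) \<le> \<rho> * (b - a)"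
    by (rule integral_bound) (use ab fab \<rho> in \<open>auto intro: continuous_intros\<close>)
  ultimately show ?thesis by (simp add: mult.commute)
qed

lemma uniform_grid_riemann_sum:
  fixes f :: "real \<Rightarrow> real"
  assumes f: "continuous_on {0..T} f" and T: "0 \<le> T" and e: "0 < e"
  shows "\<exists>d>0. \<forall>K \<tau>. 0 < \<tau> \<longrightarrow> \<tau> < d \<longrightarrow> real K * \<tau> = T \<longrightarrow>
    \<bar>integral {0..T} f - (\<Sum>k<K. f (real k * \<tau>) * \<tau>)\<bar> \<le> e"
proof -
  define \<rho> where "\<rho> = e / (T + 1)"
  have \<rho>: "0 < \<rho>" using T e by (simp add: \<rho>_def)
  have "uniformly_continuous_on {0..T} f" using f by (intro compact_uniformly_continuous) auto
  then obtain d where d: "0 < d" "\<And>s u. s \<in> {0..T} \<Longrightarrow> u \<in> {0..T} \<Longrightarrow> dist u s < d \<Longrightarrow> dist (f u) (f s) < \<rho>"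
    using \<rho> unfolding uniformly_continuous_on_def by metis
  have "\<bar>integral {0..T} f - (\<Sum>k<K. f (real k * \<tau>) * \<tau>)\<bar> \<le> e" if \<tau>: "0 < \<tau>" "\<tau> < d" and K: "real K * \<tau> = T" for K \<tau>
  proof -
    have "\<bar>integral {0..real j * \<tau>} f - (\<Sum>k<j. f (real k * \<tau>) * \<tau>)\<bar> \<le> real j * \<tau> * \<rho>" if "j \<le> K" for j
      using that
    proof (induction j)
      case (Suc j)
      have le: "real (Suc j) * \<tau> \<le> T" unfolding K[symmetric] using Suc.prems \<tau> by (intro mult_right_mono) auto
      have "\<bar>integral {0..real (Suc j) * \<tau>} f - integral {0..real j * \<tau>} f - (real (Suc j) * \<tau> - real j * \<tau>) * f (real j * \<tau>)\<bar>
        \<le> (real (Suc j) * \<tau> - real j * \<tau>) * \<rho>"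
      proof (rule integral_piece[OF f])
        fix s assume s: "real j * \<tau> \<le> s" "s \<le> real (Suc j) * \<tau>"
        have "0 \<le> real j * \<tau>" using \<tau> by simp
        then have "0 \<le> s" using s(1) by linarith
        then have "dist (f s) (f (real j * \<tau>)) < \<rho>"
          using s le \<tau> by (intro d(2)) (auto simp: dist_real_def algebra_simps)
        then show "\<bar>f s - f (real j * \<tau>)\<bar> \<le> \<rho>" by (simp add: dist_real_def)
      qed (use \<tau> le in \<open>auto simp: algebra_simps\<close>)
      moreover have "real (Suc j) * \<tau> - real j * \<tau> = \<tau>" by (simp add: algebra_simps)
      ultimately have "\<bar>integral {0..real (Suc j) * \<tau>} f - integral {0..real j * \<tau>} f - f (real j * \<tau>) * \<tau>\<bar> \<le> \<tau> * \<rho>"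
        by (simp add: mult.commute)
      moreover have "real (Suc j) * \<tau> * \<rho> = real j * \<tau> * \<rho> + \<tau> * \<rho>" by (simp add: algebra_simps)
      ultimately show ?case using Suc.IH Suc.prems unfolding sum.lessThan_Suc by linarith
    qed simp
    from this[of K] have "\<bar>integral {0..T} f - (\<Sum>k<K. f (real k * \<tau>) * \<tau>)\<bar> \<le> T * \<rho>" using K by simp
    also have "T * \<rho> \<le> e" using T e by (simp add: \<rho>_def field_simps)
    finally show ?thesis .
  qed
  then show ?thesis using d(1) by blast
qed

text \<open>Discrete variation of constants. If \<open>dx = - \<beta> x dt + dY\<close>, then the increments of \<open>exp (\<beta> s) x s\<close> over a grid cell are
  \<open>exp (\<beta> s)\<close> times those of \<open>Y\<close>, up to \<open>exp (\<beta> \<Delta>) - 1 - \<beta> \<Delta> \<le> (\<beta> \<Delta>)\<^sup>2\<close> and the oscillation of \<open>x\<close>. The argument is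
  pathwise and uses only continuity of \<open>x\<close>.\<close>

lemma exponential_weights_error:
  fixes x :: "real \<Rightarrow> real"
  assumes x: "continuous_on {0..T} x" and \<beta>: "0 \<le> \<beta>" and \<Delta>: "0 < \<Delta>" "\<beta> * \<Delta> \<le> 1" and m: "real m * \<Delta> = T"
    and b: "\<And>s. s \<in> {0..T} \<Longrightarrow> \<bar>x s\<bar> \<le> b" and \<rho>: "\<And>s u. s \<in> {0..T} \<Longrightarrow> u \<in> {0..T} \<Longrightarrow> \<bar>s - u\<bar> \<le> \<Delta> \<Longrightarrow> \<bar>x s - x u\<bar> \<le> \<rho>"
    and Y: "\<And>i. i \<le> m \<Longrightarrow> Y i = x (real i * \<Delta>) - x0 + \<beta> * integral {0..real i * \<Delta>} x"
  shows "\<bar>(\<Sum>i<m. exp (\<beta> * (real i * \<Delta>)) * (Y (Suc i) - Y i)) - (exp (\<beta> * T) * x T - x 0)\<bar>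
    \<le> exp (\<beta> * T) * T * (\<beta>\<^sup>2 * \<Delta> * b + \<beta> * \<rho>)"
proof -
  have T: "0 \<le> T" unfolding m[symmetric] using \<Delta> by simp
  have b0: "0 \<le> b" using b[of 0] T by auto
  have \<rho>0: "0 \<le> \<rho>" using \<rho>[of 0 0] T \<Delta> by auto
  have ex: "0 \<le> exp (\<beta> * \<Delta>) - 1 - \<beta> * \<Delta>" "exp (\<beta> * \<Delta>) - 1 - \<beta> * \<Delta> \<le> (\<beta> * \<Delta>)\<^sup>2"
  proof -
    show "0 \<le> exp (\<beta> * \<Delta>) - 1 - \<beta> * \<Delta>" using exp_ge_add_one_self[of "\<beta> * \<Delta>"] by linarith
    have "0 \<le> \<beta> * \<Delta>" using \<beta> \<Delta> by simp
    then show "exp (\<beta> * \<Delta>) - 1 - \<beta> * \<Delta> \<le> (\<beta> * \<Delta>)\<^sup>2"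
      using exp_bound[of "\<beta> * \<Delta>"] \<Delta>(2) by linarith
  qed
  let ?s = "\<lambda>i. real i * \<Delta>"
  have cell: "\<bar>exp (\<beta> * ?s i) * (Y (Suc i) - Y i) - (exp (\<beta> * ?s (Suc i)) * x (?s (Suc i)) - exp (\<beta> * ?s i) * x (?s i))\<bar>
     \<le> exp (\<beta> * T) * ((\<beta> * \<Delta>)\<^sup>2 * b + \<beta> * (\<Delta> * \<rho>))" if i: "i < m" for i
  proof -
    have le: "?s (Suc i) \<le> T" unfolding m[symmetric] using i \<Delta> by (intro mult_right_mono) auto
    have d: "?s (Suc i) - ?s i = \<Delta>" by (simp add: algebra_simps)
    have s0: "0 \<le> ?s i" "?s i \<le> ?s (Suc i)" "0 \<le> ?s (Suc i)" using \<Delta> by auto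
    define D where "D = integral {0..?s (Suc i)} x - integral {0..?s i} x - \<Delta> * x (?s (Suc i))"
    have "\<bar>integral {0..?s (Suc i)} x - integral {0..?s i} x - (?s (Suc i) - ?s i) * x (?s (Suc i))\<bar> \<le> (?s (Suc i) - ?s i) * \<rho>"
    proof (rule integral_piece[OF x s0(1,2) le])
      fix s assume s: "?s i \<le> s" "s \<le> ?s (Suc i)"
      then have "s \<in> {0..T}" "?s (Suc i) \<in> {0..T}" "\<bar>s - ?s (Suc i)\<bar> \<le> \<Delta>"
        using s0 le d unfolding atLeastAtMost_iff by linarith+
      then show "\<bar>x s - x (?s (Suc i))\<bar> \<le> \<rho>" by (rule \<rho>)
    qed
    then have D: "\<bar>D\<bar> \<le> \<Delta> * \<rho>" unfolding d D_def .
    have e1: "exp (\<beta> * ?s (Suc i)) = exp (\<beta> * ?s i) * exp (\<beta> * \<Delta>)"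
      unfolding exp_add[symmetric] by (simp add: algebra_simps)
    have "exp (\<beta> * ?s i) * (Y (Suc i) - Y i) - (exp (\<beta> * ?s (Suc i)) * x (?s (Suc i)) - exp (\<beta> * ?s i) * x (?s i))
       = exp (\<beta> * ?s i) * (\<beta> * D - (exp (\<beta> * \<Delta>) - 1 - \<beta> * \<Delta>) * x (?s (Suc i)))"
    proof -
      have dY: "Y (Suc i) - Y i = x (?s (Suc i)) - x (?s i) + \<beta> * (integral {0..?s (Suc i)} x - integral {0..?s i} x)"
        unfolding right_diff_distrib using Y[of i] Y[of "Suc i"] i by linarith
      have "E * (X' - X + \<beta> * (I' - I)) - (E * G * X' - E * X) = E * (\<beta> * (I' - I - \<Delta> * X') - (G - 1 - \<beta> * \<Delta>) * X')"
        for E G X X' I I' by (simp add: algebra_simps)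
      then show ?thesis unfolding e1 D_def dY .
    qed
    also have "\<bar>\<dots>\<bar> = exp (\<beta> * ?s i) * \<bar>\<beta> * D - (exp (\<beta> * \<Delta>) - 1 - \<beta> * \<Delta>) * x (?s (Suc i))\<bar>"
      by (simp add: abs_mult)
    also have "\<dots> \<le> exp (\<beta> * T) * ((\<beta> * \<Delta>)\<^sup>2 * b + \<beta> * (\<Delta> * \<rho>))"
    proof (rule mult_mono)
      show "exp (\<beta> * ?s i) \<le> exp (\<beta> * T)" using s0 le \<beta> by (auto intro!: mult_left_mono)
      have "\<bar>\<beta> * D\<bar> \<le> \<beta> * (\<Delta> * \<rho>)" using D \<beta> by (simp add: abs_mult mult_left_mono)
      moreover have "\<bar>(exp (\<beta> * \<Delta>) - 1 - \<beta> * \<Delta>) * x (?s (Suc i))\<bar> \<le> (\<beta> * \<Delta>)\<^sup>2 * b"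
        unfolding abs_mult using ex b[of "?s (Suc i)"] s0 le b0 by (intro mult_mono) auto
      ultimately show "\<bar>\<beta> * D - (exp (\<beta> * \<Delta>) - 1 - \<beta> * \<Delta>) * x (?s (Suc i))\<bar> \<le> (\<beta> * \<Delta>)\<^sup>2 * b + \<beta> * (\<Delta> * \<rho>)"
        by linarith
    qed auto
    finally show ?thesis .
  qed
  have tel: "(\<Sum>i<m. exp (\<beta> * ?s (Suc i)) * x (?s (Suc i)) - exp (\<beta> * ?s i) * x (?s i)) = exp (\<beta> * T) * x T - x 0"
    using sum_lessThan_telescope[of "\<lambda>i. exp (\<beta> * ?s i) * x (?s i)" m] m by simp
  have "\<bar>(\<Sum>i<m. exp (\<beta> * ?s i) * (Y (Suc i) - Y i)) - (exp (\<beta> * T) * x T - x 0)\<bar>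
     \<le> (\<Sum>i<m. exp (\<beta> * T) * ((\<beta> * \<Delta>)\<^sup>2 * b + \<beta> * (\<Delta> * \<rho>)))"
    unfolding tel[symmetric] sum_subtractf[symmetric] using cell by (intro order_trans[OF sum_abs] sum_mono) auto
  also have "\<dots> = exp (\<beta> * T) * (real m * \<Delta>) * (\<beta>\<^sup>2 * \<Delta> * b + \<beta> * \<rho>)"
    by (simp add: algebra_simps power2_eq_square)
  finally show ?thesis unfolding m .
qed

lemma (in localized) cut_square_integrable:
  assumes "0 \<le> s" "bounded_linear \<eta>" shows "integrable M (\<lambda>\<omega>. (norm (cut N \<eta> s \<omega>))\<^sup>2)"
proof -
  obtain c where c: "\<And>s \<omega>. norm (cut N \<eta> s \<omega>) \<le> c" using cut_bounded[OF assms(2)] by blast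
  show ?thesis
  proof (rule integrable_const_bound[of _ "c\<^sup>2"])
    show "AE \<omega> in M. norm ((norm (cut N \<eta> s \<omega>))\<^sup>2) \<le> c\<^sup>2" using c by (intro AE_I2) (simp add: power_mono)
    show "(\<lambda>\<omega>. (norm (cut N \<eta> s \<omega>))\<^sup>2) \<in> borel_measurable M"
      using measurable_F_M[OF cut_measurable[OF assms]] by simp
  qed
qed

text \<open>Weights that are constant on blocks of \<open>q\<close> fine cells see only the increments of the fine sums over
  the blocks. This connects the fine grid of the Riemann sums with the coarse grid of the weights.\<close>

lemma (in localized) block_sum:
  assumes q: "0 < q"
  shows "step_sum (grid \<tau>) (\<lambda>k \<omega>. w (k div q) *\<^sub>R \<zeta> k \<omega>) (m * q) \<omega>
    = (\<Sum>i<m. w i * (step_sum (grid \<tau>) \<zeta> (Suc i * q) \<omega> - step_sum (grid \<tau>) \<zeta> (i * q) \<omega>))"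
proof -
  let ?f = "\<lambda>k. \<zeta> k \<omega> \<bullet> (W (grid \<tau> (Suc k)) \<omega> - W (grid \<tau> k) \<omega>)"
  have "step_sum (grid \<tau>) (\<lambda>k \<omega>. w (k div q) *\<^sub>R \<zeta> k \<omega>) (m * q) \<omega> = (\<Sum>i<m. sum (\<lambda>k. w (k div q) * ?f k) {i * q..<i * q + q})"
    unfolding step_sum_def sum.nat_group by simp
  also have "\<dots> = (\<Sum>i<m. w i * sum ?f {i * q..<i * q + q})"
  proof (rule sum.cong[OF refl])
    fix i
    have "k div q = i" if "k \<in> {i * q..<i * q + q}" for k
      using that by (intro div_nat_eqI) (auto simp: mult.commute)
    then show "sum (\<lambda>k. w (k div q) * ?f k) {i * q..<i * q + q} = w i * sum ?f {i * q..<i * q + q}"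
      by (simp add: sum_distrib_left)
  qed
  also have "\<dots> = (\<Sum>i<m. w i * (step_sum (grid \<tau>) \<zeta> (Suc i * q) \<omega> - step_sum (grid \<tau>) \<zeta> (i * q) \<omega>))"
  proof (rule sum.cong[OF refl])
    fix i
    have "sum ?f {0..<i * q} + sum ?f {i * q..<i * q + q} = sum ?f {0..<i * q + q}"
      by (rule sum.atLeastLessThan_concat) auto
    then show "w i * sum ?f {i * q..<i * q + q} = w i * (step_sum (grid \<tau>) \<zeta> (Suc i * q) \<omega> - step_sum (grid \<tau>) \<zeta> (i * q) \<omega>)"
      by (simp add: step_sum_def atLeast0LessThan add.commute)
  qed
  finally show ?thesis .
qed

text \<open>The variable \<open>Y\<close> is a Riemann sum over a fine grid with weights \<open>exp (\<beta> s)\<close> that change only on a coarse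
  grid. The coarse grid is chosen first, so fine that the discrete variation of constants is
  accurate; then the fine grid, such that the Riemann sums approximate the Ito integral at each of the
  finitely many coarse times. Since \<open>\<beta> \<ge> 0\<close>, rounding the weights down to the coarse grid only decreases
  the second moment, which is a Riemann sum of \<open>exp (2 \<beta> s) G s\<close>.\<close>

lemma (in localized) mode_approximation:
  fixes H :: "real \<Rightarrow> 'w \<Rightarrow> real ^ 'n ^ 'd" and a :: "real ^ 'd" and c :: "real ^ 'n"
  assumes T: "0 < T" and \<beta>: "0 \<le> \<beta>" and \<eta>: "bounded_linear \<eta>"
    and ito: "\<And>t. 0 \<le> t \<Longrightarrow> is_ito_integral M F W H t (J t)"
    and H\<eta>: "\<And>s \<omega>. transpose (H s \<omega>) *v a = \<eta> (r s \<omega>)"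
    and Hc: "AE \<omega> in M. continuous_on {0..} (\<lambda>s. H s \<omega>)"
    and eq: "\<And>t. 0 \<le> t \<Longrightarrow> AE \<omega> in M. c \<bullet> r t \<omega> = x0 - \<beta> * integral {0..t} (\<lambda>s. c \<bullet> r s \<omega>) + a \<bullet> J t \<omega>"
    and init: "AE \<omega> in M. c \<bullet> r 0 \<omega> = x0"
    and G: "continuous_on {0..T} G" "\<And>s. s \<in> {0..T} \<Longrightarrow> expectation (\<lambda>\<omega>. (norm (cut N \<eta> s \<omega>))\<^sup>2) \<le> G s"
    and e: "0 < e"
  shows "centered_approx (integral {0..T} (\<lambda>s. exp (2 * \<beta> * s) * G s) + e) (tame N T)
    (\<lambda>\<omega>. exp (\<beta> * T) * (c \<bullet> r T \<omega>) - x0) e"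
proof -
  define b where "b = norm c * \<bar>N\<bar>"
  define A where "A = exp (\<beta> * T) * T"
  have A: "0 < A" using T by (simp add: A_def)
  have b: "0 \<le> b" by (simp add: b_def)
  have cancel: "x * (e / (4 * x)) = e / 4" if "0 < x" for x using that by simp
  \<comment> \<open>Bounds for the two errors of the discrete variation of constants, each at most \<open>e / 4\<close>: the oscillation
    of the mode is at most \<open>\<epsilon>1\<close>, and the mesh is at most \<open>d2\<close>.\<close>
  define \<epsilon>1 where "\<epsilon>1 = e / (4 * A * (\<beta> + 1))"
  have \<epsilon>1: "0 < \<epsilon>1" using A \<beta> e by (simp add: \<epsilon>1_def)
  have \<epsilon>1': "A * (\<beta> * \<epsilon>1) \<le> e / 4"
  proof -
    have "A * ((\<beta> + 1) * \<epsilon>1) = e / 4" using cancel[of "A * (\<beta> + 1)"] A \<beta> by (simp only: \<epsilon>1_def mult.assoc) simp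
    moreover have "A * (\<beta> * \<epsilon>1) \<le> A * ((\<beta> + 1) * \<epsilon>1)" using A \<epsilon>1 by (intro mult_left_mono mult_right_mono) auto
    ultimately show ?thesis by simp
  qed
  define \<rho>' where "\<rho>' = \<epsilon>1 / (norm c + 1)"
  have nc: "0 < norm c + 1" using norm_ge_zero[of c] by linarith
  have \<rho>': "0 < \<rho>'" using \<epsilon>1 nc by (simp add: \<rho>'_def)
  have c\<rho>: "norm c * \<rho>' \<le> \<epsilon>1"
  proof -
    have "(norm c + 1) * \<rho>' = \<epsilon>1" unfolding \<rho>'_def using nc by simp
    moreover have "norm c * \<rho>' \<le> (norm c + 1) * \<rho>'" using \<rho>' by (intro mult_right_mono) auto
    ultimately show ?thesis by simp
  qed
  obtain d1 E where dE: "0 < d1" "E \<in> sets M" "prob E \<le> e / 4"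
    "AE \<omega> in M. \<omega> \<notin> E \<longrightarrow> (\<forall>s\<in>{0..T}. \<forall>u\<in>{0..T}. \<bar>s - u\<bar> < d1 \<longrightarrow> norm (r s \<omega> - r u \<omega>) \<le> \<rho>')"
    using modulus_of_continuity[OF T \<rho>', of "e / 4"] e by auto
  define d2 where "d2 = min d1 (min (1 / (\<beta> + 1)) (e / (4 * A * (\<beta>\<^sup>2 * b + 1))))"
  have l2b: "0 < \<beta>\<^sup>2 * b + 1" using b by (simp add: add_nonneg_pos)
  have d2: "0 < d2" using dE(1) \<beta> e A l2b by (simp add: d2_def)
  obtain m where m: "T / d2 < real m" using reals_Archimedean2 by blast
  have m0: "0 < real m" using m T d2 by (meson divide_pos_pos less_trans)
  define \<Delta> where "\<Delta> = T / real m"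
  have \<Delta>: "0 < \<Delta>" "\<Delta> < d2" "real m * \<Delta> = T"
    using m m0 T d2 by (auto simp: \<Delta>_def field_simps)
  have \<beta>\<Delta>: "\<beta> * \<Delta> \<le> 1"
  proof -
    have "\<Delta> \<le> 1 / (\<beta> + 1)" using \<Delta>(2) by (simp add: d2_def)
    then have "(\<beta> + 1) * \<Delta> \<le> 1" using \<beta> by (simp add: field_simps)
    then show ?thesis using \<Delta>(1) by (simp add: algebra_simps)
  qed
  have \<Delta>A: "A * (\<beta>\<^sup>2 * \<Delta> * b) \<le> e / 4"
  proof -
    have "\<Delta> \<le> e / (4 * A * (\<beta>\<^sup>2 * b + 1))" using \<Delta>(2) by (simp add: d2_def)
    then have "A * ((\<beta>\<^sup>2 * b + 1) * \<Delta>) \<le> A * ((\<beta>\<^sup>2 * b + 1) * (e / (4 * A * (\<beta>\<^sup>2 * b + 1))))"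
      using A l2b by (intro mult_left_mono) auto
    also have "\<dots> = e / 4" using cancel[of "A * (\<beta>\<^sup>2 * b + 1)"] A l2b by (simp only: mult.assoc) simp
    finally have "A * ((\<beta>\<^sup>2 * b + 1) * \<Delta>) \<le> e / 4" .
    moreover have "A * (\<beta>\<^sup>2 * \<Delta> * b) \<le> A * ((\<beta>\<^sup>2 * b + 1) * \<Delta>)"
      using A \<Delta>(1) by (intro mult_left_mono) (auto simp: algebra_simps)
    ultimately show ?thesis by simp
  qed
  \<comment> \<open>Each of the \<open>m + 1\<close> Ito integrals may be off by \<open>e'\<close>, with probability \<open>e'\<close>.\<close>
  define e' where "e' = e / (4 * (real m + 1) * exp (\<beta> * T))"
  have e': "0 < e'" using e by (simp add: e'_def add_nonneg_pos)
  have e'1: "(real m + 1) * exp (\<beta> * T) * e' = e / 4"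
    using cancel[of "(real m + 1) * exp (\<beta> * T)"] unfolding e'_def by (simp only: mult.assoc) (simp add: add_nonneg_pos)
  have e'2: "(real m + 1) * e' \<le> e / 4"
  proof -
    have "1 \<le> exp (\<beta> * T)" using \<beta> T by simp
    then have "(real m + 1) * 1 * e' \<le> (real m + 1) * exp (\<beta> * T) * e'" using e' by (intro mult_right_mono mult_left_mono) auto
    then show ?thesis unfolding e'1 by simp
  qed
  \<comment> \<open>One mesh per coarse time; every finer grid that contains this time will do.\<close>
  define small where "small i d \<longleftrightarrow> 0 < d \<and> (\<forall>K \<tau>. 0 < \<tau> \<longrightarrow> \<tau> < d \<longrightarrow> grid \<tau> K = grid \<Delta> i \<longrightarrow>
    prob (tame N (grid \<Delta> i) \<inter> {\<omega>\<in>space M. e' < \<bar>a \<bullet> J (grid \<Delta> i) \<omega> - riemann N \<eta> \<tau> K \<omega>\<bar>}) \<le> e')" for i d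
  have "\<exists>d. small i d" for i
    using riemann_sum_approximates_ito_integral[OF _ ito H\<eta> \<eta> Hc e', of "grid \<Delta> i" N] \<Delta>(1) unfolding small_def by simp
  then obtain d where "\<And>i. small i (d i)" using choice[of small] by blast
  then have d: "\<And>i. 0 < d i" "\<And>i K \<tau>. 0 < \<tau> \<Longrightarrow> \<tau> < d i \<Longrightarrow> grid \<tau> K = grid \<Delta> i \<Longrightarrow>
    prob (tame N (grid \<Delta> i) \<inter> {\<omega>\<in>space M. e' < \<bar>a \<bullet> J (grid \<Delta> i) \<omega> - riemann N \<eta> \<tau> K \<omega>\<bar>}) \<le> e'"
    unfolding small_def by blast+
  have "continuous_on {0..T} (\<lambda>s. exp (2 * \<beta> * s) * G s)" using G(1) by (intro continuous_intros)
  from uniform_grid_riemann_sum[OF this _ e] T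
  obtain dR where dR: "0 < dR" "\<And>K \<tau>. 0 < \<tau> \<Longrightarrow> \<tau> < dR \<Longrightarrow> real K * \<tau> = T \<Longrightarrow>
    \<bar>integral {0..T} (\<lambda>s. exp (2 * \<beta> * s) * G s) - (\<Sum>k<K. (exp (2 * \<beta> * (real k * \<tau>)) * G (real k * \<tau>)) * \<tau>)\<bar> \<le> e"
    by auto
  define d3 where "d3 = Min (insert dR (d ` {..m}))"
  have d3: "0 < d3" "d3 \<le> dR" "\<And>i. i \<le> m \<Longrightarrow> d3 \<le> d i"
  proof -
    show "0 < d3" unfolding d3_def using dR(1) d(1) by (simp add: Min_gr_iff)
    show "d3 \<le> dR" unfolding d3_def by (rule Min_le) auto
    show "d3 \<le> d i" if "i \<le> m" for i unfolding d3_def by (rule Min_le) (use that in auto)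
  qed
  obtain q where q: "\<Delta> / d3 < real q" using reals_Archimedean2 by blast
  have q0: "0 < real q" using q \<Delta> d3 by (meson divide_pos_pos less_trans)
  \<comment> \<open>The fine grid subdivides the coarse one, so that coarse times are fine grid points.\<close>
  define \<tau> where "\<tau> = \<Delta> / real q"
  have \<tau>: "0 < \<tau>" "\<tau> < d3" "real q * \<tau> = \<Delta>"
    using q q0 \<Delta> d3 by (auto simp: \<tau>_def field_simps)
  have gq: "grid \<tau> (i * q) = grid \<Delta> i" for i unfolding grid_def \<tau>(3)[symmetric] by simp
  have gm: "grid \<Delta> m = T" using \<Delta>(3) by (simp add: grid_def)
  define w where "w i = exp (\<beta> * (real i * \<Delta>))" for i :: nat
  define \<zeta> where "\<zeta> k \<omega> = w (k div q) *\<^sub>R cut N \<eta> (grid \<tau> k) \<omega>" for k \<omega>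
  define Y where "Y = step_sum (grid \<tau>) \<zeta> (m * q)"
  define S where "S = riemann N \<eta> \<tau>"
  obtain cb where cb: "\<And>s \<omega>. norm (cut N \<eta> s \<omega>) \<le> cb" using cut_bounded[OF \<eta>] by blast
  have kq: "k div q \<le> m" "real (k div q) * \<Delta> \<le> real k * \<tau>" "real k * \<tau> \<le> T" if "k < m * q" for k
  proof -
    show "k div q \<le> m" using that by (simp add: less_mult_imp_div_less less_imp_le)
    have "real (k div q) * real q \<le> real k" unfolding of_nat_mult[symmetric] of_nat_le_iff by (rule div_times_less_eq_dividend)
    then show "real (k div q) * \<Delta> \<le> real k * \<tau>" unfolding \<tau>(3)[symmetric]
      using \<tau>(1) by (simp add: mult.assoc[symmetric])
    have "real k \<le> real (m * q)" using that unfolding of_nat_le_iff by (rule less_imp_le)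
    then have "real k * \<tau> \<le> real (m * q) * \<tau>" using \<tau>(1) by (intro mult_right_mono) simp_all
    also have "\<dots> = T" unfolding \<Delta>(3)[symmetric] \<tau>(3)[symmetric] by simp
    finally show "real k * \<tau> \<le> T" .
  qed
  have "0 \<le> grid \<tau> (m * q) \<and> step_sum (grid \<tau>) \<zeta> (m * q) \<in> borel_measurable (F (grid \<tau> (m * q))) \<and>
    integrable M (step_sum (grid \<tau>) \<zeta> (m * q)) \<and> expectation (step_sum (grid \<tau>) \<zeta> (m * q)) = 0 \<and>
    integrable M (\<lambda>\<omega>. (step_sum (grid \<tau>) \<zeta> (m * q) \<omega>)\<^sup>2) \<and>
    expectation (\<lambda>\<omega>. (step_sum (grid \<tau>) \<zeta> (m * q) \<omega>)\<^sup>2) = (\<Sum>l<m * q. expectation (\<lambda>\<omega>. (norm (\<zeta> l \<omega>))\<^sup>2) * (grid \<tau> (Suc l) - grid \<tau> l))"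
  proof (rule step_sum_moments)
    show "\<zeta> l \<in> borel_measurable (F (grid \<tau> l))" for l
      unfolding \<zeta>_def[abs_def] using cut_measurable[of "grid \<tau> l" \<eta> N] \<tau>(1) \<eta> by simp
    show "norm (\<zeta> l \<omega>) \<le> exp (\<beta> * T) * cb" if "l < m * q" for l \<omega>
    proof -
      have "w (l div q) \<le> exp (\<beta> * T)" unfolding w_def using kq[OF that] \<beta> by (auto intro!: mult_left_mono)
      then show ?thesis unfolding \<zeta>_def using cb[of "grid \<tau> l" \<omega>] by (auto simp: w_def intro!: mult_mono)
    qed
  qed (use \<tau>(1) in auto)
  then have Ym: "Y \<in> borel_measurable M" "integrable M Y" "expectation Y = 0" "integrable M (\<lambda>\<omega>. (Y \<omega>)\<^sup>2)"
    and EY: "expectation (\<lambda>\<omega>. (Y \<omega>)\<^sup>2) = (\<Sum>l<m * q. expectation (\<lambda>\<omega>. (norm (\<zeta> l \<omega>))\<^sup>2) * \<tau>)"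
    unfolding Y_def grid_diff by auto
  have "expectation (\<lambda>\<omega>. (Y \<omega>)\<^sup>2) \<le> (\<Sum>k<m * q. (exp (2 * \<beta> * (real k * \<tau>)) * G (real k * \<tau>)) * \<tau>)"
    unfolding EY
  proof (intro sum_mono mult_right_mono)
    fix k assume "k \<in> {..<m * q}"
    then have k: "k < m * q" by simp
    have "expectation (\<lambda>\<omega>. (norm (\<zeta> k \<omega>))\<^sup>2) = (w (k div q))\<^sup>2 * expectation (\<lambda>\<omega>. (norm (cut N \<eta> (grid \<tau> k) \<omega>))\<^sup>2)"
      unfolding \<zeta>_def by (simp add: power_mult_distrib)
    also have "\<dots> \<le> exp (2 * \<beta> * (real k * \<tau>)) * G (real k * \<tau>)"
    proof (rule mult_mono)
      have "w (k div q) \<le> exp (\<beta> * (real k * \<tau>))" unfolding w_def using kq[OF k] \<beta> by (auto intro!: mult_left_mono)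
      then have "(w (k div q))\<^sup>2 \<le> (exp (\<beta> * (real k * \<tau>)))\<^sup>2" by (intro power_mono) (auto simp: w_def)
      also have "\<dots> = exp (2 * \<beta> * (real k * \<tau>))" by (simp add: exp_double[symmetric] mult.assoc)
      finally show "(w (k div q))\<^sup>2 \<le> exp (2 * \<beta> * (real k * \<tau>))" .
      show "expectation (\<lambda>\<omega>. (norm (cut N \<eta> (grid \<tau> k) \<omega>))\<^sup>2) \<le> G (real k * \<tau>)"
        using G(2)[of "real k * \<tau>"] kq[OF k] \<tau>(1) by (simp add: grid_def)
      show "0 \<le> expectation (\<lambda>\<omega>. (norm (cut N \<eta> (grid \<tau> k) \<omega>))\<^sup>2)" by (intro integral_nonneg_AE) auto
    qed auto
    finally show "expectation (\<lambda>\<omega>. (norm (\<zeta> k \<omega>))\<^sup>2) \<le> exp (2 * \<beta> * (real k * \<tau>)) * G (real k * \<tau>)" .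
  qed (use \<tau> in auto)
  moreover have "real (m * q) * \<tau> = T" unfolding \<Delta>(3)[symmetric] \<tau>(3)[symmetric] by simp
  ultimately have EY2: "expectation (\<lambda>\<omega>. (Y \<omega>)\<^sup>2) \<le> integral {0..T} (\<lambda>s. exp (2 * \<beta> * s) * G s) + e"
    using dR(2)[of \<tau> "m * q"] \<tau> d3(2) by linarith
  define Z where "Z i = tame N (grid \<Delta> i) \<inter> {\<omega>\<in>space M. e' < \<bar>a \<bullet> J (grid \<Delta> i) \<omega> - S (i * q) \<omega>\<bar>}" for i
  have Zp: "prob (Z i) \<le> e'" if "i \<le> m" for i
    unfolding Z_def S_def by (rule d(2)[OF \<tau>(1) _ gq]) (use \<tau>(2) d3(3)[OF that] in linarith)
  have Jm: "J t \<in> borel_measurable M" if "0 \<le> t" for t using ito[OF that] by (simp add: is_ito_integral_def)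
  have Sm: "S l \<in> borel_measurable M" for l
  proof -
    have "step_integral l (grid \<tau>) (\<lambda>k. cut N \<eta> (grid \<tau> k)) (grid \<tau> l) \<in> borel_measurable M"
      by (rule step_integral_measurable[OF cut_adapted_step[OF \<tau>(1) \<eta>]]) (use \<tau> in simp)
    then show ?thesis unfolding S_def riemann_def grid_step_integral[OF \<tau>(1)] .
  qed
  have Zm: "Z i \<in> sets M" for i
  proof -
    have [measurable]: "J (grid \<Delta> i) \<in> borel_measurable M" "S (i * q) \<in> borel_measurable M"
      using Jm Sm \<Delta>(1) by auto
    have "{\<omega>\<in>space M. e' < \<bar>a \<bullet> J (grid \<Delta> i) \<omega> - S (i * q) \<omega>\<bar>} \<in> sets M" by measurable
    then show ?thesis unfolding Z_def using tame_sets[of "grid \<Delta> i" N] \<Delta>(1) by auto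
  qed
  have "prob (tame N T \<inter> {\<omega>\<in>space M. e < \<bar>Y \<omega> - (exp (\<beta> * T) * (c \<bullet> r T \<omega>) - x0)\<bar>}) \<le> prob (E \<union> (\<Union>i\<le>m. Z i))"
  proof (rule finite_measure_mono_AE)
    show "E \<union> (\<Union>i\<le>m. Z i) \<in> sets M" using dE(2) Zm by auto
    have eqs: "AE \<omega> in M. \<forall>i\<in>{..m}. c \<bullet> r (grid \<Delta> i) \<omega> = x0 - \<beta> * integral {0..grid \<Delta> i} (\<lambda>s. c \<bullet> r s \<omega>) + a \<bullet> J (grid \<Delta> i) \<omega>"
      using eq \<Delta>(1) by (intro AE_finite_allI) auto
    show "AE \<omega> in M. \<omega> \<in> tame N T \<inter> {\<omega>\<in>space M. e < \<bar>Y \<omega> - (exp (\<beta> * T) * (c \<bullet> r T \<omega>) - x0)\<bar>} \<longrightarrow> \<omega> \<in> E \<union> (\<Union>i\<le>m. Z i)"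
      using r_cont dE(4) eqs init
    proof eventually_elim
      case (elim \<omega>)
      show ?case
      proof (rule impI, rule ccontr)
        assume w1: "\<omega> \<in> tame N T \<inter> {\<omega>\<in>space M. e < \<bar>Y \<omega> - (exp (\<beta> * T) * (c \<bullet> r T \<omega>) - x0)\<bar>}" and w2: "\<omega> \<notin> E \<union> (\<Union>i\<le>m. Z i)"
        have T0: "0 \<le> T" using T by simp
        have bd: "norm (r s \<omega>) \<le> N" if "s \<in> {0..T}" for s
          using w1 tame_iff[OF elim(1) T0] that by auto
        define Yi where "Yi i = a \<bullet> J (grid \<Delta> i) \<omega>" for i
        have close: "\<bar>Yi i - S (i * q) \<omega>\<bar> \<le> e'" if "i \<le> m" for i
        proof -
          have "grid \<Delta> i \<le> T" unfolding gm[symmetric] grid_def using that \<Delta>(1) by (intro mult_right_mono) auto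
          then have "\<omega> \<in> tame N (grid \<Delta> i)" using tame_iff[OF elim(1), of "grid \<Delta> i" N] bd w1 \<Delta>(1) by auto
          moreover have "\<omega> \<notin> Z i" using w2 that by auto
          ultimately show ?thesis using w1 by (auto simp: Z_def Yi_def)
        qed
        have contx: "continuous_on {0..T} (\<lambda>s. c \<bullet> r s \<omega>)"
          by (rule continuous_on_subset[OF continuous_on_inner[OF continuous_on_const elim(1)]]) auto
        have "\<bar>(\<Sum>i<m. exp (\<beta> * (real i * \<Delta>)) * (Yi (Suc i) - Yi i)) - (exp (\<beta> * T) * (c \<bullet> r T \<omega>) - (c \<bullet> r 0 \<omega>))\<bar>
          \<le> exp (\<beta> * T) * T * (\<beta>\<^sup>2 * \<Delta> * b + \<beta> * \<epsilon>1)"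
        proof (rule exponential_weights_error[OF contx \<beta> \<Delta>(1) \<beta>\<Delta> \<Delta>(3)])
          show "\<bar>c \<bullet> r s \<omega>\<bar> \<le> b" if "s \<in> {0..T}" for s
          proof -
            have "norm (r s \<omega>) \<le> \<bar>N\<bar>" using bd[OF that] by simp
            then have "norm c * norm (r s \<omega>) \<le> b" unfolding b_def by (intro mult_left_mono) auto
            then show ?thesis using Cauchy_Schwarz_ineq2[of c "r s \<omega>"] by linarith
          qed
          show "\<bar>c \<bullet> r s \<omega> - c \<bullet> r u \<omega>\<bar> \<le> \<epsilon>1" if "s \<in> {0..T}" "u \<in> {0..T}" "\<bar>s - u\<bar> \<le> \<Delta>" for s u
          proof -
            have "\<bar>s - u\<bar> < d1" using that(3) \<Delta>(2) by (simp add: d2_def)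
            then have "norm (r s \<omega> - r u \<omega>) \<le> \<rho>'" using elim(2) w2 that by auto
            then have "norm c * norm (r s \<omega> - r u \<omega>) \<le> norm c * \<rho>'" by (intro mult_left_mono) auto
            then show ?thesis using Cauchy_Schwarz_ineq2[of c "r s \<omega> - r u \<omega>"] c\<rho> by (simp add: inner_diff_right)
          qed
          show "Yi i = c \<bullet> r (real i * \<Delta>) \<omega> - x0 + \<beta> * integral {0..real i * \<Delta>} (\<lambda>s. c \<bullet> r s \<omega>)" if "i \<le> m" for i
            using elim(3) that by (simp add: Yi_def grid_def)
        qed
        also have "\<dots> \<le> e / 2"
        proof -
          have "exp (\<beta> * T) * T * (\<beta>\<^sup>2 * \<Delta> * b + \<beta> * \<epsilon>1) = A * (\<beta>\<^sup>2 * \<Delta> * b) + A * (\<beta> * \<epsilon>1)"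
            unfolding A_def by (simp add: distrib_left)
          then show ?thesis using \<Delta>A \<epsilon>1' by linarith
        qed
        finally have c1: "\<bar>(\<Sum>i<m. w i * (Yi (Suc i) - Yi i)) - (exp (\<beta> * T) * (c \<bullet> r T \<omega>) - x0)\<bar> \<le> e / 2"
          unfolding w_def using elim(4) by simp
        have Yb: "Y \<omega> = (\<Sum>i<m. w i * (S (Suc i * q) \<omega> - S (i * q) \<omega>))"
          unfolding Y_def S_def riemann_def \<zeta>_def using block_sum[of q \<tau> w "\<lambda>k. cut N \<eta> (grid \<tau> k)" m \<omega>] q0 by simp
        have "\<bar>Y \<omega> - (\<Sum>i<m. w i * (Yi (Suc i) - Yi i))\<bar> \<le> (\<Sum>i<m. exp (\<beta> * T) * (2 * e'))"
          unfolding Yb sum_subtractf[symmetric]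
        proof (intro order_trans[OF sum_abs] sum_mono)
          fix i assume "i \<in> {..<m}"
          then have i: "i < m" by simp
          have "\<bar>w i * (S (Suc i * q) \<omega> - S (i * q) \<omega>) - w i * (Yi (Suc i) - Yi i)\<bar>
              = w i * \<bar>(S (Suc i * q) \<omega> - Yi (Suc i)) - (S (i * q) \<omega> - Yi i)\<bar>"
            unfolding right_diff_distrib[symmetric] abs_mult by (simp add: w_def algebra_simps)
          also have "\<dots> \<le> exp (\<beta> * T) * (2 * e')"
          proof (rule mult_mono)
            have "real i * \<Delta> \<le> T" unfolding \<Delta>(3)[symmetric] using i \<Delta>(1) by (intro mult_right_mono) auto
            then show "w i \<le> exp (\<beta> * T)" unfolding w_def using \<beta> by (auto intro!: mult_left_mono)
            show "\<bar>(S (Suc i * q) \<omega> - Yi (Suc i)) - (S (i * q) \<omega> - Yi i)\<bar> \<le> 2 * e'"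
              using close[of i] close[of "Suc i"] i by linarith
          qed auto
          finally show "\<bar>w i * (S (Suc i * q) \<omega> - S (i * q) \<omega>) - w i * (Yi (Suc i) - Yi i)\<bar> \<le> exp (\<beta> * T) * (2 * e')" .
        qed
        also have "\<dots> = 2 * (real m * exp (\<beta> * T) * e')" by simp
        also have "\<dots> \<le> 2 * ((real m + 1) * exp (\<beta> * T) * e')" using e' by (intro mult_left_mono mult_right_mono) auto
        also have "\<dots> = e / 2" unfolding e'1 by simp
        finally have "\<bar>Y \<omega> - (\<Sum>i<m. w i * (Yi (Suc i) - Yi i))\<bar> \<le> e / 2" .
        moreover have "e < \<bar>Y \<omega> - (exp (\<beta> * T) * (c \<bullet> r T \<omega>) - x0)\<bar>" using w1 by simp
        ultimately show False using c1 by linarith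
      qed
    qed
  qed
  also have "\<dots> \<le> prob E + prob (\<Union>i\<le>m. Z i)" using dE(2) Zm by (intro measure_Un_le) auto
  also have "prob (\<Union>i\<le>m. Z i) \<le> (\<Sum>i\<le>m. prob (Z i))" using Zm by (intro finite_measure_subadditive_finite) auto
  also have "\<dots> \<le> (\<Sum>i\<le>m. e')" using Zp by (intro sum_mono) auto
  also have "\<dots> = (real m + 1) * e'" by (simp add: algebra_simps)
  finally have "prob (tame N T \<inter> {\<omega>\<in>space M. e < \<bar>Y \<omega> - (exp (\<beta> * T) * (c \<bullet> r T \<omega>) - x0)\<bar>}) \<le> e"
    using e'2 dE(3) e by linarith
  then show ?thesis unfolding centered_approx_def using Ym EY2 by blast
qed

section \<open>Second moment and mean of the residual\<close>

lemma orthonormal_combination_norm: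
  fixes c :: "nat \<Rightarrow> 'a::real_inner"
  assumes "finite I" "\<And>i j. i \<in> I \<Longrightarrow> j \<in> I \<Longrightarrow> c i \<bullet> c j = (if i = j then 1 else 0)"
  shows "(norm (\<Sum>j\<in>I. \<alpha> j *\<^sub>R c j))\<^sup>2 = (\<Sum>j\<in>I. (\<alpha> j)\<^sup>2)"
proof -
  have "(norm (\<Sum>j\<in>I. \<alpha> j *\<^sub>R c j))\<^sup>2 = (\<Sum>i\<in>I. \<Sum>j\<in>I. \<alpha> i * \<alpha> j * (c j \<bullet> c i))"
    unfolding power2_norm_eq_inner by (simp add: inner_sum_left inner_sum_right sum_distrib_left mult.assoc)
  also have "\<dots> = (\<Sum>i\<in>I. \<Sum>j\<in>I. if i = j then (\<alpha> i)\<^sup>2 else 0)"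
    using assms(2) by (intro sum.cong refl) (auto simp: power2_eq_square)
  also have "\<dots> = (\<Sum>j\<in>I. (\<alpha> j)\<^sup>2)" using assms(1) by simp
  finally show ?thesis .
qed

context localized begin

text \<open>Unlike the moment of \<open>r\<close> itself this is finite by construction. It is the quantity to which the Gronwall argument
  applies.\<close>

definition tame_moment :: "real \<Rightarrow> real \<Rightarrow> real" where
  "tame_moment N s = expectation (\<lambda>\<omega>. indicator (tame N s) \<omega> * (norm (r s \<omega>))\<^sup>2)"

lemma tame_second_moment_integrable:
  assumes "0 \<le> s" shows "integrable M (\<lambda>\<omega>. indicator (tame N s) \<omega> * (norm (r s \<omega>))\<^sup>2)"
proof (rule integrable_const_bound[of _ "N\<^sup>2"])
  show "(\<lambda>\<omega>. indicator (tame N s) \<omega> * (norm (r s \<omega>))\<^sup>2) \<in> borel_measurable M"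
    using tame_sets[OF assms] r_measurable[OF assms] by measurable
  show "AE \<omega> in M. norm (indicator (tame N s) \<omega> * (norm (r s \<omega>))\<^sup>2) \<le> N\<^sup>2"
    by (intro AE_I2) (auto simp: indicator_def tame_def intro!: power_mono)
qed

lemma tame_exhausts:
  assumes "0 \<le> t" shows "AE \<omega> in M. \<forall>\<^sub>F n in sequentially. \<omega> \<in> tame (real n) t"
  using r_cont AE_space
proof eventually_elim
  case (elim \<omega>)
  have "continuous_on {0..t} (\<lambda>s. r s \<omega>)" using elim(1) by (rule continuous_on_subset) auto
  then have "bounded ((\<lambda>s. r s \<omega>) ` {0..t})" by (intro compact_imp_bounded compact_continuous_image) auto
  then obtain b where b: "\<And>s. s \<in> {0..t} \<Longrightarrow> norm (r s \<omega>) \<le> b" unfolding bounded_iff by blast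
  obtain n0 where n0: "b \<le> real n0" using real_arch_simple by blast
  show ?case
    using eventually_ge_at_top[of n0]
  proof eventually_elim
    case (elim n)
    have "real n0 \<le> real n" using elim by simp
    then show ?case using tame_iff[OF \<open>continuous_on {0..} (\<lambda>t. r t \<omega>)\<close> assms] b n0 \<open>\<omega> \<in> space M\<close> by force
  qed
qed

lemma tame_prob:
  assumes t: "0 \<le> t" and e: "0 < e"
  obtains n where "prob (space M - tame (real n) t) \<le> e"
proof -
  have "(\<lambda>n. prob (space M - tame (real n) t)) \<longlonglongrightarrow> expectation (\<lambda>_. 0)"
  proof -
    have "(\<lambda>n. expectation (\<lambda>\<omega>. indicator (space M - tame (real n) t) \<omega>)) \<longlonglongrightarrow> expectation (\<lambda>_. 0::real)"
    proof (rule integral_dominated_convergence[where w = "\<lambda>_. 1"])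
      show "AE \<omega> in M. (\<lambda>n. indicator (space M - tame (real n) t) \<omega>) \<longlonglongrightarrow> (0::real)"
        using tame_exhausts[OF t]
      proof eventually_elim
        case (elim \<omega>)
        then have "\<forall>\<^sub>F n in sequentially. indicator (space M - tame (real n) t) \<omega> = (0::real)"
          by eventually_elim simp
        then show ?case by (rule tendsto_eventually)
      qed
    qed (use tame_sets[OF t] in \<open>auto simp: indicator_def\<close>)
    then show ?thesis using tame_sets[OF t] by simp
  qed
  then have "\<forall>\<^sub>F n in sequentially. prob (space M - tame (real n) t) < e"
    using e by (intro order_tendstoD(2)) auto
  then obtain n where "prob (space M - tame (real n) t) < e" unfolding eventually_sequentially by blast
  then show ?thesis using that[of n] by simp
qed

text \<open>A majorant of the cut-off moment that is continuous in time, as Riemann sums require.\<close>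

definition capped_moment :: "nat \<Rightarrow> real \<Rightarrow> real" where
  "capped_moment n s = expectation (\<lambda>\<omega>. (min (norm (r s \<omega>)) (real n))\<^sup>2)"

lemma capped_moment_integrable:
  assumes "0 \<le> s" shows "integrable M (\<lambda>\<omega>. (min (norm (r s \<omega>)) (real n))\<^sup>2)"
proof (rule integrable_const_bound[of _ "(real n)\<^sup>2"])
  show "(\<lambda>\<omega>. (min (norm (r s \<omega>)) (real n))\<^sup>2) \<in> borel_measurable M"
    using r_measurable[OF assms] by measurable
  show "AE \<omega> in M. norm ((min (norm (r s \<omega>)) (real n))\<^sup>2) \<le> (real n)\<^sup>2"
    by (intro AE_I2) (auto intro!: power_mono)
qed

lemma capped_moment_continuous: "continuous_on {0..} (capped_moment n)"
  unfolding continuous_on_sequentially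
proof (intro allI ballI impI)
  fix u :: "nat \<Rightarrow> real" and s assume s: "s \<in> {0..}" and u: "(\<forall>i. u i \<in> {0..}) \<and> u \<longlonglongrightarrow> s"
  show "(capped_moment n \<circ> u) \<longlonglongrightarrow> capped_moment n s"
    unfolding comp_def capped_moment_def
  proof (rule integral_dominated_convergence[where w = "\<lambda>_. (real n)\<^sup>2"])
    show "AE \<omega> in M. (\<lambda>i. (min (norm (r (u i) \<omega>)) (real n))\<^sup>2) \<longlonglongrightarrow> (min (norm (r s \<omega>)) (real n))\<^sup>2"
      using r_cont
    proof eventually_elim
      case (elim \<omega>)
      then have "(\<lambda>i. r (u i) \<omega>) \<longlonglongrightarrow> r s \<omega>"
        using s u unfolding continuous_on_sequentially comp_def by blast
      then show ?case by (intro tendsto_intros)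
    qed
    show "AE \<omega> in M. norm ((min (norm (r (u i) \<omega>)) (real n))\<^sup>2) \<le> (real n)\<^sup>2" for i
      by (intro AE_I2) (auto intro!: power_mono)
    show "(\<lambda>\<omega>. (min (norm (r s \<omega>)) (real n))\<^sup>2) \<in> borel_measurable M"
      using capped_moment_integrable[of s n] s by simp
    show "(\<lambda>\<omega>. (min (norm (r (u i) \<omega>)) (real n))\<^sup>2) \<in> borel_measurable M" for i
      using capped_moment_integrable[of "u i" n] u by simp
  qed simp
qed

lemma tame_moment_le_capped_moment: "0 \<le> s \<Longrightarrow> tame_moment (real n) s \<le> capped_moment n s"
  unfolding tame_moment_def capped_moment_def
  by (intro integral_mono tame_second_moment_integrable capped_moment_integrable) (auto simp: indicator_def tame_def min_absorb1)

end

text \<open>The residual in coordinates. The orthonormal \<open>c j\<close> are the moving directions, with decay rates \<open>l j\<close> and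
  noise integrands \<open>\<eta> j (r s)\<close>, whose squared norm is at most \<open>g j \<bar>r s\<bar>\<^sup>2\<close>; \<open>p\<close> is the component that stays constant.
  One matrix-valued integrand \<open>H\<close> generates the noise of all modes through the vectors \<open>a j\<close>.\<close>

locale modal_dynamics = localized M W r
  for M :: "'w measure" and W :: "real \<Rightarrow> 'w \<Rightarrow> real ^ 'n" and r :: "real \<Rightarrow> 'w \<Rightarrow> real ^ 'n" +
  fixes H :: "real \<Rightarrow> 'w \<Rightarrow> real ^ 'n ^ 'd" and J :: "real \<Rightarrow> 'w \<Rightarrow> real ^ 'd" and m :: nat
    and c :: "nat \<Rightarrow> real ^ 'n" and a :: "nat \<Rightarrow> real ^ 'd" and l g :: "nat \<Rightarrow> real"
    and \<eta> :: "nat \<Rightarrow> real ^ 'n \<Rightarrow> real ^ 'n" and r0 p :: "real ^ 'n"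
  assumes ito: "\<And>t. 0 \<le> t \<Longrightarrow> is_ito_integral M F W H t (J t)"
    and Hc: "AE \<omega> in M. continuous_on {0..} (\<lambda>s. H s \<omega>)"
    and orth: "\<And>i j. i \<in> {1..m} \<Longrightarrow> j \<in> {1..m} \<Longrightarrow> c i \<bullet> c j = (if i = j then 1 else 0)"
    and l_nonneg: "\<And>j. j \<in> {1..m} \<Longrightarrow> 0 \<le> l j" and g_nonneg: "\<And>j. j \<in> {1..m} \<Longrightarrow> 0 \<le> g j"
    and H\<eta>: "\<And>j s \<omega>. j \<in> {1..m} \<Longrightarrow> transpose (H s \<omega>) *v a j = \<eta> j (r s \<omega>)"
    and \<eta>: "\<And>j. j \<in> {1..m} \<Longrightarrow> bounded_linear (\<eta> j)"
    and \<eta>g: "\<And>j x. j \<in> {1..m} \<Longrightarrow> (norm (\<eta> j x))\<^sup>2 \<le> g j * (norm x)\<^sup>2"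
    and eq: "\<And>j t. j \<in> {1..m} \<Longrightarrow> 0 \<le> t \<Longrightarrow>
       AE \<omega> in M. c j \<bullet> r t \<omega> = c j \<bullet> r0 - l j * integral {0..t} (\<lambda>s. c j \<bullet> r s \<omega>) + a j \<bullet> J t \<omega>"
    and init: "AE \<omega> in M. r 0 \<omega> = r0"
    and complement: "\<And>t \<omega>. r t \<omega> - (\<Sum>j=1..m. (c j \<bullet> r t \<omega>) *\<^sub>R c j) = p"
    and complement0: "r0 - (\<Sum>j=1..m. (c j \<bullet> r0) *\<^sub>R c j) = p"
begin

definition k :: "real \<Rightarrow> real" where "k s = (\<Sum>j=1..m. g j * exp (- 2 * l j * s))"

text \<open>The solution of the equation without noise; \<open>mean_residual\<close> identifies it with the mean of \<open>r t\<close>.\<close>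

definition mean_path :: "real \<Rightarrow> real ^ 'n" where
  "mean_path t = (\<Sum>j=1..m. (exp (- l j * t) * (c j \<bullet> r0)) *\<^sub>R c j) + p"

lemma deviation: "r t \<omega> - mean_path t = (\<Sum>j=1..m. (c j \<bullet> r t \<omega> - exp (- l j * t) * (c j \<bullet> r0)) *\<^sub>R c j)"
  using complement[of t \<omega>] unfolding mean_path_def by (simp add: scaleR_diff_left sum_subtractf algebra_simps)

lemma deviation_norm: "(norm (r t \<omega> - mean_path t))\<^sup>2 = (\<Sum>j=1..m. (c j \<bullet> r t \<omega> - exp (- l j * t) * (c j \<bullet> r0))\<^sup>2)"
  unfolding deviation by (rule orthonormal_combination_norm) (use orth in auto)

lemma complement_orth:
  assumes j: "j \<in> {1..m}" shows "c j \<bullet> p = 0"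
proof -
  have "(\<Sum>i=1..m. c j \<bullet> ((c i \<bullet> r0) *\<^sub>R c i)) = (\<Sum>i=1..m. if i = j then c j \<bullet> r0 else 0)"
    using orth[OF j] by (intro sum.cong refl) auto
  then show ?thesis
    unfolding complement0[symmetric] inner_diff_right inner_sum_right using j by simp
qed

lemma mean_path_norm: assumes "0 \<le> t" shows "norm (mean_path t) \<le> norm r0"
proof -
  have pyth: "(norm ((\<Sum>j=1..m. \<alpha> j *\<^sub>R c j) + p))\<^sup>2 = (\<Sum>j=1..m. (\<alpha> j)\<^sup>2) + (norm p)\<^sup>2" for \<alpha>
  proof -
    have "(\<Sum>j=1..m. \<alpha> j *\<^sub>R c j) \<bullet> p = 0" using complement_orth by (simp add: inner_sum_left)
    then have "(norm ((\<Sum>j=1..m. \<alpha> j *\<^sub>R c j) + p))\<^sup>2 = (norm (\<Sum>j=1..m. \<alpha> j *\<^sub>R c j))\<^sup>2 + (norm p)\<^sup>2"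
      by (simp add: power2_norm_eq_inner inner_add_left inner_add_right inner_commute)
    then show ?thesis by (subst (asm) orthonormal_combination_norm) (use orth in auto)
  qed
  have "(norm (mean_path t))\<^sup>2 \<le> (\<Sum>j=1..m. (c j \<bullet> r0)\<^sup>2) + (norm p)\<^sup>2"
    unfolding mean_path_def pyth
  proof (intro add_right_mono sum_mono)
    fix j assume j: "j \<in> {1..m}"
    have "exp (- l j * t) \<le> 1" using l_nonneg[OF j] assms by simp
    then have "\<bar>exp (- l j * t) * (c j \<bullet> r0)\<bar> \<le> 1 * \<bar>c j \<bullet> r0\<bar>" unfolding abs_mult by (intro mult_right_mono) auto
    then show "(exp (- l j * t) * (c j \<bullet> r0))\<^sup>2 \<le> (c j \<bullet> r0)\<^sup>2" by (intro abs_le_square_iff[THEN iffD1]) simp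
  qed
  also have "\<dots> = (norm r0)\<^sup>2"
  proof -
    have "(\<Sum>j=1..m. (c j \<bullet> r0) *\<^sub>R c j) + p = r0" using complement0 by (simp add: algebra_simps)
    then show ?thesis unfolding pyth[symmetric] by (simp only:)
  qed
  finally show ?thesis by (rule power2_le_imp_le) simp
qed

lemma mean_path_continuous: "continuous_on S mean_path"
  unfolding mean_path_def by (intro continuous_intros)

lemma k_continuous: "continuous_on S k"
  unfolding k_def by (intro continuous_intros)

lemma k_reflected_continuous: "continuous_on S (\<lambda>s. k (t - s))"
  unfolding k_def by (intro continuous_intros)

lemma k_nonneg: "0 \<le> k s"
  unfolding k_def using g_nonneg by (intro sum_nonneg) auto

lemma k_le: assumes "0 \<le> s" shows "k s \<le> k 0"
  unfolding k_def
proof (intro sum_mono mult_left_mono)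
  fix j assume j: "j \<in> {1..m}"
  show "exp (- 2 * l j * s) \<le> exp (- 2 * l j * 0)" using l_nonneg[OF j] assms by simp
qed (use g_nonneg in auto)

lemma cut_moment_le:
  assumes j: "j \<in> {1..m}" and s: "0 \<le> s"
  shows "expectation (\<lambda>\<omega>. (norm (cut N (\<eta> j) s \<omega>))\<^sup>2) \<le> g j * tame_moment N s"
proof -
  have "expectation (\<lambda>\<omega>. (norm (cut N (\<eta> j) s \<omega>))\<^sup>2) \<le> expectation (\<lambda>\<omega>. g j * (indicator (tame N s) \<omega> * (norm (r s \<omega>))\<^sup>2))"
    using \<eta>g[OF j] g_nonneg[OF j] cut_square_integrable[OF s \<eta>[OF j]] tame_second_moment_integrable[OF s]
    by (intro integral_mono) (auto simp: cut_def indicator_def)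
  then show ?thesis by (simp add: tame_moment_def)
qed

lemma mode_centered_approx:
  assumes j: "j \<in> {1..m}" and T: "0 < T" and h: "continuous_on {0..T} h" "\<And>s. s \<in> {0..T} \<Longrightarrow> tame_moment N s \<le> h s" and e: "0 < e"
  shows "centered_approx (integral {0..T} (\<lambda>s. exp (2 * l j * s) * (g j * h s)) + e) (tame N T)
    (\<lambda>\<omega>. exp (l j * T) * (c j \<bullet> r T \<omega>) - c j \<bullet> r0) e"
proof (rule mode_approximation[OF T l_nonneg[OF j] \<eta>[OF j] ito H\<eta>[OF j] Hc eq[OF j] _ _ _ e])
  show "AE \<omega> in M. c j \<bullet> r 0 \<omega> = c j \<bullet> r0" using init by eventually_elim simp
  show "continuous_on {0..T} (\<lambda>s. g j * h s)" using h(1) by (intro continuous_intros)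
  show "expectation (\<lambda>\<omega>. (norm (cut N (\<eta> j) s \<omega>))\<^sup>2) \<le> g j * h s" if "s \<in> {0..T}" for s
  proof -
    have "g j * tame_moment N s \<le> g j * h s" using h(2)[OF that] g_nonneg[OF j] by (intro mult_left_mono)
    then show ?thesis using cut_moment_le[OF j, of s N] that by simp
  qed
qed auto

text \<open>Multiplying by \<open>exp (- 2 l j T)\<close> and summing over the modes turns the bounds for the single modes
  into a convolution with the kernel. Any continuous majorant \<open>h\<close> of the cut-off moment may be
  inserted; the two uses below differ in this choice.\<close>

lemma truncated_second_moment:
  assumes T: "0 < T" and h: "continuous_on {0..T} h" "\<And>s. s \<in> {0..T} \<Longrightarrow> tame_moment N s \<le> h s"
  shows "integrable M (\<lambda>\<omega>. indicator (tame N T) \<omega> * (norm (r T \<omega> - mean_path T))\<^sup>2)"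
    "expectation (\<lambda>\<omega>. indicator (tame N T) \<omega> * (norm (r T \<omega> - mean_path T))\<^sup>2) \<le> integral {0..T} (\<lambda>s. k (T - s) * h s)"
proof -
  have T0: "0 \<le> T" using T by simp
  let ?Z = "\<lambda>j \<omega>. exp (l j * T) * (c j \<bullet> r T \<omega>) - c j \<bullet> r0"
  let ?I = "\<lambda>j. integral {0..T} (\<lambda>s. exp (2 * l j * s) * (g j * h s))"
  have Zm: "?Z j \<in> borel_measurable M" for j using r_measurable[OF T0] by measurable
  have mode: "integrable M (\<lambda>\<omega>. indicator (tame N T) \<omega> * (?Z j \<omega>)\<^sup>2)" "expectation (\<lambda>\<omega>. indicator (tame N T) \<omega> * (?Z j \<omega>)\<^sup>2) \<le> ?I j"
    if j: "j \<in> {1..m}" for j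
    by (rule second_moment_of_limit_in_probability[OF Zm tame_sets[OF T0] mode_centered_approx[OF j T h]], assumption+)+
  have sq: "(c j \<bullet> r T \<omega> - exp (- l j * T) * (c j \<bullet> r0))\<^sup>2 = exp (- 2 * l j * T) * (?Z j \<omega>)\<^sup>2" for j \<omega>
  proof -
    have "c j \<bullet> r T \<omega> - exp (- l j * T) * (c j \<bullet> r0) = exp (- l j * T) * ?Z j \<omega>"
      by (simp add: right_diff_distrib mult.assoc[symmetric] exp_add[symmetric])
    then show ?thesis by (simp add: power_mult_distrib exp_double[symmetric] mult.assoc)
  qed
  have dev: "indicator (tame N T) \<omega> * (norm (r T \<omega> - mean_path T))\<^sup>2
     = (\<Sum>j=1..m. exp (- 2 * l j * T) * (indicator (tame N T) \<omega> * (?Z j \<omega>)\<^sup>2))" for \<omega>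
    unfolding deviation_norm sq by (simp add: sum_distrib_left mult.left_commute)
  show "integrable M (\<lambda>\<omega>. indicator (tame N T) \<omega> * (norm (r T \<omega> - mean_path T))\<^sup>2)"
    unfolding dev using mode by (intro Bochner_Integration.integrable_sum integrable_mult_right) auto
  have hint: "(\<lambda>s. exp (- 2 * l j * (T - s)) * (g j * h s)) integrable_on {0..T}" for j
    using h(1) by (intro integrable_continuous_real continuous_intros)
  have "expectation (\<lambda>\<omega>. indicator (tame N T) \<omega> * (norm (r T \<omega> - mean_path T))\<^sup>2)
     = (\<Sum>j=1..m. exp (- 2 * l j * T) * expectation (\<lambda>\<omega>. indicator (tame N T) \<omega> * (?Z j \<omega>)\<^sup>2))"
    unfolding dev using mode by (subst Bochner_Integration.integral_sum) auto
  also have "\<dots> \<le> (\<Sum>j=1..m. exp (- 2 * l j * T) * ?I j)"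
    using mode by (intro sum_mono mult_left_mono) auto
  also have "\<dots> = (\<Sum>j=1..m. integral {0..T} (\<lambda>s. exp (- 2 * l j * (T - s)) * (g j * h s)))"
  proof (rule sum.cong[OF refl])
    fix j
    have "exp (- 2 * l j * (T - s)) = exp (- 2 * l j * T) * exp (2 * l j * s)" for s
      by (simp add: exp_add[symmetric] algebra_simps)
    then have "(\<lambda>s. exp (- 2 * l j * (T - s)) * (g j * h s)) = (\<lambda>s. exp (- 2 * l j * T) * (exp (2 * l j * s) * (g j * h s)))"
      by (simp add: mult.assoc)
    then show "exp (- 2 * l j * T) * ?I j = integral {0..T} (\<lambda>s. exp (- 2 * l j * (T - s)) * (g j * h s))" by simp
  qed
  also have "\<dots> = integral {0..T} (\<lambda>s. \<Sum>j=1..m. exp (- 2 * l j * (T - s)) * (g j * h s))"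
    using hint by (intro Henstock_Kurzweil_Integration.integral_sum[symmetric]) auto
  also have "(\<lambda>s. \<Sum>j=1..m. exp (- 2 * l j * (T - s)) * (g j * h s)) = (\<lambda>s. k (T - s) * h s)"
    unfolding k_def sum_distrib_right by (intro ext sum.cong refl) (simp add: mult_ac)
  finally show "expectation (\<lambda>\<omega>. indicator (tame N T) \<omega> * (norm (r T \<omega> - mean_path T))\<^sup>2) \<le> integral {0..T} (\<lambda>s. k (T - s) * h s)" .
qed

lemma square_split: "(norm (x :: real ^ 'n))\<^sup>2 \<le> 2 * (norm y)\<^sup>2 + 2 * (norm (x - y))\<^sup>2"
proof -
  have "norm x \<le> norm y + norm (x - y)" using norm_triangle_ineq[of y "x - y"] by simp
  then have "(norm x)\<^sup>2 \<le> (norm y + norm (x - y))\<^sup>2" by (intro power_mono) auto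
  also have "\<dots> \<le> 2 * (norm y)\<^sup>2 + 2 * (norm (x - y))\<^sup>2"
    using sum_squares_bound[of "norm y" "norm (x - y)"] by (simp add: power2_sum)
  finally show ?thesis .
qed

text \<open>With this rate, \<open>2 k 0 \<integral>\<^sub>0\<^sup>T exp (growth s) ds \<le> exp (growth T) / 2\<close>: one step of the iteration below halves the
  constant. The summand 1 keeps the rate positive when the kernel vanishes.\<close>

abbreviation "growth \<equiv> 4 * (k 0 + 1)"

lemma growth_pos: "0 < growth" using k_nonneg[of 0] by simp

text \<open>Gronwall's inequality by iteration of continuous majorants, which avoids measurability of the
  cut-off moment in time. The start \<open>N\<^sup>2\<close> is trivial, and its contribution is halved in each step while the
  contribution of \<open>r0\<close> reproduces itself.\<close>

lemma tame_moment_bound_iterate: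
  assumes "0 \<le> T" shows "tame_moment N T \<le> (4 * (norm r0)\<^sup>2 + N\<^sup>2 * (1/2) ^ i) * exp (growth * T)"
  using assms
proof (induction i arbitrary: T)
  case 0
  have "tame_moment N T \<le> N\<^sup>2"
    unfolding tame_moment_def using tame_second_moment_integrable[OF 0]
    by (intro integral_le_const) (auto intro!: AE_I2 power_mono simp: indicator_def tame_def)
  also have "\<dots> \<le> (4 * (norm r0)\<^sup>2 + N\<^sup>2 * (1/2) ^ 0) * 1" by simp
  also have "\<dots> \<le> (4 * (norm r0)\<^sup>2 + N\<^sup>2 * (1/2) ^ 0) * exp (growth * T)"
    using 0 growth_pos by (intro mult_left_mono) auto
  finally show ?case .
next
  case (Suc i)
  define C where "C = 4 * (norm r0)\<^sup>2 + N\<^sup>2 * (1/2) ^ i"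
  have C: "0 \<le> C" by (simp add: C_def)
  have base: "tame_moment N T \<le> 2 * (norm r0)\<^sup>2 + (C / 2) * exp (growth * T)"
  proof (cases "T = 0")
    case True
    have "tame_moment N 0 \<le> expectation (\<lambda>_. (norm r0)\<^sup>2)"
      unfolding tame_moment_def
    proof (rule integral_mono_AE)
      show "AE \<omega> in M. indicator (tame N 0) \<omega> * (norm (r 0 \<omega>))\<^sup>2 \<le> (norm r0)\<^sup>2"
        using init by eventually_elim (simp add: indicator_def)
    qed (use tame_second_moment_integrable in auto)
    then have "tame_moment N T \<le> (norm r0)\<^sup>2" using True by (simp add: prob_space)
    moreover have "0 \<le> (C / 2) * exp (growth * T)" using C by simp
    moreover have "0 \<le> (norm r0)\<^sup>2" by simp
    ultimately show ?thesis by linarith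
  next
    case False
    then have T: "0 < T" using Suc.prems by simp
    define h where "h s = C * exp (growth * s)" for s
    have hc: "continuous_on {0..T} h" unfolding h_def by (intro continuous_intros)
    have hG: "tame_moment N s \<le> h s" if "s \<in> {0..T}" for s using Suc.IH[of s] that by (simp add: h_def C_def)
    note tm = truncated_second_moment[OF T hc hG]
    have "integral {0..T} (\<lambda>s. k (T - s) * h s) \<le> integral {0..T} (\<lambda>s. (k 0 + 1) * h s)"
    proof (rule integral_le)
      show "(\<lambda>s. k (T - s) * h s) integrable_on {0..T}"
        by (rule integrable_continuous_real[OF continuous_on_mult[OF k_reflected_continuous hc]])
      show "(\<lambda>s. (k 0 + 1) * h s) integrable_on {0..T}"
        using hc by (intro integrable_continuous_real continuous_intros)
      fix s assume "s \<in> {0..T}"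
      then show "k (T - s) * h s \<le> (k 0 + 1) * h s"
        using k_le[of "T - s"] C by (intro mult_right_mono) (auto simp: h_def)
    qed
    also have "\<dots> = (C / 4) * (exp (growth * T) - exp (growth * 0))"
    proof -
      have "((\<lambda>s. (k 0 + 1) * h s) has_integral (C / 4) * exp (growth * T) - (C / 4) * exp (growth * 0)) {0..T}"
      proof (rule fundamental_theorem_of_calculus)
        fix s assume "s \<in> {0..T}"
        have "((\<lambda>s. (C / 4) * exp (growth * s)) has_real_derivative (C / 4) * (exp (growth * s) * growth)) (at s within {0..T})"
          by (auto intro!: derivative_eq_intros)
        moreover have "(C / 4) * (exp (growth * s) * growth) = (k 0 + 1) * h s" by (simp add: h_def algebra_simps)
        ultimately show "((\<lambda>s. (C / 4) * exp (growth * s)) has_vector_derivative (k 0 + 1) * h s) (at s within {0..T})"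
          by (simp add: has_real_derivative_iff_has_vector_derivative)
      qed (use T in simp)
      then have "integral {0..T} (\<lambda>s. (k 0 + 1) * h s) = (C / 4) * exp (growth * T) - (C / 4) * exp (growth * 0)"
        by (rule integral_unique)
      then show ?thesis by (simp only: right_diff_distrib)
    qed
    also have "\<dots> \<le> (C / 4) * exp (growth * T)" using C by (simp add: right_diff_distrib)
    finally have I: "integral {0..T} (\<lambda>s. k (T - s) * h s) \<le> (C / 4) * exp (growth * T)" .
    have "tame_moment N T \<le> expectation (\<lambda>\<omega>. 2 * (norm r0)\<^sup>2 + 2 * (indicator (tame N T) \<omega> * (norm (r T \<omega> - mean_path T))\<^sup>2))"
      unfolding tame_moment_def
    proof (rule integral_mono)
      show "integrable M (\<lambda>\<omega>. 2 * (norm r0)\<^sup>2 + 2 * (indicator (tame N T) \<omega> * (norm (r T \<omega> - mean_path T))\<^sup>2))"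
        using tm(1) by simp
      fix \<omega>
      have "(norm (mean_path T))\<^sup>2 \<le> (norm r0)\<^sup>2" using mean_path_norm[OF Suc.prems] by (intro power_mono) auto
      then have "(norm (r T \<omega>))\<^sup>2 \<le> 2 * (norm r0)\<^sup>2 + 2 * (norm (r T \<omega> - mean_path T))\<^sup>2"
        using square_split[of "r T \<omega>" "mean_path T"] by linarith
      then show "indicator (tame N T) \<omega> * (norm (r T \<omega>))\<^sup>2 \<le> 2 * (norm r0)\<^sup>2 + 2 * (indicator (tame N T) \<omega> * (norm (r T \<omega> - mean_path T))\<^sup>2)"
        by (cases "\<omega> \<in> tame N T") simp_all
    qed (use tame_second_moment_integrable[OF Suc.prems] in auto)
    also have "\<dots> = 2 * (norm r0)\<^sup>2 + 2 * expectation (\<lambda>\<omega>. indicator (tame N T) \<omega> * (norm (r T \<omega> - mean_path T))\<^sup>2)"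
      using tm(1) by (simp add: prob_space)
    also have "\<dots> \<le> 2 * (norm r0)\<^sup>2 + 2 * ((C / 4) * exp (growth * T))" using tm(2) I by linarith
    finally show ?thesis by simp
  qed
  also have "2 * (norm r0)\<^sup>2 + (C / 2) * exp (growth * T) \<le> 2 * (norm r0)\<^sup>2 * exp (growth * T) + (C / 2) * exp (growth * T)"
  proof -
    have "2 * (norm r0)\<^sup>2 * 1 \<le> 2 * (norm r0)\<^sup>2 * exp (growth * T)" using Suc.prems growth_pos by (intro mult_left_mono) auto
    then show ?thesis by simp
  qed
  also have "\<dots> = (4 * (norm r0)\<^sup>2 + N\<^sup>2 * (1/2) ^ Suc i) * exp (growth * T)"
    by (simp add: C_def algebra_simps add_divide_distrib)
  finally show ?case .
qed

lemma tame_moment_bound: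
  assumes "0 \<le> T" shows "tame_moment N T \<le> 4 * (norm r0)\<^sup>2 * exp (growth * T)"
proof -
  have "(\<lambda>i. (4 * (norm r0)\<^sup>2 + N\<^sup>2 * (1/2) ^ i) * exp (growth * T)) \<longlonglongrightarrow> (4 * (norm r0)\<^sup>2 + N\<^sup>2 * 0) * exp (growth * T)"
    by (intro tendsto_intros LIMSEQ_power_zero) simp
  then show ?thesis using tame_moment_bound_iterate[OF assms] LIMSEQ_le_const by fastforce
qed

text \<open>Since \<open>tame_moment_bound\<close> does not involve \<open>N\<close>, the cut-off can be removed by Fatou's lemma.\<close>

lemma second_moment:
  assumes t: "0 \<le> t"
  shows "integrable M (\<lambda>\<omega>. (norm (r t \<omega>))\<^sup>2)"
    "expectation (\<lambda>\<omega>. (norm (r t \<omega>))\<^sup>2) \<le> 4 * (norm r0)\<^sup>2 * exp (growth * t)"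
proof -
  let ?f = "\<lambda>n \<omega>. indicator (tame (real n) t) \<omega> * (norm (r t \<omega>))\<^sup>2"
  have lim: "AE \<omega> in M. (\<lambda>n. ?f n \<omega>) \<longlonglongrightarrow> (norm (r t \<omega>))\<^sup>2"
    using tame_exhausts[OF t]
  proof eventually_elim
    case (elim \<omega>)
    then have "\<forall>\<^sub>F n in sequentially. ?f n \<omega> = (norm (r t \<omega>))\<^sup>2" by eventually_elim simp
    then show ?case by (rule tendsto_eventually)
  qed
  have m: "(\<lambda>\<omega>. (norm (r t \<omega>))\<^sup>2) \<in> borel_measurable M" using r_measurable[OF t] by measurable
  show "integrable M (\<lambda>\<omega>. (norm (r t \<omega>))\<^sup>2)"
    "expectation (\<lambda>\<omega>. (norm (r t \<omega>))\<^sup>2) \<le> 4 * (norm r0)\<^sup>2 * exp (growth * t)"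
    using fatou_bound[OF tame_second_moment_integrable[OF t] _ lim m] tame_moment_bound[OF t] by (auto simp: tame_moment_def)
qed

definition L :: "real \<Rightarrow> real" where "L t = expectation (\<lambda>\<omega>. (norm (r t \<omega>))\<^sup>2)"

lemma L_nonneg: "0 \<le> L t" unfolding L_def by (intro integral_nonneg_AE) auto

lemma L_bounded: "\<exists>b. \<forall>s\<in>{0..T}. L s \<le> b"
proof (intro exI ballI)
  fix s assume s: "s \<in> {0..T}"
  have "L s \<le> 4 * (norm r0)\<^sup>2 * exp (growth * s)" unfolding L_def using s by (intro second_moment) auto
  also have "\<dots> \<le> 4 * (norm r0)\<^sup>2 * exp (growth * T)"
    using s growth_pos by (intro mult_left_mono) (auto intro!: mult_left_mono)
  finally show "L s \<le> 4 * (norm r0)\<^sup>2 * exp (growth * T)" .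
qed

lemma capped_moment_le_L: "0 \<le> s \<Longrightarrow> capped_moment n s \<le> L s"
  unfolding capped_moment_def L_def by (intro integral_mono capped_moment_integrable second_moment power_mono) auto

lemma capped_moment_tendsto_L: assumes s: "0 \<le> s" shows "(\<lambda>n. capped_moment n s) \<longlonglongrightarrow> L s"
  unfolding capped_moment_def L_def
proof (rule integral_dominated_convergence[where w = "\<lambda>\<omega>. (norm (r s \<omega>))\<^sup>2"])
  show "AE \<omega> in M. (\<lambda>n. (min (norm (r s \<omega>)) (real n))\<^sup>2) \<longlonglongrightarrow> (norm (r s \<omega>))\<^sup>2"
  proof (rule AE_I2)
    fix \<omega>
    obtain n0 where n0: "norm (r s \<omega>) \<le> real n0" using real_arch_simple by blast
    have "\<forall>\<^sub>F n in sequentially. (min (norm (r s \<omega>)) (real n))\<^sup>2 = (norm (r s \<omega>))\<^sup>2"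
      using eventually_ge_at_top[of n0]
    proof eventually_elim
      case (elim n)
      have "real n0 \<le> real n" using elim by simp
      then show ?case using n0 by (simp add: min_absorb1)
    qed
    then show "(\<lambda>n. (min (norm (r s \<omega>)) (real n))\<^sup>2) \<longlonglongrightarrow> (norm (r s \<omega>))\<^sup>2" by (rule tendsto_eventually)
  qed
  show "(\<lambda>\<omega>. (norm (r s \<omega>))\<^sup>2) \<in> borel_measurable M" using second_moment(1)[OF s] by simp
  show "(\<lambda>\<omega>. (min (norm (r s \<omega>)) (real n))\<^sup>2) \<in> borel_measurable M" for n using capped_moment_integrable[OF s, of n] by simp
  show "AE \<omega> in M. norm ((min (norm (r s \<omega>)) (real n))\<^sup>2) \<le> (norm (r s \<omega>))\<^sup>2" for n
    by (intro AE_I2) (auto intro!: power_mono)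
qed (rule second_moment(1)[OF s])

text \<open>Nothing shows that \<open>L\<close> is continuous at this stage; it is Borel as a limit of continuous functions.\<close>

lemma L_indicator_measurable: "(\<lambda>s. indicator {0..} s *\<^sub>R L s) \<in> borel_measurable borel"
proof (rule borel_measurable_LIMSEQ_real[where u = "\<lambda>n s. indicator {0..} s *\<^sub>R capped_moment n s"])
  show "(\<lambda>s. indicator {0..} s *\<^sub>R capped_moment n s) \<in> borel_measurable borel" for n
    by (rule borel_measurable_continuous_on_indicator[OF _ capped_moment_continuous]) simp
  show "(\<lambda>n. indicator {0..} s *\<^sub>R capped_moment n s) \<longlonglongrightarrow> indicator {0..} s *\<^sub>R L s" for s
    using capped_moment_tendsto_L[of s] by (cases "0 \<le> s") auto
qed

lemma causal_L_measurable: "causal L \<in> borel_measurable borel"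
proof -
  have "causal L = (\<lambda>s. ennreal (indicator {0..} s *\<^sub>R L s))" by (auto simp: causal_def indicator_def)
  then show ?thesis using L_indicator_measurable by simp
qed

lemma kernel_L_integrable:
  assumes t: "0 \<le> t" shows "set_integrable lborel {0..t} (\<lambda>s. k (t - s) * L s)"
proof -
  obtain b where b: "\<And>s. s \<in> {0..t} \<Longrightarrow> L s \<le> b" using L_bounded by blast
  have km: "k \<in> borel_measurable borel" by (rule borel_measurable_continuous_onI) (rule k_continuous)
  show ?thesis
    unfolding set_integrable_def
  proof (rule Bochner_Integration.integrable_bound[where f = "\<lambda>s. indicator {0..t} s *\<^sub>R (k 0 * b)"])
    show "integrable lborel (\<lambda>s. indicator {0..t} s *\<^sub>R (k 0 * b))" using t by simp
    have "(\<lambda>s. indicator {0..t} s *\<^sub>R (k (t - s) * L s)) = (\<lambda>s. indicator {0..t} s * (k (t - s) * (indicator {0..} s *\<^sub>R L s)))"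
      by (auto simp: indicator_def)
    moreover have "(\<lambda>s. indicator {0..t} s * (k (t - s) * (indicator {0..} s *\<^sub>R L s))) \<in> borel_measurable lborel"
      using km L_indicator_measurable by measurable
    ultimately show "(\<lambda>s. indicator {0..t} s *\<^sub>R (k (t - s) * L s)) \<in> borel_measurable lborel" by simp
    show "AE s in lborel. norm (indicator {0..t} s *\<^sub>R (k (t - s) * L s)) \<le> norm (indicator {0..t} s *\<^sub>R (k 0 * b))"
    proof (rule AE_I2)
      fix s
      show "norm (indicator {0..t} s *\<^sub>R (k (t - s) * L s)) \<le> norm (indicator {0..t} s *\<^sub>R (k 0 * b))"
      proof (cases "s \<in> {0..t}")
        case True
        have "k (t - s) * L s \<le> k 0 * b"
          using True k_le[of "t - s"] b[OF True] k_nonneg L_nonneg by (intro mult_mono) auto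
        then show ?thesis using True k_nonneg[of "t - s"] L_nonneg[of s] by simp
      qed simp
    qed
  qed
qed

text \<open>The cut-off moment is now inserted with its capped majorant, which lies below \<open>L\<close> for every level,
  and the level tends to infinity on the left-hand side only. Time 0 is separate because the grids
  need a positive horizon.\<close>

lemma variance_bound:
  assumes t: "0 \<le> t"
  shows "integrable M (\<lambda>\<omega>. (norm (r t \<omega> - mean_path t))\<^sup>2)"
    "expectation (\<lambda>\<omega>. (norm (r t \<omega> - mean_path t))\<^sup>2) \<le> causal_conv k L t"
proof -
  have conv0: "0 \<le> causal_conv k L t"
    unfolding causal_conv_def set_lebesgue_integral_def using k_nonneg L_nonneg by (intro integral_nonneg_AE) auto
  have rm: "(\<lambda>\<omega>. (norm (r t \<omega> - mean_path t))\<^sup>2) \<in> borel_measurable M" using r_measurable[OF t] by measurable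
  have "integrable M (\<lambda>\<omega>. (norm (r t \<omega> - mean_path t))\<^sup>2) \<and> expectation (\<lambda>\<omega>. (norm (r t \<omega> - mean_path t))\<^sup>2) \<le> causal_conv k L t"
  proof (cases "t = 0")
    case True
    have "mean_path 0 = r0" using complement0 by (simp add: mean_path_def algebra_simps)
    then have ae: "AE \<omega> in M. (norm (r t \<omega> - mean_path t))\<^sup>2 = 0" using init True by auto
    have "integrable M (\<lambda>\<omega>. (norm (r t \<omega> - mean_path t))\<^sup>2)"
      using integrable_cong_AE[OF rm _ ae] by simp
    moreover have "expectation (\<lambda>\<omega>. (norm (r t \<omega> - mean_path t))\<^sup>2) = 0"
      using integral_cong_AE[OF rm _ ae] by simp
    ultimately show ?thesis using conv0 by simp
  next
    case False
    then have t': "0 < t" using t by simp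
    let ?f = "\<lambda>n \<omega>. indicator (tame (real n) t) \<omega> * (norm (r t \<omega> - mean_path t))\<^sup>2"
    have lim: "AE \<omega> in M. (\<lambda>n. ?f n \<omega>) \<longlonglongrightarrow> (norm (r t \<omega> - mean_path t))\<^sup>2"
      using tame_exhausts[OF t]
    proof eventually_elim
      case (elim \<omega>)
      then have "\<forall>\<^sub>F n in sequentially. ?f n \<omega> = (norm (r t \<omega> - mean_path t))\<^sup>2" by eventually_elim simp
      then show ?case by (rule tendsto_eventually)
    qed
    have Gc: "continuous_on {0..t} (capped_moment n)" for n by (rule continuous_on_subset[OF capped_moment_continuous]) auto
    have tm: "integrable M (?f n)" "expectation (?f n) \<le> integral {0..t} (\<lambda>s. k (t - s) * capped_moment n s)" for n
      using truncated_second_moment[OF t' Gc, of "real n" n] tame_moment_le_capped_moment by auto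
    have "integral {0..t} (\<lambda>s. k (t - s) * capped_moment n s) \<le> causal_conv k L t" for n
    proof -
      have cont: "continuous_on {0..t} (\<lambda>s. k (t - s) * capped_moment n s)"
        by (rule continuous_on_mult[OF k_reflected_continuous Gc])
      then have si: "set_integrable lborel {0..t} (\<lambda>s. k (t - s) * capped_moment n s)" by (rule borel_integrable_atLeastAtMost')
      have "integral {0..t} (\<lambda>s. k (t - s) * capped_moment n s) = (LBINT s:{0..t}. k (t - s) * capped_moment n s)"
        using set_borel_integral_eq_integral(2)[OF si] by simp
      also have "\<dots> \<le> causal_conv k L t"
        unfolding causal_conv_def
        by (rule set_integral_mono[OF si kernel_L_integrable[OF t]]) (use capped_moment_le_L k_nonneg in \<open>auto intro!: mult_left_mono\<close>)
      finally show ?thesis .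
    qed
    then have b: "expectation (?f n) \<le> causal_conv k L t" for n using tm(2) order_trans by blast
    show ?thesis using fatou_bound[OF tm(1) _ lim rm _ b] by auto
  qed
  then show "integrable M (\<lambda>\<omega>. (norm (r t \<omega> - mean_path t))\<^sup>2)"
    "expectation (\<lambda>\<omega>. (norm (r t \<omega> - mean_path t))\<^sup>2) \<le> causal_conv k L t" by auto
qed

lemma r_integrable: assumes "0 \<le> t" shows "integrable M (r t)"
proof (rule Bochner_Integration.integrable_bound[where f = "\<lambda>\<omega>. 1 + (norm (r t \<omega>))\<^sup>2"])
  show "integrable M (\<lambda>\<omega>. 1 + (norm (r t \<omega>))\<^sup>2)" using second_moment(1)[OF assms] by simp
  show "AE \<omega> in M. norm (r t \<omega>) \<le> norm (1 + (norm (r t \<omega>))\<^sup>2)"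
  proof (rule AE_I2)
    fix \<omega>
    have "norm (r t \<omega>) \<le> 1 + (norm (r t \<omega>))\<^sup>2"
      using sum_squares_bound[of "norm (r t \<omega>)" 1] norm_ge_zero[of "r t \<omega>"] by (simp, linarith)
    then show "norm (r t \<omega>) \<le> norm (1 + (norm (r t \<omega>))\<^sup>2)" by simp
  qed
qed (rule r_measurable[OF assms])

text \<open>The approximating sums have second moments bounded uniformly in the level \<open>N\<close>, by \<open>tame_moment_bound\<close>. Choosing
  \<open>N\<close> so large that \<open>tame N T\<close> fails with small probability removes the localization.\<close>

lemma mode_mean:
  assumes j: "j \<in> {1..m}" and T: "0 \<le> T"
  shows "expectation (\<lambda>\<omega>. c j \<bullet> r T \<omega>) = exp (- l j * T) * (c j \<bullet> r0)"
proof (cases "T = 0")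
  case True
  have "expectation (\<lambda>\<omega>. c j \<bullet> r T \<omega>) = expectation (\<lambda>_. c j \<bullet> r0)"
    using init r_measurable[OF T] True by (intro integral_cong_AE) auto
  then show ?thesis using True by (simp add: prob_space)
next
  case False
  then have T': "0 < T" using T by simp
  let ?Z = "\<lambda>\<omega>. exp (l j * T) * (c j \<bullet> r T \<omega>) - c j \<bullet> r0"
  define h where "h s = 4 * (norm r0)\<^sup>2 * exp (growth * s)" for s
  have hc: "continuous_on {0..T} h" unfolding h_def by (intro continuous_intros)
  have hG: "tame_moment N s \<le> h s" if "s \<in> {0..T}" for s N using tame_moment_bound[of s N] that by (simp add: h_def)
  let ?I = "integral {0..T} (\<lambda>s. exp (2 * l j * s) * (g j * h s))"
  have cr: "integrable M (\<lambda>\<omega>. c j \<bullet> r T \<omega>)" using r_integrable[OF T] by simp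
  then have Zi: "integrable M ?Z" by simp
  have Zm: "?Z \<in> borel_measurable M" using Zi by simp
  have approx: "centered_approx (?I + 1) (space M) ?Z e" if e: "0 < e" "e \<le> 1" for e
  proof -
    obtain n where n: "prob (space M - tame (real n) T) \<le> e / 2" using tame_prob[OF T, of "e / 2"] e by auto
    show ?thesis
      by (rule centered_approx_extend[OF Zm mode_centered_approx[OF j T' hc hG, of "e / 2" "real n"] tame_sets[OF T]])
         (use e n in auto)
  qed
  have "integrable M (\<lambda>\<omega>. indicator (space M) \<omega> * (?Z \<omega>)\<^sup>2)"
  proof (rule second_moment_of_limit_in_probability(1)[OF Zm sets.top, where b = "?I + 1"])
    fix e :: real assume e: "0 < e"
    show "centered_approx (?I + 1 + e) (space M) ?Z e"
      by (rule centered_approx_extend[OF Zm approx[of "min e 1"]]) (use e in auto)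
  qed
  then have Z2: "integrable M (\<lambda>\<omega>. (?Z \<omega>)\<^sup>2)"
    by (simp cong: Bochner_Integration.integrable_cong)
  have "expectation ?Z = 0" by (rule mean_of_limit_in_probability[OF Zi Z2 approx])
  then have "exp (l j * T) * expectation (\<lambda>\<omega>. c j \<bullet> r T \<omega>) = c j \<bullet> r0"
    using cr by (simp add: prob_space)
  then show ?thesis by (simp add: exp_minus field_simps)
qed

lemma mean_residual: assumes t: "0 \<le> t" shows "expectation (r t) = mean_path t"
proof -
  have i: "integrable M (\<lambda>\<omega>. c j \<bullet> r t \<omega>)" for j using r_integrable[OF t] by simp
  have "r t \<omega> = (\<Sum>j=1..m. (c j \<bullet> r t \<omega>) *\<^sub>R c j) + p" for \<omega> using complement[of t \<omega>] by (simp add: algebra_simps)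
  then have "expectation (r t) = expectation (\<lambda>\<omega>. (\<Sum>j=1..m. (c j \<bullet> r t \<omega>) *\<^sub>R c j) + p)" by (simp cong: Bochner_Integration.integral_cong)
  also have "\<dots> = (\<Sum>j=1..m. expectation (\<lambda>\<omega>. c j \<bullet> r t \<omega>) *\<^sub>R c j) + p"
    using i by (simp add: Bochner_Integration.integral_add Bochner_Integration.integral_sum prob_space)
  also have "\<dots> = mean_path t" unfolding mean_path_def using mode_mean[OF _ t] by simp
  finally show ?thesis .
qed

lemma L_decomposition:
  assumes t: "0 \<le> t" shows "L t = (norm (mean_path t))\<^sup>2 + expectation (\<lambda>\<omega>. (norm (r t \<omega> - mean_path t))\<^sup>2)"
proof -
  have i: "integrable M (\<lambda>\<omega>. mean_path t \<bullet> r t \<omega>)" using r_integrable[OF t] by simp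
  have pw: "(norm (r t \<omega>))\<^sup>2 = (norm (r t \<omega> - mean_path t))\<^sup>2 + 2 * (mean_path t \<bullet> r t \<omega>) - (norm (mean_path t))\<^sup>2" for \<omega>
    unfolding power2_norm_eq_inner by (simp add: inner_diff_left inner_diff_right inner_commute)
  have "L t = expectation (\<lambda>\<omega>. (norm (r t \<omega> - mean_path t))\<^sup>2) + 2 * expectation (\<lambda>\<omega>. mean_path t \<bullet> r t \<omega>) - (norm (mean_path t))\<^sup>2"
    unfolding L_def pw using i variance_bound(1)[OF t] by (simp add: prob_space)
  also have "expectation (\<lambda>\<omega>. mean_path t \<bullet> r t \<omega>) = mean_path t \<bullet> mean_path t"
    using integral_inner_right[of "mean_path t" M "r t"] r_integrable[OF t] mean_residual[OF t] by simp
  finally show ?thesis by (simp add: power2_norm_eq_inner)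
qed

end

section \<open>The spectral coordinates of the residual\<close>

lemma noise_matrix_component:
  "noise_matrix (x :: real ^ 'n) $ i $ j = x $ i * ((if i = j then 1 else 0) - 1 / real CARD('n))"
  by (simp add: noise_matrix_def diag_mat_def outer_prod_def algebra_simps)

lemma noise_transpose_component:
  fixes x w :: "real ^ 'n"
  shows "(transpose (noise_matrix x) *v w) $ j = x $ j * w $ j - (x \<bullet> w) / real CARD('n)"
proof -
  have "(transpose (noise_matrix x) *v w) $ j = (\<Sum>i\<in>UNIV. (if i = j then x $ i * w $ i else 0) - x $ i * w $ i / real CARD('n))"
    unfolding matrix_vector_mult_def transpose_def vec_lambda_beta noise_matrix_component
    by (intro sum.cong refl) (auto simp: algebra_simps)
  then show ?thesis by (simp add: sum_subtractf sum_divide_distrib inner_vec_def)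
qed

text \<open>The vector has entries \<open>x j w j - t\<close>, where \<open>t\<close> is the average of the products \<open>x j w j\<close>; centring does not increase
  the sum of squares.\<close>

lemma noise_transpose_norm:
  fixes x w :: "real ^ 'n"
  assumes "\<And>i. (w $ i)\<^sup>2 \<le> b"
  shows "(norm (transpose (noise_matrix x) *v w))\<^sup>2 \<le> b * (norm x)\<^sup>2"
proof -
  let ?n = "real CARD('n)"
  have n: "0 < ?n" by simp
  have xw: "x \<bullet> w = (\<Sum>j\<in>UNIV. x $ j * w $ j)" by (simp add: inner_vec_def)
  define t where "t = (x \<bullet> w) / ?n"
  have t: "?n * t = x \<bullet> w" by (simp add: t_def)
  have "(norm (transpose (noise_matrix x) *v w))\<^sup>2 = (\<Sum>j\<in>UNIV. (x $ j * w $ j - t)\<^sup>2)"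
    unfolding norm_cart_squared noise_transpose_component t_def ..
  also have "\<dots> = (\<Sum>j\<in>UNIV. (x $ j * w $ j)\<^sup>2 - 2 * t * (x $ j * w $ j) + t\<^sup>2)"
    by (intro sum.cong refl) (simp add: power2_diff)
  also have "\<dots> = (\<Sum>j\<in>UNIV. (x $ j * w $ j)\<^sup>2) - (\<Sum>j\<in>UNIV. 2 * t * (x $ j * w $ j)) + ?n * t\<^sup>2"
    by (simp add: sum.distrib sum_subtractf)
  also have "(\<Sum>j\<in>UNIV. 2 * t * (x $ j * w $ j)) = 2 * t * (?n * t)"
    unfolding t xw sum_distrib_left ..
  also have "(\<Sum>j\<in>UNIV. (x $ j * w $ j)\<^sup>2) - 2 * t * (?n * t) + ?n * t\<^sup>2 = (\<Sum>j\<in>UNIV. (x $ j * w $ j)\<^sup>2) - ?n * t\<^sup>2"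
    by (simp add: power2_eq_square)
  also have "\<dots> \<le> (\<Sum>j\<in>UNIV. (x $ j * w $ j)\<^sup>2)" by simp
  also have "\<dots> \<le> (\<Sum>j\<in>UNIV. b * (x $ j)\<^sup>2)"
  proof (rule sum_mono)
    fix j show "(x $ j * w $ j)\<^sup>2 \<le> b * (x $ j)\<^sup>2"
      using mult_right_mono[OF assms[of j], of "(x $ j)\<^sup>2"] by (simp add: power_mult_distrib mult.commute)
  qed
  also have "\<dots> = b * (norm x)\<^sup>2" by (simp add: norm_cart_squared sum_distrib_left)
  finally show ?thesis .
qed

lemma noise_transpose_bounded_linear:
  "bounded_linear (\<lambda>x :: real ^ 'n. a *\<^sub>R (transpose (noise_matrix x) *v w))"
  unfolding linear_conv_bounded_linear[symmetric]
proof (rule linearI)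
  fix x y :: "real ^ 'n" and b :: real
  show "a *\<^sub>R (transpose (noise_matrix (x + y)) *v w) = a *\<^sub>R (transpose (noise_matrix x) *v w) + a *\<^sub>R (transpose (noise_matrix y) *v w)"
    unfolding vec_eq_iff vector_add_component vector_scaleR_component noise_transpose_component
    by (simp add: inner_add_left algebra_simps add_divide_distrib)
  show "a *\<^sub>R (transpose (noise_matrix (b *\<^sub>R x)) *v w) = b *\<^sub>R (a *\<^sub>R (transpose (noise_matrix x) *v w))"
    unfolding vec_eq_iff vector_scaleR_component noise_transpose_component
    by (simp add: algebra_simps)
qed

lemma diffusion_continuous:
  fixes X :: "real ^ 'd ^ 'n"
  assumes "continuous_on S f"
  shows "continuous_on S (\<lambda>s. b *\<^sub>R (transpose X ** noise_matrix (f s)))"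
proof -
  have eq: "b *\<^sub>R (transpose X ** noise_matrix (f s)) =
     (\<chi> i j. b * (\<Sum>l\<in>UNIV. transpose X $ i $ l * (f s $ l * ((if l = j then 1 else 0) - 1 / real CARD('n)))))" for s
    by (simp add: vec_eq_iff matrix_matrix_mult_def noise_matrix_component)
  show ?thesis unfolding eq using assms by (intro continuous_intros)
qed

lemma diffusion_transpose:
  fixes X :: "real ^ 'd ^ 'n"
  shows "transpose (b *\<^sub>R (transpose X ** R)) *v w = b *\<^sub>R (transpose R *v (X *v w))"
proof -
  have "transpose (b *\<^sub>R (transpose X ** R)) = b *\<^sub>R (transpose R ** X)"
    by (simp add: vec_eq_iff transpose_def matrix_matrix_mult_def mult.commute)
  then show ?thesis by (simp add: scaleR_matrix_vector_assoc matrix_vector_mul_assoc)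
qed

lemma outer_prod_mult: "outer_prod x y *v z = (y \<bullet> z) *\<^sub>R x"
  by (simp add: vec_eq_iff outer_prod_def matrix_vector_mult_def inner_vec_def sum_distrib_left mult_ac)

text \<open>The vectors \<open>u j\<close> are the left singular vectors of \<open>X\<close> that belong to nonzero singular values.\<close>

locale spectral_data =
  fixes X :: "real ^ 'd ^ 'n" and m :: nat and lam :: "nat \<Rightarrow> real" and v :: "nat \<Rightarrow> real ^ 'd" and u :: "nat \<Rightarrow> real ^ 'n"
  assumes lam_pos: "\<And>j. j \<in> {1..m} \<Longrightarrow> lam j > 0"
    and v_orthonormal: "\<And>i j. i \<in> {1..m} \<Longrightarrow> j \<in> {1..m} \<Longrightarrow> v i \<bullet> v j = (if i = j then 1 else 0)"
    and spectral: "(1 / real CARD('n)) *\<^sub>R (transpose X ** X) = (\<Sum>j=1..m. lam j *\<^sub>R outer_prod (v j) (v j))"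
    and u_def: "\<And>j. u j = (real CARD('n) * lam j) powr (- 1 / 2) *\<^sub>R (X *v v j)"
begin

lemma gram: "transpose X *v (X *v w) = real CARD('n) *\<^sub>R (\<Sum>j=1..m. (lam j * (v j \<bullet> w)) *\<^sub>R v j)"
proof -
  have sum_mult: "(\<Sum>j\<in>I. A j) *v w = (\<Sum>j\<in>I. A j *v w)" if "finite I" for A :: "nat \<Rightarrow> real ^ 'd ^ 'd" and I
    using that by (induction I rule: finite_induct) (simp_all add: matrix_vector_mult_add_rdistrib)
  have "(1 / real CARD('n)) *\<^sub>R (transpose X *v (X *v w)) = (\<Sum>j=1..m. lam j *\<^sub>R outer_prod (v j) (v j)) *v w"
    unfolding spectral[symmetric] by (simp add: scaleR_matrix_vector_assoc[symmetric] matrix_vector_mul_assoc)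
  also have "\<dots> = (\<Sum>j=1..m. (lam j * (v j \<bullet> w)) *\<^sub>R v j)"
    by (simp add: sum_mult scaleR_matrix_vector_assoc[symmetric] outer_prod_mult)
  finally have "real CARD('n) *\<^sub>R ((1 / real CARD('n)) *\<^sub>R (transpose X *v (X *v w))) = real CARD('n) *\<^sub>R (\<Sum>j=1..m. (lam j * (v j \<bullet> w)) *\<^sub>R v j)" by simp
  then show ?thesis by simp
qed

lemma image_inner: "(X *v z) \<bullet> (X *v w) = real CARD('n) * (\<Sum>j=1..m. lam j * (v j \<bullet> w) * (z \<bullet> v j))"
proof -
  have "(X *v z) \<bullet> (X *v w) = z \<bullet> (transpose X *v (X *v w))"
    unfolding inner_matrix_transpose[of z "transpose X"] transpose_transpose ..
  then show ?thesis unfolding gram by (simp add: inner_sum_right)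
qed

lemma image_inner_v: "j \<in> {1..m} \<Longrightarrow> (X *v v j) \<bullet> (X *v w) = real CARD('n) * lam j * (v j \<bullet> w)"
proof -
  assume j: "j \<in> {1..m}"
  have "(\<Sum>i=1..m. lam i * (v i \<bullet> w) * (v j \<bullet> v i)) = (\<Sum>i=1..m. if i = j then lam j * (v j \<bullet> w) else 0)"
    using v_orthonormal[OF j] by (intro sum.cong refl) auto
  then show ?thesis unfolding image_inner using j by simp
qed

lemma root_pos: "j \<in> {1..m} \<Longrightarrow> 0 < sqrt (real CARD('n) * lam j)" using lam_pos by simp

lemma u_eq: assumes j: "j \<in> {1..m}" shows "u j = (1 / sqrt (real CARD('n) * lam j)) *\<^sub>R (X *v v j)"
proof -
  have "0 < real CARD('n) * lam j" using lam_pos[OF j] by simp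
  then have "(real CARD('n) * lam j) powr (- 1 / 2) = 1 / sqrt (real CARD('n) * lam j)"
    by (simp add: powr_minus_divide powr_half_sqrt[symmetric])
  then show ?thesis by (simp add: u_def)
qed

lemma Xv_eq: "j \<in> {1..m} \<Longrightarrow> X *v v j = sqrt (real CARD('n) * lam j) *\<^sub>R u j"
  using lam_pos[of j] by (auto simp: u_eq)

lemma u_image: assumes j: "j \<in> {1..m}" shows "u j \<bullet> (X *v w) = (sqrt (real CARD('n) * lam j) *\<^sub>R v j) \<bullet> w"
proof -
  have "u j \<bullet> (X *v w) = real CARD('n) * lam j * (v j \<bullet> w) / sqrt (real CARD('n) * lam j)"
    unfolding u_eq[OF j] by (simp add: image_inner_v[OF j])
  also have "\<dots> = sqrt (real CARD('n) * lam j) * (v j \<bullet> w)"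
  proof -
    have "0 \<le> real CARD('n) * lam j" using lam_pos[OF j] by simp
    then have "real CARD('n) * lam j / sqrt (real CARD('n) * lam j) = sqrt (real CARD('n) * lam j)" by (rule real_div_sqrt)
    then show ?thesis by (metis times_divide_eq_left)
  qed
  finally show ?thesis by simp
qed

lemma u_orthonormal: assumes i: "i \<in> {1..m}" and j: "j \<in> {1..m}" shows "u i \<bullet> u j = (if i = j then 1 else 0)"
proof -
  have "u i \<bullet> u j = (u i \<bullet> (X *v v j)) / sqrt (real CARD('n) * lam j)" unfolding u_eq[OF j] by simp
  also have "\<dots> = sqrt (real CARD('n) * lam i) * (v i \<bullet> v j) / sqrt (real CARD('n) * lam j)" unfolding u_image[OF i] by simp
  finally show ?thesis using v_orthonormal[OF i j] root_pos[OF j] by auto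
qed

text \<open>The range of \<open>X\<close> is spanned by the \<open>u j\<close>: the part of \<open>w\<close> orthogonal to all \<open>v j\<close> is annihilated by the Gram
  matrix, hence by \<open>X\<close>.\<close>

lemma image_expansion: "X *v w = (\<Sum>j=1..m. (u j \<bullet> (X *v w)) *\<^sub>R u j)"
proof -
  define w' where "w' = w - (\<Sum>j=1..m. (v j \<bullet> w) *\<^sub>R v j)"
  have "v i \<bullet> w' = 0" if i: "i \<in> {1..m}" for i
  proof -
    have "(\<Sum>j=1..m. v i \<bullet> ((v j \<bullet> w) *\<^sub>R v j)) = (\<Sum>j=1..m. if j = i then v i \<bullet> w else 0)"
      using v_orthonormal[OF i] by (intro sum.cong refl) auto
    then show ?thesis unfolding w'_def inner_diff_right inner_sum_right using i by simp
  qed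
  then have "(X *v w') \<bullet> (X *v w') = 0" unfolding image_inner by simp
  then have "X *v w' = 0" by simp
  moreover have "X *v w' = X *v w - (\<Sum>j=1..m. (v j \<bullet> w) *\<^sub>R (X *v v j))"
    unfolding w'_def by (simp add: matrix_vector_mult_diff_distrib linear_sum[OF matrix_vector_mul_linear] matrix_vector_mult_scaleR)
  moreover have "(\<Sum>j=1..m. (v j \<bullet> w) *\<^sub>R (X *v v j)) = (\<Sum>j=1..m. (u j \<bullet> (X *v w)) *\<^sub>R u j)"
    by (intro sum.cong refl) (simp add: u_image Xv_eq mult.commute)
  ultimately show ?thesis by simp
qed

end

lemma exponential_kernel_mass:
  fixes g l :: "nat \<Rightarrow> real"
  assumes l: "\<And>j. j \<in> {1..m} \<Longrightarrow> 0 < l j" and g: "\<And>j. j \<in> {1..m} \<Longrightarrow> 0 \<le> g j"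
  shows "(\<integral>\<^sup>+ s. causal (\<lambda>s. \<Sum>j=1..m. g j * exp (- 2 * l j * s)) s \<partial>lborel) = ennreal (\<Sum>j=1..m. g j / (2 * l j))"
proof -
  define P where "P s = (\<Sum>j=1..m. - (g j / (2 * l j)) * exp (- 2 * l j * s))" for s
  have "(\<integral>\<^sup>+ s. ennreal (\<Sum>j=1..m. g j * exp (- 2 * l j * s)) * indicator {0..} s \<partial>lborel) = ennreal (0 - P 0)"
  proof (rule nn_integral_FTC_atLeast)
    show "(\<lambda>s. \<Sum>j=1..m. g j * exp (- 2 * l j * s)) \<in> borel_measurable borel" by measurable
    show "DERIV P s :> (\<Sum>j=1..m. g j * exp (- 2 * l j * s))" for s
    proof -
      have "DERIV P s :> (\<Sum>j=1..m. - (g j / (2 * l j)) * (exp (- 2 * l j * s) * (- 2 * l j)))"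
        unfolding P_def
      proof (intro DERIV_sum DERIV_cmult)
        show "DERIV (\<lambda>s. exp (- 2 * l j * s)) s :> exp (- 2 * l j * s) * (- 2 * l j)" for j
          by (auto intro!: derivative_eq_intros)
      qed
      also have "(\<Sum>j=1..m. - (g j / (2 * l j)) * (exp (- 2 * l j * s) * (- 2 * l j))) = (\<Sum>j=1..m. g j * exp (- 2 * l j * s))"
      proof (rule sum.cong[OF refl])
        fix j assume "j \<in> {1..m}"
        then have "l j \<noteq> 0" using l[of j] by auto
        then show "- (g j / (2 * l j)) * (exp (- 2 * l j * s) * (- 2 * l j)) = g j * exp (- 2 * l j * s)" by simp
      qed
      finally show ?thesis .
    qed
    show "0 \<le> (\<Sum>j=1..m. g j * exp (- 2 * l j * s))" for s using g by (intro sum_nonneg) auto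
    have lim: "((\<lambda>s. - (g j / (2 * l j)) * exp (- 2 * l j * s)) \<longlongrightarrow> 0) at_top" if j: "j \<in> {1..m}" for j
    proof -
      have "LIM s at_top. - 2 * l j * s :> at_bot"
        using l[OF j] filterlim_tendsto_neg_mult_at_bot[OF tendsto_const, of "- 2 * l j" "\<lambda>s. s" at_top] filterlim_ident by auto
      then have "((\<lambda>s. exp (- 2 * l j * s)) \<longlongrightarrow> 0) at_top" by (rule filterlim_compose[OF exp_at_bot])
      then show ?thesis by (rule tendsto_mult_right_zero)
    qed
    have "(P \<longlongrightarrow> (\<Sum>j=1..m. 0)) at_top" unfolding P_def by (rule tendsto_sum) (rule lim)
    then show "(P \<longlongrightarrow> 0) at_top" by simp
  qed
  then show ?thesis by (simp add: causal_def P_def sum_negf)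
qed

section \<open>The Volterra bound for the expected loss\<close>

theorem proposition3:
  fixes X :: "real ^ 'd ^ 'n"
    and \<theta>star \<theta>0 :: "real ^ 'd"
    and \<epsilon> y :: "real ^ 'n"
    and \<delta> \<gamma> \<kappa> mustar2 \<nu> :: real
    and \<Sigma> :: "real ^ 'd ^ 'd"
    and K :: "real ^ 'n ^ 'n"
    and m :: nat
    and lam mu2 :: "nat \<Rightarrow> real"
    and v :: "nat \<Rightarrow> real ^ 'd"
    and u :: "nat \<Rightarrow> real ^ 'n"
    and M :: "'w measure"
    and W :: "real \<Rightarrow> 'w \<Rightarrow> real ^ 'n"
    and \<theta> :: "real \<Rightarrow> 'w \<Rightarrow> real ^ 'd"
    and r :: "real \<Rightarrow> 'w \<Rightarrow> real ^ 'n"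
    and rbar :: "real \<Rightarrow> real ^ 'n"
    and V L k Q :: "real \<Rightarrow> real"
  assumes X_nz: "X \<noteq> 0"
    and delta_pos: "\<delta> > 0"
    and eps_bound: "norm \<epsilon> \<le> sqrt (real CARD('n)) * \<delta>"
    and y_def: "y = X *v \<theta>star + \<epsilon>"
    and gamma_pos: "\<gamma> > 0"
    and Sigma_def: "\<Sigma> = (1 / real CARD('n)) *\<^sub>R (transpose X ** X)"
    and K_def: "K = (1 / real CARD('n)) *\<^sub>R (X ** transpose X)"
    and m_def: "m = rank X"
    and lam_pos: "\<And>j. j \<in> {1..m} \<Longrightarrow> lam j > 0"
    and lam_decr: "\<And>i j. i \<in> {1..m} \<Longrightarrow> j \<in> {1..m} \<Longrightarrow> i \<le> j \<Longrightarrow> lam j \<le> lam i"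
    and v_orthonormal:
      "\<And>i j. i \<in> {1..m} \<Longrightarrow> j \<in> {1..m} \<Longrightarrow> v i \<bullet> v j = (if i = j then 1 else 0)"
    and Sigma_spectral: "\<Sigma> = (\<Sum>j=1..m. lam j *\<^sub>R outer_prod (v j) (v j))"
    and u_def: "u = (\<lambda>j. (real CARD('n) * lam j) powr (- 1 / 2) *\<^sub>R (X *v v j))"
    and kappa_def: "\<kappa> = trace K"
    and mu2_def: "mu2 = (\<lambda>j. real CARD('n) * Max (range (\<lambda>i. (u j $ i)\<^sup>2)))"
    and mustar2_def: "mustar2 = 1 / \<kappa> * (\<Sum>j=1..m. mu2 j * lam j)"
    and nu_def: "\<nu> = \<gamma> / 2 * mustar2 * \<kappa>"
    and W_bm: "brownian_motion M W"
    and theta_sol: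
      "strong_solution M W
         (\<lambda>x. - (1 / real CARD('n)) *\<^sub>R (transpose X *v (X *v x - y)))
         (\<lambda>x. sqrt (\<gamma> / real CARD('n)) *\<^sub>R (transpose X ** noise_matrix (X *v x - y)))
         \<theta>0 \<theta>"
    and r_def: "r = (\<lambda>t \<omega>. X *v \<theta> t \<omega> - y)"
    and rbar_def: "rbar = (\<lambda>t. LINT \<omega>|M. r t \<omega>)"
    and V_def: "V = (\<lambda>t. LINT \<omega>|M. (norm (r t \<omega> - rbar t))\<^sup>2)"
    and L_def: "L = (\<lambda>t. LINT \<omega>|M. (norm (r t \<omega>))\<^sup>2)"
    and k_def: "k = (\<lambda>s. \<gamma> * (\<Sum>i=1..m. mu2 i * (lam i)\<^sup>2 * exp (- 2 * lam i * s)))"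
    and Q_def: "Q = resolvent k"
  shows
    "(\<forall>t\<ge>0. integrable M (\<lambda>\<omega>. (norm (r t \<omega>))\<^sup>2) \<and>
            set_integrable lborel {0..t} (\<lambda>s. k (t - s) * L s) \<and>
            L t \<le> (norm (rbar t))\<^sup>2 + causal_conv k L t \<and>
            V t \<le> causal_conv k L t) \<and>
     set_integrable lborel {0<..} k \<and>
     L1_norm k = \<gamma> / 2 * (\<Sum>i=1..m. mu2 i * lam i) \<and>
     \<gamma> / 2 * (\<Sum>i=1..m. mu2 i * lam i) = \<gamma> / 2 * mustar2 * trace K \<and>
     \<gamma> / 2 * mustar2 * trace K = \<nu> \<and>
     (\<nu> < 1 \<longrightarrow>
        tendsto_in_L1 (\<lambda>N s. \<Sum>l=1..N. conv_power k l s) Q \<and>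
        L1_norm Q = \<nu> / (1 - \<nu>) \<and>
        (\<forall>t\<ge>0. set_integrable lborel {0..t} (\<lambda>s. Q (t - s) * (norm (rbar s))\<^sup>2) \<and>
               L t \<le> (norm (rbar t))\<^sup>2 + causal_conv Q (\<lambda>s. (norm (rbar s))\<^sup>2) t \<and>
               V t \<le> causal_conv Q (\<lambda>s. (norm (rbar s))\<^sup>2) t) \<and>
        bdd_above (L ` {0..}) \<and>
        (SUP t\<in>{0..}. L t) \<le> (norm (X *v \<theta>0 - y))\<^sup>2 / (1 - \<nu>)) \<and>
     (\<nu> \<le> 1 / 8 \<longleftrightarrow> \<gamma> * mustar2 * \<kappa> \<le> 1 / 4) \<and>
     (\<nu> \<le> 1 / 8 \<longrightarrow> L1_norm Q \<le> 1 / 7)"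
proof -
  interpret sd: spectral_data X m lam v u
    using lam_pos v_orthonormal Sigma_spectral unfolding Sigma_def u_def by unfold_locales auto
  interpret bm: brownian M W using W_bm by unfold_locales
  \<comment> \<open>The vectors \<open>aa j\<close> and the maps \<open>\<eta> j\<close> follow from \<open>u j \<bullet> X w = aa j \<bullet> w\<close> and \<open>X (aa j) = n \<lambda>\<^sub>j u j\<close>, where \<open>n\<close> is the number of
    rows: the noise of mode \<open>j\<close> has integrand \<open>sqrt (\<gamma> / n) R\<^sup>T X (aa j) = \<lambda>\<^sub>j sqrt (\<gamma> n) R\<^sup>T u j\<close>.\<close>
  define c0 where "c0 = sqrt (\<gamma> / real CARD('n))"
  define H where "H s \<omega> = c0 *\<^sub>R (transpose X ** noise_matrix (r s \<omega>))" for s \<omega>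
  define r0 where "r0 = X *v \<theta>0 - y"
  define p where "p = (\<Sum>j=1..m. (u j \<bullet> y) *\<^sub>R u j) - y"
  have r_eq: "r t \<omega> = X *v \<theta> t \<omega> - y" for t \<omega> by (simp add: r_def)
  have sol: "\<And>t. 0 \<le> t \<Longrightarrow> \<theta> t \<in> borel_measurable (bm.F t)"
    "AE \<omega> in M. continuous_on {0..} (\<lambda>t. \<theta> t \<omega>)" "AE \<omega> in M. \<theta> 0 \<omega> = \<theta>0"
    using theta_sol by (simp_all add: strong_solution_def)
  let ?b = "\<lambda>s \<omega>. - (1 / real CARD('n)) *\<^sub>R (transpose X *v r s \<omega>)"
  define noise where "noise t J \<longleftrightarrow> (0 \<le> t \<longrightarrow> is_ito_integral M bm.F W H t J \<and>
      (AE \<omega> in M. \<theta> t \<omega> = \<theta>0 + (LBINT s:{0..t}. ?b s \<omega>) + J \<omega>))" for t J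
  have "\<forall>t. \<exists>J. noise t J"
    using theta_sol unfolding strong_solution_def noise_def H_def[abs_def] c0_def r_def by blast
  then obtain J where "\<forall>t. noise t (J t)" using choice[of noise] by blast
  then have J: "\<And>t. 0 \<le> t \<Longrightarrow> is_ito_integral M bm.F W H t (J t)"
    "\<And>t. 0 \<le> t \<Longrightarrow> AE \<omega> in M. \<theta> t \<omega> = \<theta>0 + (LBINT s:{0..t}. ?b s \<omega>) + J t \<omega>"
    unfolding noise_def by blast+
  have r_cont: "AE \<omega> in M. continuous_on {0..} (\<lambda>t. r t \<omega>)"
    using sol(2)
  proof eventually_elim
    case (elim \<omega>)
    then show ?case unfolding r_eq
      by (intro continuous_on_diff continuous_on_const bounded_linear.continuous_on[OF matrix_vector_mul_bounded_linear])
  qed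
  define aa where "aa j = sqrt (real CARD('n) * lam j) *\<^sub>R v j" for j
  define g where "g j = \<gamma> * mu2 j * (lam j)\<^sup>2" for j
  define \<eta> where "\<eta> j x = (lam j * sqrt (\<gamma> * real CARD('n))) *\<^sub>R (transpose (noise_matrix x) *v u j)" for j and x :: "real ^ 'n"
  have n_pos: "0 < real CARD('n)" by simp
  have mu2_bound: "(u j $ i)\<^sup>2 \<le> mu2 j / real CARD('n)" for i j
    unfolding mu2_def using Max_ge[of "range (\<lambda>i. (u j $ i)\<^sup>2)" "(u j $ i)\<^sup>2"] n_pos by simp
  have mu2_nonneg: "0 \<le> mu2 j" for j
    using mu2_bound[of j undefined] n_pos by (meson divide_nonneg_pos not_le order_trans zero_le_divide_iff zero_le_power2)
  have g_nonneg: "0 \<le> g j" for j using gamma_pos mu2_nonneg by (simp add: g_def)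
  \<comment> \<open>The component orthogonal to the range of \<open>X\<close> depends on \<open>y\<close> only, hence is constant along the flow.\<close>
  have r0_complement: "w - (\<Sum>j=1..m. (u j \<bullet> w) *\<^sub>R u j) = p" if "w = X *v z - y" for w z
    using sd.image_expansion[of z] unfolding that p_def
    by (simp add: inner_diff_right scaleR_diff_left sum_subtractf)
  interpret md: modal_dynamics M W r H J m u aa lam g \<eta> r0 p
  proof (intro modal_dynamics.intro localized.intro localized_axioms.intro modal_dynamics_axioms.intro bm.brownian_axioms)
    show "r t \<in> borel_measurable (bm.F t)" if "0 \<le> t" for t
      unfolding r_def using sol(1)[OF that] by (intro borel_measurable_diff matrix_vector_measurable) auto
    show "AE \<omega> in M. continuous_on {0..} (\<lambda>t. r t \<omega>)" by (rule r_cont)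
    show "is_ito_integral M bm.F W H t (J t)" if "0 \<le> t" for t by (rule J(1)[OF that])
    show "AE \<omega> in M. continuous_on {0..} (\<lambda>s. H s \<omega>)"
      using r_cont unfolding H_def by eventually_elim (rule diffusion_continuous)
    show "u i \<bullet> u j = (if i = j then 1 else 0)" if "i \<in> {1..m}" "j \<in> {1..m}" for i j
      by (rule sd.u_orthonormal[OF that])
    show "0 \<le> lam j" if "j \<in> {1..m}" for j using lam_pos[OF that] by simp
    show "0 \<le> g j" if "j \<in> {1..m}" for j by (rule g_nonneg)
    show "bounded_linear (\<eta> j)" if "j \<in> {1..m}" for j unfolding \<eta>_def by (rule noise_transpose_bounded_linear)
    show "transpose (H s \<omega>) *v aa j = \<eta> j (r s \<omega>)" if j: "j \<in> {1..m}" for j s \<omega>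
    proof -
      have "transpose (H s \<omega>) *v aa j = c0 *\<^sub>R (transpose (noise_matrix (r s \<omega>)) *v (X *v aa j))"
        unfolding H_def by (rule diffusion_transpose)
      also have "X *v aa j = (real CARD('n) * lam j) *\<^sub>R u j"
        unfolding aa_def matrix_vector_mult_scaleR sd.Xv_eq[OF j] using lam_pos[OF j] by simp
      also have "c0 *\<^sub>R (transpose (noise_matrix (r s \<omega>)) *v ((real CARD('n) * lam j) *\<^sub>R u j))
          = (c0 * (real CARD('n) * lam j)) *\<^sub>R (transpose (noise_matrix (r s \<omega>)) *v u j)"
        unfolding matrix_vector_mult_scaleR by simp
      also have "c0 * (real CARD('n) * lam j) = lam j * sqrt (\<gamma> * real CARD('n))"
      proof -
        have "c0 * real CARD('n) = sqrt (\<gamma> * real CARD('n))"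
          unfolding c0_def using n_pos real_div_sqrt[of "real CARD('n)"]
          by (simp add: real_sqrt_divide real_sqrt_mult) (simp add: field_simps)
        then show ?thesis by (simp add: mult_ac)
      qed
      finally show ?thesis unfolding \<eta>_def .
    qed
    show "(norm (\<eta> j x))\<^sup>2 \<le> g j * (norm x)\<^sup>2" if j: "j \<in> {1..m}" for j x
    proof -
      have "(norm (\<eta> j x))\<^sup>2 = ((lam j)\<^sup>2 * (\<gamma> * real CARD('n))) * (norm (transpose (noise_matrix x) *v u j))\<^sup>2"
        unfolding \<eta>_def using gamma_pos by (simp add: power_mult_distrib)
      also have "\<dots> \<le> ((lam j)\<^sup>2 * (\<gamma> * real CARD('n))) * (mu2 j / real CARD('n) * (norm x)\<^sup>2)"
        using gamma_pos noise_transpose_norm[OF mu2_bound, of x j] by (intro mult_left_mono) auto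
      also have "\<dots> = g j * (norm x)\<^sup>2" by (simp add: g_def)
      finally show ?thesis .
    qed
    show "AE \<omega> in M. u j \<bullet> r t \<omega> = u j \<bullet> r0 - lam j * integral {0..t} (\<lambda>s. u j \<bullet> r s \<omega>) + aa j \<bullet> J t \<omega>"
      if j: "j \<in> {1..m}" and t: "0 \<le> t" for j t
      using J(2)[OF t] r_cont
    proof eventually_elim
      case (elim \<omega>)
      have drift: "aa j \<bullet> ?b s \<omega> = - lam j * (u j \<bullet> r s \<omega>)" for s
      proof -
        have "aa j \<bullet> (transpose X *v r s \<omega>) = (X *v aa j) \<bullet> r s \<omega>"
          unfolding inner_matrix_transpose[of "aa j" "transpose X"] transpose_transpose ..
        also have "X *v aa j = (real CARD('n) * lam j) *\<^sub>R u j"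
          unfolding aa_def matrix_vector_mult_scaleR sd.Xv_eq[OF j] using lam_pos[OF j] by simp
        finally show ?thesis by simp
      qed
      have cont: "continuous_on {0..t} (\<lambda>s. r s \<omega>)" using elim(2) by (rule continuous_on_subset) auto
      have "continuous_on {0..t} (\<lambda>s. ?b s \<omega>)"
        by (intro continuous_on_scaleR continuous_on_const bounded_linear.continuous_on[OF matrix_vector_mul_bounded_linear] cont)
      then have bi: "set_integrable lborel {0..t} (\<lambda>s. ?b s \<omega>)" by (rule borel_integrable_atLeastAtMost')
      have "continuous_on {0..t} (\<lambda>s. - lam j * (u j \<bullet> r s \<omega>))" using cont by (intro continuous_intros)
      then have ui: "set_integrable lborel {0..t} (\<lambda>s. - lam j * (u j \<bullet> r s \<omega>))" by (rule borel_integrable_atLeastAtMost')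
      have "aa j \<bullet> (LBINT s:{0..t}. ?b s \<omega>) = (LBINT s:{0..t}. aa j \<bullet> ?b s \<omega>)"
        using bi unfolding set_lebesgue_integral_def set_integrable_def
        by (subst integral_inner_right[symmetric]) (simp_all only: inner_scaleR_right real_scaleR_def)
      also have "\<dots> = integral {0..t} (\<lambda>s. - lam j * (u j \<bullet> r s \<omega>))"
        unfolding drift using set_borel_integral_eq_integral(2)[OF ui] by simp
      finally have I: "aa j \<bullet> (LBINT s:{0..t}. ?b s \<omega>) = - lam j * integral {0..t} (\<lambda>s. u j \<bullet> r s \<omega>)" by simp
      have img: "u j \<bullet> (X *v w) = aa j \<bullet> w" for w unfolding aa_def by (rule sd.u_image[OF j])
      have "u j \<bullet> r t \<omega> = aa j \<bullet> \<theta> t \<omega> - u j \<bullet> y" unfolding r_eq inner_diff_right img ..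
      also have "aa j \<bullet> \<theta> t \<omega> = aa j \<bullet> \<theta>0 + aa j \<bullet> (LBINT s:{0..t}. ?b s \<omega>) + aa j \<bullet> J t \<omega>"
        by (subst elim(1)) (simp only: inner_add_right)
      also have "aa j \<bullet> \<theta>0 = u j \<bullet> r0 + u j \<bullet> y" unfolding r0_def inner_diff_right img by simp
      finally show ?case unfolding I by simp
    qed
    show "AE \<omega> in M. r 0 \<omega> = r0" using sol(3) by eventually_elim (simp add: r_eq r0_def)
    show "r t \<omega> - (\<Sum>j=1..m. (u j \<bullet> r t \<omega>) *\<^sub>R u j) = p" for t \<omega> by (rule r0_complement[OF r_eq])
    show "r0 - (\<Sum>j=1..m. (u j \<bullet> r0) *\<^sub>R u j) = p" by (rule r0_complement[OF r0_def])
  qed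
  have k_eq: "md.k = k" unfolding md.k_def[abs_def] k_def g_def by (simp add: sum_distrib_left mult.assoc)
  have L_eq: "md.L = L" unfolding md.L_def[abs_def] L_def ..
  have rbar_eq: "rbar t = md.mean_path t" if "0 \<le> t" for t
    using md.mean_residual[OF that] by (simp add: rbar_def)
  have V_eq: "V t = bm.expectation (\<lambda>\<omega>. (norm (r t \<omega> - md.mean_path t))\<^sup>2)" if "0 \<le> t" for t
    using rbar_eq[OF that] by (simp add: V_def)
  have V_le: "V t \<le> causal_conv k L t" if "0 \<le> t" for t
    using md.variance_bound(2)[OF that] unfolding V_eq[OF that] k_eq L_eq .
  have L_split: "L t = (norm (rbar t))\<^sup>2 + V t" if "0 \<le> t" for t
    using md.L_decomposition[OF that] unfolding V_eq[OF that] rbar_eq[OF that] L_eq .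
  have L_le: "L t \<le> (norm (rbar t))\<^sup>2 + causal_conv k L t" if "0 \<le> t" for t
    using V_le[OF that] L_split[OF that] by linarith
  have part1: "\<forall>t\<ge>0. integrable M (\<lambda>\<omega>. (norm (r t \<omega>))\<^sup>2) \<and>
            set_integrable lborel {0..t} (\<lambda>s. k (t - s) * L s) \<and>
            L t \<le> (norm (rbar t))\<^sup>2 + causal_conv k L t \<and> V t \<le> causal_conv k L t"
    using md.second_moment(1) md.kernel_L_integrable[unfolded k_eq L_eq] L_le V_le by blast
  define S where "S = \<gamma> / 2 * (\<Sum>i=1..m. mu2 i * lam i)"
  have "(\<Sum>j=1..m. g j / (2 * lam j)) = S"
    unfolding S_def sum_distrib_left
  proof (rule sum.cong[OF refl])
    fix j assume "j \<in> {1..m}"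
    then have "lam j \<noteq> 0" using lam_pos[of j] by auto
    then show "g j / (2 * lam j) = \<gamma> / 2 * (mu2 j * lam j)" by (simp add: g_def power2_eq_square)
  qed
  then have mass: "(\<integral>\<^sup>+ s. causal k s \<partial>lborel) = ennreal S"
    using exponential_kernel_mass[of m lam g] lam_pos g_nonneg unfolding k_eq[symmetric] md.k_def[abs_def] by simp
  have S_nonneg: "0 \<le> S"
    unfolding S_def using gamma_pos mu2_nonneg lam_pos by (intro mult_nonneg_nonneg sum_nonneg) (auto simp: less_imp_le)
  have k_nonneg: "0 \<le> k s" for s using md.k_nonneg[of s] unfolding k_eq .
  have k_meas: "k \<in> borel_measurable borel"
    using md.k_continuous[of UNIV] unfolding k_eq by (rule borel_measurable_continuous_onI)
  note k_mass = half_line_mass[OF causal_measurable[OF k_meas] k_nonneg mass S_nonneg]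
  have trace_pos: "0 < trace K"
  proof -
    have "trace K = (1 / real CARD('n)) * (norm X)\<^sup>2"
      unfolding K_def norm_matrix_squared trace_def
      by (simp add: matrix_matrix_mult_def transpose_def power2_eq_square sum_distrib_left)
    then show ?thesis using X_nz by simp
  qed
  have trace_eq: "S = \<gamma> / 2 * mustar2 * trace K"
    unfolding S_def mustar2_def kappa_def using trace_pos by simp
  have nu_eq: "\<gamma> / 2 * mustar2 * trace K = \<nu>" unfolding nu_def kappa_def ..
  have nu_S: "\<nu> = S" unfolding trace_eq nu_eq ..
  have part3: "tendsto_in_L1 (\<lambda>N s. \<Sum>l=1..N. conv_power k l s) Q \<and>
        L1_norm Q = \<nu> / (1 - \<nu>) \<and>
        (\<forall>t\<ge>0. set_integrable lborel {0..t} (\<lambda>s. Q (t - s) * (norm (rbar s))\<^sup>2) \<and>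
               L t \<le> (norm (rbar t))\<^sup>2 + causal_conv Q (\<lambda>s. (norm (rbar s))\<^sup>2) t \<and>
               V t \<le> causal_conv Q (\<lambda>s. (norm (rbar s))\<^sup>2) t) \<and>
        bdd_above (L ` {0..}) \<and>
        (SUP t\<in>{0..}. L t) \<le> (norm (X *v \<theta>0 - y))\<^sup>2 / (1 - \<nu>)" if nu1: "\<nu> < 1"
  proof -
    interpret sk: subcritical_kernel k "k 0" \<nu>
      using k_meas k_nonneg md.k_le mass S_nonneg nu1 unfolding k_eq nu_S by unfold_locales auto
    define \<rho> where "\<rho> = (\<lambda>s. (norm (rbar s))\<^sup>2)"
    have \<rho>_bd: "\<rho> s \<le> (norm r0)\<^sup>2" if "0 \<le> s" for s
      unfolding \<rho>_def rbar_eq[OF that] using md.mean_path_norm[OF that] by (intro power_mono) auto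
    have "causal \<rho> = causal (\<lambda>s. (norm (md.mean_path s))\<^sup>2)"
      using rbar_eq by (auto simp: causal_def \<rho>_def indicator_def)
    moreover have "(\<lambda>s. (norm (md.mean_path s))\<^sup>2) \<in> borel_measurable borel"
      using md.mean_path_continuous[of UNIV] by (intro borel_measurable_continuous_onI continuous_intros)
    ultimately have \<rho>_meas: "causal \<rho> \<in> borel_measurable borel" using causal_measurable by simp
    have L_nn: "0 \<le> L s" for s using md.L_nonneg[of s] unfolding L_eq .
    have \<rho>_nn: "0 \<le> \<rho> s" for s by (simp add: \<rho>_def)
    have ineq: "L t \<le> \<rho> t + causal_conv k L t" if "0 \<le> t" for t using L_le[OF that] by (simp add: \<rho>_def)
    note volterra = sk.volterra[OF md.causal_L_measurable[unfolded L_eq] \<rho>_meas L_nn md.L_bounded[unfolded L_eq] \<rho>_nn \<rho>_bd ineq]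
    have vol: "set_integrable lborel {0..t} (\<lambda>s. Q (t - s) * \<rho> s)" "L t \<le> \<rho> t + causal_conv Q \<rho> t"
      "causal_conv k L t \<le> causal_conv Q \<rho> t" "causal_conv Q \<rho> t \<le> (norm r0)\<^sup>2 * (\<nu> / (1 - \<nu>))"
      if "0 \<le> t" for t
      unfolding Q_def using volterra(2-5) that by blast+
    have sup: "L t \<le> (norm r0)\<^sup>2 / (1 - \<nu>)" if "0 \<le> t" for t
    proof -
      have "L t \<le> (norm r0)\<^sup>2 + (norm r0)\<^sup>2 * (\<nu> / (1 - \<nu>))"
        using vol(2)[OF that] vol(4)[OF that] \<rho>_bd[OF that] by linarith
      also have "\<dots> = (norm r0)\<^sup>2 / (1 - \<nu>)" using nu1 by (simp add: field_simps)
      finally show ?thesis .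
    qed
    have "\<forall>t\<ge>0. set_integrable lborel {0..t} (\<lambda>s. Q (t - s) * \<rho> s) \<and>
               L t \<le> \<rho> t + causal_conv Q \<rho> t \<and> V t \<le> causal_conv Q \<rho> t"
      using vol(1-3) V_le by (meson order_trans)
    then show ?thesis
      using sk.resolvent_converges sk.Q_integral(3) sup unfolding Q_def[symmetric] \<rho>_def r0_def
      by (auto intro!: cSUP_least bdd_aboveI2)
  qed
  have part4: "L1_norm Q \<le> 1 / 7" if "\<nu> \<le> 1 / 8"
  proof -
    have "L1_norm Q = \<nu> / (1 - \<nu>)" using part3 that by simp
    also have "\<dots> \<le> 1 / 7" using that by (simp add: field_simps)
    finally show ?thesis .
  qed
  have iff: "\<nu> \<le> 1 / 8 \<longleftrightarrow> \<gamma> * mustar2 * \<kappa> \<le> 1 / 4" unfolding nu_def by (simp add: mult_ac)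
  show ?thesis
    using part1 k_mass(1,3) trace_eq nu_eq part3 part4 iff unfolding S_def by blast
qed

end
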